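(* Let $p$ be an odd prime and let $Q$ be a $4\times4$ positive definite even quadratic form of level $p$ with square determinant. Then, in degree two, $\vartheta^Q|\mathrm{Tr}=0$.
   Context: A $4\times4$ symmetric integral matrix $Q$ is even if its diagonal entries are even; it has level $p$ if $p$ is the least positive integer with $pQ^{-1}$ even integral. The degree two theta series is $\vartheta^Q(\Omega)=\sum_{N\in\mathbb Z^{4\times2}}e\left(\tfrac12\mathrm{tr}(N'QN\,\Omega)\right)$, $e(z)=e^{2\pi iz}$, $\Omega$ in the Siegel upper half space of degree $2$; it lies in $M_2^2(\Gamma_0(p))$, $\Gamma_0(p)=\{\begin{pmatrix}A&B\\C&D\end{pmatrix}\in\mathrm{Sp}_2(\mathbb Z):C\equiv0\bmod p\}$. $\mathrm{Tr}:M_2^k(\Gamma_0(p))\to M_2^k(K(p))$, $K(p)=\mathrm{Sp}_2(\mathbb Q)\cap\begin{pmatrix} * & * & */p & *\\ p* & * & * & *\\ p* & p* & * & p*\\ p* & * & * & *\end{pmatrix}$ ($*\in\mathbb Z$), is the operator $f|\mathrm{Tr}=\sum_{\beta\bmod p}f|t\begin{pmatrix}\beta/p&0\\0&0\end{pmatrix}+(f|E_1)|\tilde\mu+\sum_{\alpha,\beta\bmod p}(f|E_1)|t\begin{pmatrix}\beta/p&0\\0&\alpha\end{pmatrix}+\sum_{\alpha\bmod p}(f|F_p)|\mu\,t\begin{pmatrix}0&0\\0&\alpha\end{pmatrix}$ (equivalently, the composite of the Hecke double coset operators $[B(p)\Gamma_0'(p)]$ and $[\Gamma_0'(p)K(p)]$,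 where $\Gamma_0'(p)=K(p)\cap\mathrm{Sp}_2(\mathbb Z)$ and $B(p)$ is the Iwahori subgroup). Here $(f|_k\gamma)(\Omega)=\mu(\gamma)^{2k-3}\det(C\Omega+D)^{-k}f((A\Omega+B)(C\Omega+D)^{-1})$ with $\mu(\gamma)$ the symplectic multiplier, $t(S)=\begin{pmatrix}I_2&S\\0&I_2\end{pmatrix}$, $E_1=\begin{pmatrix}1&0&0&0\\0&0&0&1\\0&0&1&0\\0&-1&0&0\end{pmatrix}$, $F_p=\frac1{\sqrt p}\begin{pmatrix}0&I_2\\-pI_2&0\end{pmatrix}$, $\mu=\frac1{\sqrt p}\begin{pmatrix}0&1&0&0\\-p&0&0&0\\0&0&0&p\\0&0&-1&0\end{pmatrix}$, $\tilde\mu=\begin{pmatrix}0&1&0&0\\-p&0&0&0\\0&0&0&1\\0&0&-1/p&0\end{pmatrix}$. *)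

theory Defs
  imports "HOL-Analysis.Analysis" "HOL-Computational_Algebra.Primes"
begin

definition even_integral :: "int^'n^'n \<Rightarrow> bool" where
  "even_integral Q \<longleftrightarrow> transpose Q = Q \<and> (\<forall>i. even (Q $ i $ i))"

definition pos_def :: "real^'n^'n \<Rightarrow> bool" where
  "pos_def M \<longleftrightarrow> transpose M = M \<and> (\<forall>x. x \<noteq> 0 \<longrightarrow> x \<bullet> (M *v x) > 0)"

abbreviation real_mat :: "int^'n^'m \<Rightarrow> real^'n^'m" where
  "real_mat \<equiv> map_matrix real_of_int"

abbreviation cplx_mat :: "real^'n^'m \<Rightarrow> complex^'n^'m" where
  "cplx_mat \<equiv> map_matrix complex_of_real"

definition inverse_scaled_even :: "int^'n^'n \<Rightarrow> nat \<Rightarrow> bool" where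
  "inverse_scaled_even Q n \<longleftrightarrow>
     (\<exists>P. even_integral P \<and> real n *\<^sub>R matrix_inv (real_mat Q) = real_mat P)"

definition has_level :: "int^'n^'n \<Rightarrow> nat \<Rightarrow> bool" where
  "has_level Q n \<longleftrightarrow> n > 0 \<and> inverse_scaled_even Q n \<and>
     (\<forall>m>0. inverse_scaled_even Q m \<longrightarrow> n \<le> m)"

definition siegel_upper_half :: "(complex^2^2) set" where
  "siegel_upper_half = {\<Omega>. transpose \<Omega> = \<Omega> \<and> pos_def (map_matrix Im \<Omega>)}"

definition theta2 :: "int^'n^'n \<Rightarrow> complex^2^2 \<Rightarrow> complex" where
  "theta2 Q \<Omega> = (\<Sum>\<^sub>\<infinity>N\<in>(UNIV :: (int^2^'n) set).
     exp (2 * of_real pi * \<i> * (1 / 2 * trace (map_matrix of_int (transpose N ** Q ** N) ** \<Omega>))))"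

definition block_A :: "real^4^4 \<Rightarrow> real^2^2" where
  "block_A g = vector [vector [g$1$1, g$1$2], vector [g$2$1, g$2$2]]"

definition block_B :: "real^4^4 \<Rightarrow> real^2^2" where
  "block_B g = vector [vector [g$1$3, g$1$4], vector [g$2$3, g$2$4]]"

definition block_C :: "real^4^4 \<Rightarrow> real^2^2" where
  "block_C g = vector [vector [g$3$1, g$3$2], vector [g$4$1, g$4$2]]"

definition block_D :: "real^4^4 \<Rightarrow> real^2^2" where
  "block_D g = vector [vector [g$3$3, g$3$4], vector [g$4$3, g$4$4]]"

definition symp_J :: "real^4^4" where
  "symp_J = vector [vector [ 0,  0, 1, 0],
                    vector [ 0,  0, 0, 1],
                    vector [-1,  0, 0, 0],
                    vector [ 0, -1, 0, 0]]"

definition multiplier :: "real^4^4 \<Rightarrow> real" where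
  "multiplier g = (THE m. transpose g ** symp_J ** g = m *\<^sub>R symp_J)"

definition slash :: "int \<Rightarrow> (complex^2^2 \<Rightarrow> complex) \<Rightarrow> real^4^4 \<Rightarrow> complex^2^2 \<Rightarrow> complex" where
  "slash k f g \<Omega> =
     (let A = cplx_mat (block_A g); B = cplx_mat (block_B g);
          C = cplx_mat (block_C g); D = cplx_mat (block_D g)
      in of_real (multiplier g powi (2 * k - 3)) * det (C ** \<Omega> + D) powi (- k)
           * f ((A ** \<Omega> + B) ** matrix_inv (C ** \<Omega> + D)))"

definition t_mat :: "real^2^2 \<Rightarrow> real^4^4" where
  "t_mat S = vector [vector [1, 0, S$1$1, S$1$2],
                     vector [0, 1, S$2$1, S$2$2],
                     vector [0, 0, 1,     0],
                     vector [0, 0, 0,     1]]"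

definition diag2 :: "real \<Rightarrow> real \<Rightarrow> real^2^2" where
  "diag2 a d = vector [vector [a, 0], vector [0, d]]"

definition E1_mat :: "real^4^4" where
  "E1_mat = vector [vector [1,  0, 0, 0],
                    vector [0,  0, 0, 1],
                    vector [0,  0, 1, 0],
                    vector [0, -1, 0, 0]]"

definition F_mat :: "nat \<Rightarrow> real^4^4" where
  "F_mat p = (1 / sqrt (real p)) *\<^sub>R
     vector [vector [0,         0,        1, 0],
             vector [0,         0,        0, 1],
             vector [- real p,  0,        0, 0],
             vector [0,         - real p, 0, 0]]"

definition mu_mat :: "nat \<Rightarrow> real^4^4" where
  "mu_mat p = (1 / sqrt (real p)) *\<^sub>R
     vector [vector [0,        1,  0, 0],
             vector [- real p, 0,  0, 0],
             vector [0,        0,  0, real p],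
             vector [0,        0, -1, 0]]"

definition mu_tilde_mat :: "nat \<Rightarrow> real^4^4" where
  "mu_tilde_mat p =
     vector [vector [0,        1, 0,            0],
             vector [- real p, 0, 0,            0],
             vector [0,        0, 0,            1],
             vector [0,        0, - 1 / real p, 0]]"

text \<open>On forms for \<open>\<Gamma>\<^sub>0(p)\<close> the summands depend only on \<open>\<alpha>\<close> and \<open>\<beta>\<close> modulo \<open>p\<close>; the
  representatives \<open>0, \<dots>, p - 1\<close> are used.\<close>

definition Tr_op :: "int \<Rightarrow> nat \<Rightarrow> (complex^2^2 \<Rightarrow> complex) \<Rightarrow> complex^2^2 \<Rightarrow> complex" where
  "Tr_op k p f \<Omega> =
     (\<Sum>\<beta><p. slash k f (t_mat (diag2 (real \<beta> / real p) 0)) \<Omega>)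
   + slash k (slash k f E1_mat) (mu_tilde_mat p) \<Omega>
   + (\<Sum>\<alpha><p. \<Sum>\<beta><p. slash k (slash k f E1_mat) (t_mat (diag2 (real \<beta> / real p) (real \<alpha>))) \<Omega>)
   + (\<Sum>\<alpha><p. slash k (slash k f (F_mat p)) (mu_mat p ** t_mat (diag2 0 (real \<alpha>))) \<Omega>)"

end

theory Submission
  imports Defs "HOL-Complex_Analysis.Cauchy_Integral_Formula" "HOL-Real_Asymp.Real_Asymp"
begin

text \<open>Write \<open>L = \<int>\<^sup>4\<close> with the form \<open>Q\<close>, \<open>L'\<close> for its dual, and \<open>\<Theta>(A, B)\<close> for the degree two
  theta series over \<open>A \<times> B\<close>. An even unimodular positive definite lattice of rank four does not
  exist, since its theta series would be modular of weight two with the wrong sign. This forces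
  \<open>det Q = p\<^sup>2\<close> and makes the discriminant form \<open>L' / L\<close> anisotropic: an isotropic vector would
  generate a unimodular overlattice. Inverting the theta series in one or in both columns turns a
  factor \<open>L\<close> into \<open>L'\<close> (with sign \<open>-1\<close> per column, the rank being four), and each sum over \<open>\<alpha>\<close> or
  \<open>\<beta>\<close> selects, by anisotropy, \<open>L\<close> inside \<open>L'\<close> or \<open>p L'\<close> inside \<open>L\<close>. The four summands of the
  trace thus become \<open>p \<Theta>\<close>, \<open>- p \<Theta>\<close>, \<open>- p \<Theta>\<close> and \<open>p \<Theta>\<close> with \<open>\<Theta> = \<Theta>(p L', L)\<close>.

  Theta inversion is reduced to one variable. There, an entire function of period one is the sum of
  its Fourier series, the coefficients follow from quasi-periodicity, and the remaining constant is
  found by rotating the line of integration to the case \<open>\<tau> = \<i>\<close>.\<close>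

section \<open>Fourier series of entire periodic functions\<close>

text \<open>The products of \<open>Q\<close> and P = p Q^(-1) are p, so their determinants multiply
  to p^4; a square determinant leaves 1, p^2 or p^4 for det Q, and the two extremes would make Q or
  P even unimodular. The value p^2 then enters twice: an overlattice of index p becomes unimodular,
  and every inversion of a column carries the factor sqrt (det Q) = p, which balances the factors p
  of the character sums. Each sum over \<alpha> or \<beta> tests only whether a norm is divisible by
  p. Anisotropy is what converts this quadratic condition into membership in a sublattice, so that
  the result is again a theta series, with one of its two factors replaced; since Q and P both have
  determinant p^2, it is available for both. The reduction to one variable uses a triangular change
  of coordinates. The sum over each integer variable is then a Gaussian sum with a real shift
  determined by the other variables, and inverting it produces a character of modulus one that the
  remaining Gaussians absorb. The one unknown constant is fixed at \<i>, where the inversion formula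
  relates a nonzero value to itself.\<close>

definition cexp1 :: "complex \<Rightarrow> complex" where
  "cexp1 z = exp (2 * of_real pi * \<i> * z)"

lemma cexp1_add: "cexp1 (x + y) = cexp1 x * cexp1 y"
  by (simp add: cexp1_def ring_distribs exp_add)

lemma cexp1_minus: "cexp1 (- x) = inverse (cexp1 x)"
  by (simp add: cexp1_def exp_minus)

lemma cexp1_eq_1_iff: "cexp1 z = 1 \<longleftrightarrow> z \<in> \<int>"
proof -
  have "cexp1 z = 1 \<longleftrightarrow> (\<exists>n::int. 2 * of_real pi * \<i> * z = of_real (of_int (2 * n) * pi) * \<i>)"
    unfolding cexp1_def exp_eq_1 by (auto simp: complex_eq_iff)
  also have "\<dots> \<longleftrightarrow> (\<exists>n::int. z = of_int n)"
    by (auto simp: field_simps)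
  finally show ?thesis
    by (auto simp: Ints_def)
qed

lemma cexp1_of_int [simp]: "cexp1 (of_int n) = 1"
  by (simp add: cexp1_eq_1_iff)

lemma cexp1_0 [simp]: "cexp1 0 = 1" and cexp1_1 [simp]: "cexp1 1 = 1"
  by (simp_all add: cexp1_eq_1_iff)

lemma cexp1_nonzero [simp]: "cexp1 z \<noteq> 0"
  by (simp add: cexp1_def)

lemma norm_cexp1: "norm (cexp1 z) = exp (- 2 * pi * Im z)"
  by (simp add: cexp1_def)

lemma cexp1_holomorphic [holomorphic_intros]:
  "f holomorphic_on A \<Longrightarrow> (\<lambda>z. cexp1 (f z)) holomorphic_on A"
  unfolding cexp1_def by (intro holomorphic_intros)

section \<open>Primitives of entire functions and integrals over one period\<close>

lemma entire_primitive:
  fixes f :: "complex \<Rightarrow> complex"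
  assumes "f holomorphic_on UNIV"
  obtains A where "\<And>z. (A has_field_derivative f z) (at z)"
  using holomorphic_convex_primitive'[of UNIV f] assms by auto

definition period_integral :: "(complex \<Rightarrow> complex) \<Rightarrow> complex" where
  "period_integral f = contour_integral (linepath 0 1) f"

lemma period_integral_primitive:
  assumes "\<And>z. (A has_field_derivative f z) (at z)"
  shows "period_integral f = A 1 - A 0"
  using contour_integral_primitive[of UNIV A f "linepath 0 1"] assms
  by (simp add: period_integral_def contour_integral_unique)

text \<open>\<open>A (z + 1) - A z\<close> has derivative zero, so the integral over the segment
  from \<open>w\<close> to \<open>w + 1\<close> is the same for every complex \<open>w\<close>. This
  takes the place of moving a contour up or down.\<close>

lemma period_integral_primitive_shift:
  assumes A: "\<And>z. (A has_field_derivative f z) (at z)"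
    and per: "\<And>z. f (z + 1) = f z"
  shows "A (w + 1) - A w = period_integral f"
proof -
  have "((\<lambda>z. A (z + 1) - A z) has_field_derivative 0) (at z)" for z
    using DERIV_diff[OF A[of "z + 1", unfolded DERIV_shift] A[of z]] by (simp add: per)
  then obtain c where "\<And>z. A (z + 1) - A z = c"
    using has_field_derivative_zero_constant[of UNIV "\<lambda>z. A (z + 1) - A z"] by auto
  from this[of w] this[of 0] show ?thesis
    by (simp add: period_integral_primitive[OF A])
qed

lemma period_integral_translate:
  assumes hol: "f holomorphic_on UNIV" and per: "\<And>z. f (z + 1) = f z"
  shows "period_integral (\<lambda>z. c * f (z + w)) = c * period_integral f"
proof -
  obtain A where A: "\<And>z. (A has_field_derivative f z) (at z)"
    using entire_primitive[OF hol] by blast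
  have "((\<lambda>z. c * A (z + w)) has_field_derivative c * f (z + w)) (at z)" for z
    using A[of "z + w", unfolded DERIV_shift] by (rule DERIV_cmult)
  then have "period_integral (\<lambda>z. c * f (z + w)) = c * (A (w + 1) - A w)"
    by (subst period_integral_primitive) (auto simp: algebra_simps)
  then show ?thesis
    by (simp add: period_integral_primitive_shift[OF A per])
qed

lemma period_integral_diff:
  assumes "f holomorphic_on UNIV" "g holomorphic_on UNIV"
  shows "period_integral (\<lambda>z. f z - g z) = period_integral f - period_integral g"
proof -
  obtain A B where A: "\<And>z. (A has_field_derivative f z) (at z)"
    and B: "\<And>z. (B has_field_derivative g z) (at z)"
    using entire_primitive assms by metis
  have "((\<lambda>z. A z - B z) has_field_derivative f z - g z) (at z)" for z
    by (intro derivative_intros A B)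
  from period_integral_primitive[OF this] show ?thesis
    by (simp add: period_integral_primitive[OF A] period_integral_primitive[OF B])
qed

lemma period_integral_bound:
  assumes hol: "f holomorphic_on UNIV" and per: "\<And>z. f (z + 1) = f z"
    and bound: "\<And>z. z \<in> closed_segment w (w + 1) \<Longrightarrow> norm (f z) \<le> B"
  shows "norm (period_integral f) \<le> B"
proof -
  obtain A where A: "\<And>z. (A has_field_derivative f z) (at z)"
    using entire_primitive[OF hol] by blast
  have "norm (A (w + 1) - A w) \<le> B * norm (w + 1 - w)"
    by (rule field_differentiable_bound[where S = "closed_segment w (w + 1)" and f' = f])
       (auto intro: has_field_derivative_at_within A bound)
  then show ?thesis
    by (simp add: period_integral_primitive_shift[OF A per])
qed

lemma segment_Im:
  assumes "z \<in> closed_segment w (w + 1)"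
  shows "Im z = Im w"
  using assms by (auto simp: closed_segment_def algebra_simps)

text \<open>Moving the segment of integration up or down makes the Fourier coefficients of an entire
  periodic function decay.\<close>

lemma fourier_coeff_tendsto_0:
  assumes hol: "H holomorphic_on UNIV" and per: "\<And>z. H (z + 1) = H z" and s: "s = 1 \<or> s = -1"
  shows "(\<lambda>n. period_integral (\<lambda>z. H z * cexp1 (- (of_int (s * int n) * z)))) \<longlonglongrightarrow> 0"
proof -
  \<comment> \<open>On the line Im z = - s the exponential factor has modulus exp (2 pi s n Im z) =
    exp (- 2 pi n), because s^2 = 1.\<close>
  define w where "w = - of_int s * \<i>"
  have "compact (H ` closed_segment w (w + 1))"
    by (intro compact_continuous_image holomorphic_on_imp_continuous_on holomorphic_on_subset[OF hol]) auto
  then obtain B where B: "\<And>z. z \<in> closed_segment w (w + 1) \<Longrightarrow> norm (H z) \<le> B"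
    using compact_imp_bounded[of "H ` closed_segment w (w + 1)"] by (auto simp: bounded_iff)
  have bnd: "norm (period_integral (\<lambda>z. H z * cexp1 (- (of_int (s * int n) * z)))) \<le> B * exp (- 2 * pi) ^ n" for n
  proof (rule period_integral_bound[where w = w])
    show "(\<lambda>z. H z * cexp1 (- (of_int (s * int n) * z))) holomorphic_on UNIV"
      by (intro holomorphic_intros hol)
    show "H (z + 1) * cexp1 (- (of_int (s * int n) * (z + 1))) = H z * cexp1 (- (of_int (s * int n) * z))" for z
    proof -
      have "cexp1 (- (of_int (s * int n) * (z + 1))) = cexp1 (- (of_int (s * int n) * z)) * cexp1 (of_int (- (s * int n)))"
        unfolding cexp1_add[symmetric] by (simp add: algebra_simps)
      then show ?thesis
        by (simp only: per cexp1_of_int mult_1_right)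
    qed
    fix z assume z: "z \<in> closed_segment w (w + 1)"
    have "Im z = - of_int s"
      using segment_Im[OF z] by (simp add: w_def)
    then have "Im (of_int (s * int n) * z) = - real n"
      using s by auto
    then have "norm (cexp1 (- (of_int (s * int n) * z))) = exp (- 2 * pi) ^ n"
      by (simp add: norm_cexp1 exp_of_nat_mult[symmetric] mult_ac)
    then show "norm (H z * cexp1 (- (of_int (s * int n) * z))) \<le> B * exp (- 2 * pi) ^ n"
      using B[OF z] by (simp add: norm_mult mult_right_mono)
  qed
  have "(\<lambda>n. exp (- 2 * pi) ^ n) \<longlonglongrightarrow> 0"
    by (rule LIMSEQ_power_zero) simp
  then have lim: "(\<lambda>n. B * exp (- 2 * pi) ^ n) \<longlonglongrightarrow> 0"
    by (rule tendsto_mult_right_zero)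
  show ?thesis
    by (rule Lim_null_comparison[OF always_eventually lim]) (use bnd in blast)
qed

text \<open>The zeros of \<open>1 - cexp1 (- z)\<close> are simple and lie at the integers, where
  \<open>E\<close> vanishes as well by periodicity, so the quotient is entire. Multiplication by
  this factor is what makes Fourier coefficients telescope in
  \<open>fourier_inversion_entire\<close>.\<close>

lemma entire_periodic_divide:
  assumes hol: "E holomorphic_on UNIV" and per: "\<And>z. E (z + 1) = E z" and E0: "E 0 = 0"
  obtains H where "H holomorphic_on UNIV" "\<And>z. H (z + 1) = H z" "\<And>z. E z = (1 - cexp1 (-z)) * H z"
proof -
  define g where "g = (\<lambda>z. 1 - cexp1 (- z))"
  \<comment> \<open>The removable value is the quotient of the derivatives at 0; periodicity makes
    it the same at every integer.\<close>
  define H where "H = (\<lambda>z. if g z = 0 then deriv E 0 / deriv g 0 else E z / g z)"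
  have holg: "g holomorphic_on UNIV"
    unfolding g_def by (intro holomorphic_intros)
  have g0: "g z = 0 \<longleftrightarrow> z \<in> \<int>" for z
    using cexp1_eq_1_iff[of "-z"] by (auto simp: g_def)
  have gper: "g (z + 1) = g z" for z
    by (simp add: g_def cexp1_minus cexp1_add)
  have Hper: "H (z + 1) = H z" for z
    by (simp add: H_def gper per)
  have Eint: "E (of_int n) = 0" for n
  proof (induction n rule: int_induct[where k = 0])
    case (step2 i)
    with per[of "of_int (i - 1)"] show ?case by simp
  qed (auto simp: E0 per)
  have dg: "(g has_field_derivative 2 * of_real pi * \<i>) (at 0)"
    unfolding g_def cexp1_def by (auto intro!: derivative_eq_intros)
  \<comment> \<open>After division by \<open>z\<close> both \<open>E\<close> and \<open>g\<close>
    stay entire, and \<open>g\<close> loses its only zero in the unit ball since its derivative at 0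
    is 2 pi i. So \<open>H\<close> is holomorphic there, and periodicity carries this to the other
    integers.\<close>
  define psi where "psi = (\<lambda>z. if z = 0 then deriv E 0 else E z / z)"
  define phi where "phi = (\<lambda>z. if z = 0 then deriv g 0 else g z / z)"
  have psi: "psi holomorphic_on UNIV"
    using pole_theorem[OF hol, of 0 "\<lambda>z. E z / z"] by (simp add: psi_def E0 cong: if_cong)
  have phi: "phi holomorphic_on UNIV"
    using pole_theorem[OF holg, of 0 "\<lambda>z. g z / z"] g0[of 0] by (simp add: phi_def cong: if_cong)
  have small: "z \<in> \<int> \<longleftrightarrow> z = 0" if "norm z < 1" for z :: complex
    using that by (auto elim!: Ints_cases)
  have ph0: "phi z \<noteq> 0" if "z \<in> ball 0 1" for z
    using that small[of z] DERIV_imp_deriv[OF dg] by (auto simp: phi_def g0)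
  have "(\<lambda>z. psi z / phi z) holomorphic_on ball 0 1"
    by (intro holomorphic_intros holomorphic_on_subset[OF psi] holomorphic_on_subset[OF phi] ph0) auto
  then have H0: "H holomorphic_on ball 0 1"
    by (rule holomorphic_transform) (auto simp: psi_def phi_def H_def g0 small)
  have Hint: "H (z + of_int n) = H z" for z n
  proof (induction n rule: int_induct[where k = 0])
    case (step2 i)
    then show ?case using Hper[of "z + of_int (i - 1)"] by (simp add: algebra_simps)
  next
    case (step1 i)
    then show ?case using Hper[of "z + of_int i"] by (simp add: algebra_simps)
  qed auto
  have "H field_differentiable at z" for z
  proof (cases "z \<in> \<int>")
    case True
    then obtain n where n: "z = of_int n" by (auto elim: Ints_cases)
    have "H field_differentiable at 0"
      using H0 holomorphic_on_imp_differentiable_at by fastforce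
    then obtain D where D: "(H has_field_derivative D) (at 0)"
      by (auto simp: field_differentiable_def)
    have "((\<lambda>y. H (y - of_int n)) has_field_derivative D) (at z)"
      by (rule DERIV_chain'[where g = H, THEN DERIV_cong]) (auto intro!: derivative_eq_intros simp: n D)
    moreover have "(\<lambda>y. H (y - of_int n)) = H"
      using Hint[of "y - of_int n" n for y] by auto
    ultimately show ?thesis
      by (auto simp: field_differentiable_def)
  next
    case False
    have "(\<lambda>z. E z / g z) holomorphic_on - \<int>"
      by (intro holomorphic_intros holomorphic_on_subset[OF hol] holomorphic_on_subset[OF holg]) (auto simp: g0)
    then have "H holomorphic_on - \<int>"
      by (rule holomorphic_transform) (auto simp: H_def g0)
    moreover have "open (- \<int> :: complex set)"
      by auto
    ultimately show ?thesis
      using False holomorphic_on_imp_differentiable_at by blast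
  qed
  then have "H holomorphic_on UNIV"
    by (auto simp: holomorphic_on_def field_differentiable_at_within)
  moreover have "E z = (1 - cexp1 (-z)) * H z" for z
    using Eint g0 by (auto simp: H_def g_def elim!: Ints_cases)
  ultimately show ?thesis
    using that Hper by blast
qed

text \<open>Writing \<open>G z - G 0\<close> as \<open>(1 - cexp1 (- z)) * H z\<close> turns the
  coefficients \<open>c m\<close> of \<open>H\<close> into the differences
  \<open>c m - c (m + 1)\<close>. A symmetric partial sum is therefore
  \<open>G 0 + c (- N) - c (N + 1)\<close>, and the coefficients of \<open>H\<close> tend to
  zero.\<close>

theorem fourier_inversion_entire:
  assumes hol: "G holomorphic_on UNIV" and per: "\<And>z. G (z + 1) = G z"
  shows "(\<lambda>N. \<Sum>m\<in>{-int N..int N}. period_integral (\<lambda>z. G z * cexp1 (- (of_int m * z)))) \<longlonglongrightarrow> G 0"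
proof -
  obtain H where H: "H holomorphic_on UNIV" "\<And>z. H (z + 1) = H z"
    and EH: "\<And>z. G z - G 0 = (1 - cexp1 (-z)) * H z"
    by (rule entire_periodic_divide[of "\<lambda>z. G z - G 0"]) (auto intro!: holomorphic_intros hol simp: per)
  define c where "c = (\<lambda>m::int. period_integral (\<lambda>z. H z * cexp1 (- (of_int m * z))))"
  have one: "period_integral (\<lambda>z. cexp1 (- (of_int m * z))) = (if m = 0 then 1 else 0)" for m :: int
  proof (cases "m = 0")
    case True
    then show ?thesis
      using period_integral_primitive[of "\<lambda>z. z" "\<lambda>z. 1"] by (auto intro!: derivative_eq_intros)
  next
    case False
    have "((\<lambda>z. - cexp1 (- (of_int m * z)) / (2 * of_real pi * \<i> * of_int m)) has_field_derivative cexp1 (- (of_int m * z))) (at z)" for z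
      unfolding cexp1_def using False by (auto intro!: derivative_eq_intros)
    from period_integral_primitive[OF this] show ?thesis
      using False by (simp add: cexp1_minus)
  qed
  have coeff: "period_integral (\<lambda>z. G z * cexp1 (- (of_int m * z))) = (if m = 0 then G 0 else 0) + (c m - c (m + 1))" for m
  proof -
    have "period_integral (\<lambda>z. G z * cexp1 (- (of_int m * z)) - G 0 * cexp1 (- (of_int m * z)))
        = period_integral (\<lambda>z. H z * cexp1 (- (of_int m * z)) - H z * cexp1 (- (of_int (m + 1) * z)))"
    proof (intro arg_cong[where f = period_integral] ext)
      fix z
      have "cexp1 (- (of_int (m + 1) * z)) = cexp1 (- z) * cexp1 (- (of_int m * z))"
        unfolding cexp1_add[symmetric] by (simp add: algebra_simps)
      then show "G z * cexp1 (- (of_int m * z)) - G 0 * cexp1 (- (of_int m * z)) =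
          H z * cexp1 (- (of_int m * z)) - H z * cexp1 (- (of_int (m + 1) * z))"
        using arg_cong[OF EH[of z], of "\<lambda>x. x * cexp1 (- (of_int m * z))"] by (simp add: algebra_simps)
    qed
    moreover have "period_integral (\<lambda>z. G 0 * cexp1 (- (of_int m * z))) = G 0 * (if m = 0 then 1 else 0)"
    proof -
      have "cexp1 (- (of_int m * (z + 1))) = cexp1 (- (of_int m * z))" for z
        using cexp1_add[of "- (of_int m * z)" "of_int (- m)"] by (simp add: algebra_simps cexp1_minus)
      then show ?thesis
        using period_integral_translate[of "\<lambda>z. cexp1 (- (of_int m * z))" "G 0" 0] one[of m]
        by (simp add: holomorphic_intros)
    qed
    ultimately show ?thesis
      by (subst (asm) (1 2) period_integral_diff) (auto intro!: holomorphic_intros hol H simp: c_def algebra_simps)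
  qed
  have tele: "(\<Sum>m\<in>{-int N..int N}. c m - c (m + 1)) = c (- int N) - c (int N + 1)" for N
  proof (induction N)
    case (Suc N)
    have "{- int (Suc N)..int (Suc N)} = insert (- int (Suc N)) (insert (int (Suc N)) {- int N..int N})"
      by auto
    then show ?case using Suc by (simp add: algebra_simps)
  qed auto
  have "(\<Sum>m\<in>{-int N..int N}. period_integral (\<lambda>z. G z * cexp1 (- (of_int m * z)))) = G 0 + (c (- int N) - c (int N + 1))" for N
    by (simp add: coeff sum.distrib tele sum.delta)
  moreover have "(\<lambda>N. G 0 + (c (- int N) - c (int N + 1))) \<longlonglongrightarrow> G 0 + (0 - 0)"
  proof (intro tendsto_intros)
    show "(\<lambda>n. c (- int n)) \<longlonglongrightarrow> 0"
      using fourier_coeff_tendsto_0[OF H, of "-1"] by (simp add: c_def)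
    have "(\<lambda>n. c (int n)) \<longlonglongrightarrow> 0"
      using fourier_coeff_tendsto_0[OF H, of "1"] by (simp add: c_def)
    then show "(\<lambda>n. c (int n + 1)) \<longlonglongrightarrow> 0"
      using LIMSEQ_Suc[of "\<lambda>n. c (int n)" 0] by (simp add: algebra_simps)
  qed
  ultimately show ?thesis by simp
qed

section \<open>The Jacobi inversion formula\<close>

abbreviation norm_summable_on :: "('a \<Rightarrow> 'b::real_normed_vector) \<Rightarrow> 'a set \<Rightarrow> bool"  (infixr "norm'_summable'_on" 46)
  where "f norm_summable_on A \<equiv> (\<lambda>x. norm (f x)) summable_on A"

lemma summable_exp_neg_abs_int: "(\<lambda>n::int. exp (- \<bar>real_of_int n\<bar>)) summable_on UNIV"
proof -
  let ?f = "\<lambda>n::int. exp (- \<bar>real_of_int n\<bar>)"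
  have "summable (\<lambda>n::nat. exp (-1 :: real) ^ n)"
    by (rule summable_geometric) simp
  then have s: "(\<lambda>n::nat. exp (- real n)) summable_on UNIV"
    by (subst summable_on_UNIV_nonneg_real_iff) (auto simp: exp_of_nat_mult[symmetric])
  have "?f summable_on range int"
    using s by (subst summable_on_reindex) (auto simp: o_def)
  moreover have "?f summable_on range (\<lambda>n. - int n)"
    using s by (subst summable_on_reindex) (auto simp: o_def inj_def)
  moreover have "range int \<union> range (\<lambda>n. - int n) = UNIV"
    by (auto, metis int_cases2 rangeI)
  ultimately show ?thesis
    using summable_on_union[of ?f "range int" "range (\<lambda>n. - int n)"] by simp
qed

lemma bij_add_int: "bij (\<lambda>n. n + k :: int)"
  by (rule bij_betw_byWitness[where f' = "\<lambda>n. n - k"]) auto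

text \<open>Shifting the index by the floor of \<open>x\<close> leaves a fractional part, which
  costs at most the factor \<open>exp 1\<close>. The bound must not depend on \<open>x\<close>: in
  \<open>inversion_step\<close> it serves infinitely many shifts at once.\<close>

lemma sum_exp_neg_abs_shift:
  fixes x :: real
  shows "(\<lambda>n::int. exp (- \<bar>real_of_int n + x\<bar>)) summable_on UNIV"
    and "(\<Sum>\<^sub>\<infinity>n::int. exp (- \<bar>real_of_int n + x\<bar>)) \<le> exp 1 * (\<Sum>\<^sub>\<infinity>n::int. exp (- \<bar>real_of_int n\<bar>))"
proof -
  let ?f = "\<lambda>n::int. exp (- \<bar>real_of_int n\<bar>)"
  have s: "(\<lambda>n. ?f (n + \<lfloor>x\<rfloor>)) summable_on UNIV"
    using summable_exp_neg_abs_int by (subst summable_on_reindex_bij_betw[OF bij_add_int])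
  have le: "exp (- \<bar>real_of_int n + x\<bar>) \<le> exp 1 * ?f (n + \<lfloor>x\<rfloor>)" for n
  proof -
    have "x - of_int \<lfloor>x\<rfloor> \<ge> 0" "x - of_int \<lfloor>x\<rfloor> < 1"
      by linarith+
    then have "- \<bar>real_of_int n + x\<bar> \<le> 1 - \<bar>real_of_int (n + \<lfloor>x\<rfloor>)\<bar>"
      by (simp only: of_int_add abs_if split: if_splits) linarith
    then show ?thesis
      by (simp add: exp_add[symmetric] del: of_int_add)
  qed
  show 1: "(\<lambda>n::int. exp (- \<bar>real_of_int n + x\<bar>)) summable_on UNIV"
    by (rule summable_on_comparison_test[OF summable_on_cmult_right[OF s]]) (use le in auto)
  have "(\<Sum>\<^sub>\<infinity>n::int. exp (- \<bar>real_of_int n + x\<bar>)) \<le> (\<Sum>\<^sub>\<infinity>n. exp 1 * ?f (n + \<lfloor>x\<rfloor>))"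
    by (rule infsum_mono[OF 1 summable_on_cmult_right[OF s]]) (use le in auto)
  also have "\<dots> = exp 1 * (\<Sum>\<^sub>\<infinity>n. ?f (n + \<lfloor>x\<rfloor>))"
    by (rule infsum_cmult_right')
  also have "(\<Sum>\<^sub>\<infinity>n. ?f (n + \<lfloor>x\<rfloor>)) = infsum ?f UNIV"
    by (rule infsum_reindex_bij_betw[OF bij_add_int])
  finally show "(\<Sum>\<^sub>\<infinity>n::int. exp (- \<bar>real_of_int n + x\<bar>)) \<le> exp 1 * infsum ?f UNIV" .
qed

definition gauss :: "complex \<Rightarrow> complex \<Rightarrow> complex" where
  "gauss \<tau> z = exp (of_real pi * \<i> * \<tau> * z\<^sup>2)"

lemma gauss_nonzero [simp]: "gauss \<tau> z \<noteq> 0"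
  by (simp add: gauss_def)

lemma gauss_holomorphic [holomorphic_intros]:
  "f holomorphic_on A \<Longrightarrow> (\<lambda>z. gauss \<tau> (f z)) holomorphic_on A"
  unfolding gauss_def by (intro holomorphic_intros)

lemma linear_le_quadratic:
  fixes a b x :: real
  assumes "a > 0"
  shows "b * x \<le> a * x\<^sup>2 + b\<^sup>2 / (4 * a)"
proof -
  have "0 \<le> a * (x - b / (2 * a))\<^sup>2"
    using assms by simp
  also have "\<dots> = a * x\<^sup>2 + b\<^sup>2 / (4 * a) - b * x"
    using assms by (simp add: power2_eq_square field_simps)
  finally show ?thesis by simp
qed

lemma gauss_bound:
  assumes "Im \<tau> > 0" "R \<ge> 0"
  obtains K where "K > 0" "\<And>z. \<bar>Im z\<bar> \<le> R \<Longrightarrow> norm (gauss \<tau> z) \<le> K * exp (- \<bar>Re z\<bar>)"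
proof -
  \<comment> \<open>\<open>b\<close> majorises the cross term 2 pi Re \<tau> Re z Im z on the strip;
    the additional 1 is the rate of decay that survives completing the square.\<close>
  define b where "b = 2 * pi * \<bar>Re \<tau>\<bar> * R + 1"
  define c where "c = pi * Im \<tau> * R\<^sup>2 + b\<^sup>2 / (4 * (pi * Im \<tau>))"
  have "norm (gauss \<tau> z) \<le> exp c * exp (- \<bar>Re z\<bar>)" if z: "\<bar>Im z\<bar> \<le> R" for z
  proof -
    have "norm (gauss \<tau> z) = exp (- pi * Im (\<tau> * z\<^sup>2))"
      by (simp add: gauss_def mult.assoc right_diff_distrib ring_distribs)
    also have "Im (\<tau> * z\<^sup>2) = Im \<tau> * ((Re z)\<^sup>2 - (Im z)\<^sup>2) + 2 * Re \<tau> * Re z * Im z"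
      by (simp add: power2_eq_square algebra_simps)
    also have "- pi * \<dots> \<le> c - \<bar>Re z\<bar>"
    proof -
      have "b * \<bar>Re z\<bar> \<le> pi * Im \<tau> * \<bar>Re z\<bar>\<^sup>2 + b\<^sup>2 / (4 * (pi * Im \<tau>))"
        using assms by (intro linear_le_quadratic) simp
      moreover have "- (2 * pi * Re \<tau> * Re z * Im z) \<le> 2 * pi * \<bar>Re \<tau>\<bar> * R * \<bar>Re z\<bar>"
      proof -
        have "- (2 * pi * Re \<tau> * Re z * Im z) \<le> \<bar>2 * pi * Re \<tau> * Re z * Im z\<bar>" by simp
        also have "\<dots> = 2 * pi * \<bar>Re \<tau>\<bar> * \<bar>Re z\<bar> * \<bar>Im z\<bar>" by (simp add: abs_mult)
        also have "\<dots> \<le> 2 * pi * \<bar>Re \<tau>\<bar> * \<bar>Re z\<bar> * R" using z by (intro mult_left_mono) auto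
        finally show ?thesis by (simp add: mult_ac)
      qed
      moreover have "pi * Im \<tau> * (Im z)\<^sup>2 \<le> pi * Im \<tau> * R\<^sup>2"
        using z assms abs_le_square_iff[of "Im z" R] by (intro mult_left_mono) auto
      moreover have "- pi * (Im \<tau> * ((Re z)\<^sup>2 - (Im z)\<^sup>2) + 2 * Re \<tau> * Re z * Im z)
          = - (pi * Im \<tau> * \<bar>Re z\<bar>\<^sup>2) + pi * Im \<tau> * (Im z)\<^sup>2 - 2 * pi * Re \<tau> * Re z * Im z"
        by (simp add: algebra_simps)
      moreover have "b * \<bar>Re z\<bar> = 2 * pi * \<bar>Re \<tau>\<bar> * R * \<bar>Re z\<bar> + \<bar>Re z\<bar>"
        by (simp add: b_def algebra_simps)
      ultimately show ?thesis
        unfolding c_def by linarith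
    qed
    finally show ?thesis
      by (simp add: exp_add[symmetric])
  qed
  then show ?thesis
    using that[of "exp c"] by simp
qed

lemma gauss_sum_bound:
  assumes "Im \<tau> > 0" "R \<ge> 0"
  obtains B where "\<And>w. \<bar>Im w\<bar> \<le> R \<Longrightarrow> (\<lambda>n::int. gauss \<tau> (of_int n + w)) norm_summable_on UNIV"
    and "\<And>w. \<bar>Im w\<bar> \<le> R \<Longrightarrow> (\<Sum>\<^sub>\<infinity>n::int. norm (gauss \<tau> (of_int n + w))) \<le> B"
proof -
  obtain K where K: "K > 0" "\<And>z. \<bar>Im z\<bar> \<le> R \<Longrightarrow> norm (gauss \<tau> z) \<le> K * exp (- \<bar>Re z\<bar>)"
    using gauss_bound[OF assms] by blast
  have le: "norm (gauss \<tau> (of_int n + w)) \<le> K * exp (- \<bar>real_of_int n + Re w\<bar>)" if "\<bar>Im w\<bar> \<le> R" for n w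
    using K(2)[of "of_int n + w"] that by simp
  have s: "(\<lambda>n::int. norm (gauss \<tau> (of_int n + w))) summable_on UNIV" if "\<bar>Im w\<bar> \<le> R" for w
    by (rule summable_on_comparison_test[OF summable_on_cmult_right[OF sum_exp_neg_abs_shift(1)[of "Re w"]]])
       (use le that in auto)
  have "(\<Sum>\<^sub>\<infinity>n::int. norm (gauss \<tau> (of_int n + w))) \<le> K * (exp 1 * (\<Sum>\<^sub>\<infinity>n::int. exp (- \<bar>real_of_int n\<bar>)))"
    if w: "\<bar>Im w\<bar> \<le> R" for w
  proof -
    have "(\<Sum>\<^sub>\<infinity>n::int. norm (gauss \<tau> (of_int n + w))) \<le> (\<Sum>\<^sub>\<infinity>n::int. K * exp (- \<bar>real_of_int n + Re w\<bar>))"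
      by (rule infsum_mono[OF s[OF w] summable_on_cmult_right[OF sum_exp_neg_abs_shift(1)]]) (use le w in auto)
    also have "\<dots> = K * (\<Sum>\<^sub>\<infinity>n::int. exp (- \<bar>real_of_int n + Re w\<bar>))"
      by (rule infsum_cmult_right')
    also have "\<dots> \<le> K * (exp 1 * (\<Sum>\<^sub>\<infinity>n::int. exp (- \<bar>real_of_int n\<bar>)))"
      using K by (intro mult_left_mono sum_exp_neg_abs_shift) auto
    finally show ?thesis .
  qed
  with s show ?thesis
    by (intro that)
qed

lemma gauss_abs_summable:
  assumes "Im \<tau> > 0"
  shows "(\<lambda>n::int. gauss \<tau> (of_int n + w)) norm_summable_on UNIV"
  by (rule gauss_sum_bound[OF assms, of "\<bar>Im w\<bar>"]) auto

definition gauss_sum :: "complex \<Rightarrow> complex \<Rightarrow> complex" where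
  "gauss_sum \<tau> w = (\<Sum>\<^sub>\<infinity>n::int. gauss \<tau> (of_int n + w))"

lemma gauss_sum_uniform_limit:
  assumes "Im \<tau> > 0"
  shows "uniform_limit (cball w 1) (\<lambda>X z. \<Sum>n\<in>X. gauss \<tau> (of_int n + z)) (gauss_sum \<tau>)
           (finite_subsets_at_top (UNIV :: int set))"
proof -
  define R where "R = \<bar>Im w\<bar> + 1"
  obtain K where K: "K > 0" "\<And>z. \<bar>Im z\<bar> \<le> R \<Longrightarrow> norm (gauss \<tau> z) \<le> K * exp (- \<bar>Re z\<bar>)"
    using gauss_bound[OF assms, of R] by (auto simp: R_def)
  show ?thesis
    unfolding gauss_sum_def
  proof (rule Weierstrass_m_test_general)
    show "(\<lambda>n::int. K * (exp (\<bar>Re w\<bar> + 1) * exp (- \<bar>real_of_int n\<bar>))) summable_on UNIV"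
      by (intro summable_on_cmult_right summable_exp_neg_abs_int)
    fix n :: int and z assume "z \<in> cball w 1"
    then have "norm (z - w) \<le> 1" by (simp add: dist_norm norm_minus_commute)
    then have "\<bar>Re z - Re w\<bar> \<le> 1" "\<bar>Im z - Im w\<bar> \<le> 1"
      using abs_Re_le_cmod[of "z - w"] abs_Im_le_cmod[of "z - w"] by auto
    then have "\<bar>Im (of_int n + z)\<bar> \<le> R" "- \<bar>Re (of_int n + z)\<bar> \<le> (\<bar>Re w\<bar> + 1) - \<bar>real_of_int n\<bar>"
      by (auto simp: R_def)
    then have "norm (gauss \<tau> (of_int n + z)) \<le> K * exp (- \<bar>Re (of_int n + z)\<bar>)"
      "exp (- \<bar>Re (of_int n + z)\<bar>) \<le> exp (\<bar>Re w\<bar> + 1) * exp (- \<bar>real_of_int n\<bar>)"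
      by (auto simp: exp_add[symmetric] simp del: plus_complex.sel intro: K(2))
    then show "norm (gauss \<tau> (of_int n + z)) \<le> K * (exp (\<bar>Re w\<bar> + 1) * exp (- \<bar>real_of_int n\<bar>))"
      using K(1) by (meson mult_left_mono order_trans less_imp_le)
  qed
qed

lemma gauss_sum_holomorphic:
  assumes "Im \<tau> > 0"
  shows "gauss_sum \<tau> holomorphic_on UNIV"
proof -
  have "gauss_sum \<tau> holomorphic_on ball w 1" for w
    by (rule holomorphic_uniform_limit[OF _ gauss_sum_uniform_limit[OF assms, of w]])
       (auto intro!: always_eventually holomorphic_on_imp_continuous_on holomorphic_intros)
  then have "gauss_sum \<tau> field_differentiable at w" for w
    by (meson centre_in_ball holomorphic_on_imp_differentiable_at open_ball zero_less_one)
  then show ?thesis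
    by (auto simp: holomorphic_on_def field_differentiable_at_within)
qed

lemma gauss_sum_periodic: "gauss_sum \<tau> (w + 1) = gauss_sum \<tau> w"
  using infsum_reindex_bij_betw[OF bij_add_int[of 1], of "\<lambda>n. gauss \<tau> (of_int n + w)"]
  by (simp add: gauss_sum_def algebra_simps)

text \<open>Completing the square, the shift by m / \<tau> changes the n-th term by the trivial
  factor \<open>cexp1 (of_int (m * n))\<close> and by a factor independent of n. Consequently the
  m-th Fourier coefficient of \<open>gauss_sum \<tau>\<close> is
  \<open>gauss (-1 / \<tau>) (of_int m)\<close> times the zeroth.\<close>

lemma gauss_sum_quasiperiodic:
  assumes "\<tau> \<noteq> 0"
  shows "gauss_sum \<tau> (z + of_int m / \<tau>) * cexp1 (- (of_int m * (z + of_int m / \<tau>))) = gauss (-1 / \<tau>) (of_int m) * gauss_sum \<tau> z"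
proof -
  have "gauss \<tau> (of_int n + (z + of_int m / \<tau>)) * cexp1 (- (of_int m * (z + of_int m / \<tau>)))
      = gauss (-1 / \<tau>) (of_int m) * gauss \<tau> (of_int n + z)" for n
  proof -
    have "gauss \<tau> (of_int n + (z + of_int m / \<tau>)) * cexp1 (- (of_int m * (z + of_int m / \<tau>)))
      = gauss (-1 / \<tau>) (of_int m) * gauss \<tau> (of_int n + z) * cexp1 (of_int (m * n))"
      unfolding gauss_def cexp1_def exp_add[symmetric] using assms
      by (intro arg_cong[where f = exp]) (simp add: field_simps power2_eq_square)
    then show ?thesis
      by (simp only: cexp1_of_int mult_1_right)
  qed
  then show ?thesis
    unfolding gauss_sum_def
    by (simp add: infsum_cmult_left'[symmetric] infsum_cmult_right'[symmetric])
qed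

lemma filterlim_symmetric_int_intervals:
  "filterlim (\<lambda>N. {- int N..int N}) (finite_subsets_at_top UNIV) sequentially"
  "filterlim (\<lambda>N. {- int N..<int N}) (finite_subsets_at_top UNIV) sequentially"
proof -
  have *: "eventually (\<lambda>N. X \<subseteq> {- int N..<int N}) sequentially" if "finite X" for X
  proof -
    define M where "M = Max (abs ` X)"
    have M: "\<bar>x\<bar> \<le> M" if "x \<in> X" for x
      unfolding M_def using \<open>finite X\<close> that by (intro Max_ge) auto
    show ?thesis
      using eventually_gt_at_top[of "nat M"]
    proof eventually_elim
      case (elim N)
      show ?case
      proof
        fix x assume "x \<in> X"
        from M[OF this] elim show "x \<in> {- int N..<int N}" by auto
      qed
    qed
  qed
  show "filterlim (\<lambda>N. {- int N..<int N}) (finite_subsets_at_top UNIV) sequentially"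
    unfolding filterlim_finite_subsets_at_top using * by auto
  show "filterlim (\<lambda>N. {- int N..int N}) (finite_subsets_at_top UNIV) sequentially"
    unfolding filterlim_finite_subsets_at_top using * by (auto elim!: eventually_mono[OF *])
qed

text \<open>Quasi-periodicity determines all Fourier coefficients up to one common factor, the
  zeroth coefficient. It stays open here and is evaluated in
  \<open>period_integral_gauss_sum\<close>.\<close>

lemma jacobi_inversion_const:
  assumes "Im \<tau> > 0"
  shows "gauss_sum \<tau> w = period_integral (gauss_sum \<tau>) * (\<Sum>\<^sub>\<infinity>m::int. gauss (-1 / \<tau>) (of_int m) * cexp1 (of_int m * w))"
    and "(\<lambda>m::int. gauss (-1 / \<tau>) (of_int m) * cexp1 (of_int m * w)) norm_summable_on UNIV"
proof -
  from assms have t0: "\<tau> \<noteq> 0" by auto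
  have im: "Im (-1 / \<tau>) > 0"
    using assms by (simp add: Im_divide sum_power2_gt_zero_iff)
  let ?F = "gauss_sum \<tau>"
  note hol = gauss_sum_holomorphic[OF assms]
  have hol': "(\<lambda>z. ?F (z + w)) holomorphic_on UNIV"
    using holomorphic_on_compose_gen[OF _ hol, of "\<lambda>z. z + w" UNIV]
    by (simp add: o_def holomorphic_intros)
  have coeff: "period_integral (\<lambda>z. ?F (z + w) * cexp1 (- (of_int m * z)))
      = period_integral ?F * (gauss (-1 / \<tau>) (of_int m) * cexp1 (of_int m * w))" for m
  proof -
    define \<Psi> where "\<Psi> = (\<lambda>z. ?F z * cexp1 (- (of_int m * z)))"
    have hP: "\<Psi> holomorphic_on UNIV"
      unfolding \<Psi>_def by (intro holomorphic_intros hol)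
    have pP: "\<Psi> (z + 1) = \<Psi> z" for z
      by (simp add: \<Psi>_def ring_distribs cexp1_minus cexp1_add gauss_sum_periodic)
    have "(\<lambda>z. ?F (z + w) * cexp1 (- (of_int m * z))) = (\<lambda>z. cexp1 (of_int m * w) * \<Psi> (z + w))"
      by (auto simp: \<Psi>_def cexp1_add cexp1_minus ring_distribs)
    then have "period_integral (\<lambda>z. ?F (z + w) * cexp1 (- (of_int m * z))) = cexp1 (of_int m * w) * period_integral \<Psi>"
      by (simp add: period_integral_translate[OF hP pP])
    \<comment> \<open>The translation by the complex number m / \<tau>, which the integral does not
      see, brings in the quasi-periodicity.\<close>
    also have "period_integral \<Psi> = period_integral (\<lambda>z. 1 * \<Psi> (z + of_int m / \<tau>))"
      by (subst period_integral_translate[OF hP pP]) simp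
    also have "\<dots> = period_integral (\<lambda>z. gauss (-1 / \<tau>) (of_int m) * ?F (z + 0))"
      using gauss_sum_quasiperiodic[OF t0] by (simp add: \<Psi>_def)
    also have "\<dots> = gauss (-1 / \<tau>) (of_int m) * period_integral ?F"
      by (rule period_integral_translate[OF hol gauss_sum_periodic])
    finally show ?thesis by simp
  qed
  show abs: "(\<lambda>m::int. gauss (-1 / \<tau>) (of_int m) * cexp1 (of_int m * w)) norm_summable_on UNIV"
  proof -
    \<comment> \<open>Completing the square: up to a constant factor the twisted series is a
      Gaussian series with shift - \<tau> w.\<close>
    have "gauss (-1 / \<tau>) (of_int m) * cexp1 (of_int m * w) = gauss (-1 / \<tau>) (of_int m - \<tau> * w) * gauss \<tau> w" for m
      unfolding gauss_def cexp1_def exp_add[symmetric] using t0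
      by (intro arg_cong[where f = exp]) (simp add: field_simps power2_eq_square)
    then show ?thesis
      using gauss_abs_summable[OF im, of "- \<tau> * w"]
      by (simp add: norm_mult summable_on_cmult_left')
  qed
  have "((\<lambda>m::int. period_integral ?F * (gauss (-1 / \<tau>) (of_int m) * cexp1 (of_int m * w))) has_sum
      (period_integral ?F * (\<Sum>\<^sub>\<infinity>m::int. gauss (-1 / \<tau>) (of_int m) * cexp1 (of_int m * w)))) UNIV"
    by (rule has_sum_cmult_right[OF has_sum_infsum[OF abs_summable_summable[OF abs]]])
  then have "(\<lambda>N. \<Sum>m\<in>{-int N..int N}. period_integral ?F * (gauss (-1 / \<tau>) (of_int m) * cexp1 (of_int m * w))) \<longlonglongrightarrow>
      (period_integral ?F * (\<Sum>\<^sub>\<infinity>m::int. gauss (-1 / \<tau>) (of_int m) * cexp1 (of_int m * w)))"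
    unfolding has_sum_def by (rule filterlim_compose[OF _ filterlim_symmetric_int_intervals(1)])
  moreover have "(\<lambda>N. \<Sum>m\<in>{-int N..int N}. period_integral ?F * (gauss (-1 / \<tau>) (of_int m) * cexp1 (of_int m * w))) \<longlonglongrightarrow> ?F (0 + w)"
    using fourier_inversion_entire[OF hol'] gauss_sum_periodic[of \<tau> "z + w" for z]
    unfolding coeff by (simp add: add_ac)
  ultimately show "?F w = period_integral ?F * (\<Sum>\<^sub>\<infinity>m::int. gauss (-1 / \<tau>) (of_int m) * cexp1 (of_int m * w))"
    using LIMSEQ_unique by fastforce
qed

section \<open>The constant factor as a Gaussian integral\<close>

lemma period_integral_gauss_sum_limit:
  assumes "Im \<tau> > 0" and A: "\<And>z. (A has_field_derivative gauss \<tau> z) (at z)"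
  shows "(\<lambda>N. A (of_nat N) - A (- of_nat N)) \<longlonglongrightarrow> period_integral (gauss_sum \<tau>)"
proof -
  \<comment> \<open>With the half-open range the unit intervals from n to n + 1 tile the interval
    from - N to N, so the integral telescopes.\<close>
  let ?S = "\<lambda>N z. \<Sum>n\<in>{-int N..<int N}. gauss \<tau> (of_int n + z)"
  have hS: "?S N holomorphic_on UNIV" for N
    by (intro holomorphic_intros)
  have "period_integral (?S N) = A (of_nat N) - A (- of_nat N)" for N
  proof -
    have "((\<lambda>z. \<Sum>n\<in>{-int N..<int N}. A (of_int n + z)) has_field_derivative ?S N z) (at z)" for z
      using A[of "z + of_int n" for n, unfolded DERIV_shift]
      by (intro DERIV_sum) (simp add: add.commute)
    then have "period_integral (?S N) = (\<Sum>n\<in>{-int N..<int N}. A (of_int n + 1) - A (of_int n))"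
      by (subst period_integral_primitive) (auto simp: sum_subtractf)
    also have "\<dots> = A (of_nat N) - A (- of_nat N)"
    proof (induction N)
      case (Suc N)
      have "{-int (Suc N)..<int (Suc N)} = insert (- int (Suc N)) (insert (int N) {-int N..<int N})" by auto
      with Suc show ?case by (simp add: algebra_simps)
    qed auto
    finally show ?thesis .
  qed
  moreover have "(\<lambda>N. period_integral (?S N)) \<longlonglongrightarrow> period_integral (gauss_sum \<tau>)"
  proof (rule LIMSEQ_I)
    fix e :: real assume e: "e > 0"
    have "eventually (\<lambda>X. \<forall>z\<in>cball 0 1. dist (\<Sum>n\<in>X. gauss \<tau> (of_int n + z)) (gauss_sum \<tau> z) < e / 2)
        (finite_subsets_at_top (UNIV :: int set))"
      using uniform_limitD[OF gauss_sum_uniform_limit[OF assms(1), of 0], of "e / 2"] e by simp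
    then have "eventually (\<lambda>N. \<forall>z\<in>cball 0 1. dist (?S N z) (gauss_sum \<tau> z) < e / 2) sequentially"
      using filterlim_symmetric_int_intervals(2) by (rule eventually_compose_filterlim)
    then obtain M where M: "\<And>N z. N \<ge> M \<Longrightarrow> z \<in> cball 0 1 \<Longrightarrow> dist (?S N z) (gauss_sum \<tau> z) < e / 2"
      unfolding eventually_sequentially by blast
    have "norm (period_integral (?S N) - period_integral (gauss_sum \<tau>)) < e" if "N \<ge> M" for N
    proof -
      let ?d = "\<lambda>z. ?S N z - gauss_sum \<tau> z"
      have "?d holomorphic_on UNIV"
        by (intro holomorphic_on_diff hS gauss_sum_holomorphic assms)
      then obtain D where D: "\<And>z. (D has_field_derivative ?d z) (at z)"
        by (rule entire_primitive) blast
      have "norm (D 1 - D 0) \<le> (e / 2) * norm (1 - 0 :: complex)"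
      proof (rule field_differentiable_bound[where S = "closed_segment 0 1" and f' = ?d])
        fix z :: complex assume "z \<in> closed_segment 0 1"
        then have "z \<in> cball 0 1"
          by (auto simp: closed_segment_def norm_mult)
        from M[OF that this] show "norm (?d z) \<le> e / 2"
          by (simp add: dist_norm)
      qed (auto intro: has_field_derivative_at_within D)
      then show ?thesis
        using e by (simp flip: period_integral_primitive[OF D] period_integral_diff[OF hS gauss_sum_holomorphic[OF assms(1)]])
    qed
    then show "\<exists>M. \<forall>N\<ge>M. norm (period_integral (?S N) - period_integral (gauss_sum \<tau>)) < e"
      by blast
  qed
  ultimately show ?thesis by simp
qed

lemma gauss_sum_ii_nonzero: "gauss_sum \<i> 0 \<noteq> 0"
proof -
  have eq: "gauss \<i> (of_int n) = of_real (exp (- pi * (of_int n)\<^sup>2))" for n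
    by (simp add: gauss_def exp_of_real[symmetric] mult.assoc)
  have s: "(\<lambda>n::int. exp (- pi * (of_int n)\<^sup>2)) summable_on UNIV"
    using gauss_abs_summable[of \<i> 0] by (simp add: eq)
  have "(\<Sum>n\<in>{0::int}. exp (- pi * (of_int n)\<^sup>2)) \<le> (\<Sum>\<^sub>\<infinity>n::int. exp (- pi * (of_int n)\<^sup>2))"
    by (rule finite_sum_le_infsum[OF s]) auto
  moreover have "gauss_sum \<i> 0 = of_real (\<Sum>\<^sub>\<infinity>n::int. exp (- pi * (of_int n)\<^sup>2))"
    using has_sum_of_real[OF has_sum_infsum[OF s], where 'a = complex]
    by (auto simp: gauss_sum_def eq intro: infsumI)
  ultimately show ?thesis by auto
qed

text \<open>The point \<i> is fixed by the map taking \<tau> to -1 / \<tau>, so at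
  \<open>w = 0\<close> the inversion formula reads x = c x with x nonzero.\<close>

lemma period_integral_gauss_sum_ii: "period_integral (gauss_sum \<i>) = 1"
  using jacobi_inversion_const(1)[of \<i> 0] gauss_sum_ii_nonzero
  by (simp add: gauss_sum_def field_simps)

text \<open>For \<sigma>^2 = - \<i> \<tau> one has
  \<open>gauss \<i> (\<sigma> * z) = gauss \<tau> z\<close>, and (Re \<sigma>)^2 - (Im \<sigma>)^2 =
  Im \<tau> > 0 places \<sigma> in the sector where \<open>gauss \<i>\<close> decays. The segments
  joining \<sigma> N to N, and their negatives, thus contribute nothing in the limit.\<close>

lemma period_integral_gauss_sum:
  assumes "Im \<tau> > 0"
  shows "period_integral (gauss_sum \<tau>) = 1 / csqrt (- \<i> * \<tau>)"
proof -
  define \<sigma> where "\<sigma> = csqrt (- \<i> * \<tau>)"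
  have s2: "\<sigma>\<^sup>2 = - \<i> * \<tau>" by (simp add: \<sigma>_def)
  from assms have "\<sigma> \<noteq> 0" by (auto simp: \<sigma>_def)
  have "Re \<sigma> \<ge> 0" using csqrt_principal[of "- \<i> * \<tau>"] by (auto simp: \<sigma>_def)
  moreover have "(Re \<sigma>)\<^sup>2 - (Im \<sigma>)\<^sup>2 = Im \<tau>"
    using arg_cong[OF s2, of Re] by (simp add: power2_eq_square)
  ultimately have re: "\<bar>Im \<sigma>\<bar> < Re \<sigma>"
    using assms abs_le_square_iff[of "Re \<sigma>" "Im \<sigma>"] by linarith
  obtain A where A: "\<And>z. (A has_field_derivative gauss \<i> z) (at z)"
    by (rule entire_primitive[of "gauss \<i>"]) (auto intro!: holomorphic_intros)
  \<comment> \<open>\<delta> N is to bound x - |y| from below along the segment from \<sigma> N to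
    N; the two entries of the minimum are the values of (x - |y|) / N at the end points.\<close>
  define \<delta> where "\<delta> = min 1 (Re \<sigma> - \<bar>Im \<sigma>\<bar>)"
  have d: "\<delta> > 0" "\<delta> \<le> 1" "\<delta> \<le> Re \<sigma> - \<bar>Im \<sigma>\<bar>" using re by (auto simp: \<delta>_def)
  have gs: "gauss \<i> (\<sigma> * z) = gauss \<tau> z" for z
    using s2 by (simp add: gauss_def power_mult_distrib algebra_simps)
  have "((\<lambda>z. A (\<sigma> * z) / \<sigma>) has_field_derivative gauss \<tau> z) (at z)" for z
  proof -
    have "((\<lambda>z. A (\<sigma> * z)) has_field_derivative gauss \<i> (\<sigma> * z) * \<sigma>) (at z)"
      by (rule DERIV_chain2[OF A]) (auto intro!: derivative_eq_intros)
    from DERIV_cdivide[OF this, of \<sigma>] show ?thesis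
      using \<open>\<sigma> \<noteq> 0\<close> by (simp add: gs)
  qed
  from period_integral_gauss_sum_limit[OF assms this]
  have lim: "(\<lambda>N. (A (\<sigma> * of_nat N) - A (- (\<sigma> * of_nat N))) / \<sigma>) \<longlonglongrightarrow> period_integral (gauss_sum \<tau>)"
    by (simp add: diff_divide_distrib)
  have lim1: "(\<lambda>N. A (of_nat N) - A (- of_nat N)) \<longlonglongrightarrow> 1"
    using period_integral_gauss_sum_limit[OF _ A] period_integral_gauss_sum_ii by simp
  have bound: "norm (A (s * (\<sigma> * of_nat N)) - A (s * of_nat N)) \<le> exp (- (pi * \<delta>\<^sup>2) * (real N)\<^sup>2) * (norm (\<sigma> - 1) * real N)"
    if s: "s = 1 \<or> s = -1" for s :: complex and N
  proof -
    have "norm (A (s * (\<sigma> * of_nat N)) - A (s * of_nat N))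
       \<le> exp (- (pi * \<delta>\<^sup>2) * (real N)\<^sup>2) * norm (s * (\<sigma> * of_nat N) - s * of_nat N)"
    proof (rule field_differentiable_bound[where S = "closed_segment (s * (\<sigma> * of_nat N)) (s * of_nat N)" and f' = "gauss \<i>"])
      fix z assume "z \<in> closed_segment (s * (\<sigma> * of_nat N)) (s * of_nat N)"
      then obtain u where u: "0 \<le> u" "u \<le> 1" and z: "z = (1 - u) *\<^sub>R (s * (\<sigma> * of_nat N)) + u *\<^sub>R (s * of_nat N)"
        by (auto simp: closed_segment_def)
      define x where "x = ((1 - u) * Re \<sigma> + u) * real N"
      define y where "y = (1 - u) * Im \<sigma> * real N"
      \<comment> \<open>\<open>x\<close> and \<open>y\<close> are the coordinates in the case s = 1;
        the sign disappears in the square, on which alone \<open>gauss\<close> depends.\<close>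
      have z2: "z\<^sup>2 = (Complex x y)\<^sup>2"
        using s by (auto simp: z x_def y_def complex_eq_iff power2_eq_square algebra_simps)
      have "\<delta> * real N \<le> x - \<bar>y\<bar>"
      proof -
        have "\<delta> \<le> (1 - u) * (Re \<sigma> - \<bar>Im \<sigma>\<bar>) + u * 1"
        proof -
          have "(1 - u) * \<delta> \<le> (1 - u) * (Re \<sigma> - \<bar>Im \<sigma>\<bar>)" "u * \<delta> \<le> u * 1"
            using d u by (intro mult_left_mono; simp)+
          then show ?thesis by (simp add: algebra_simps)
        qed
        then have "\<delta> * real N \<le> ((1 - u) * (Re \<sigma> - \<bar>Im \<sigma>\<bar>) + u * 1) * real N"
          by (intro mult_right_mono) auto
        also have "\<dots> = x - (1 - u) * \<bar>Im \<sigma>\<bar> * real N"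
          by (simp add: x_def algebra_simps)
        also have "(1 - u) * \<bar>Im \<sigma>\<bar> * real N = \<bar>y\<bar>"
          using u by (simp add: y_def abs_mult)
        finally show ?thesis .
      qed
      moreover have "0 \<le> \<delta> * real N" using d by simp
      ultimately have "(\<delta> * real N) * (\<delta> * real N) \<le> (x - \<bar>y\<bar>) * (x + \<bar>y\<bar>)"
        by (intro mult_mono) auto
      also have "\<dots> = x\<^sup>2 - y\<^sup>2"
        by (simp add: algebra_simps power2_eq_square)
      finally have "(\<delta> * real N)\<^sup>2 \<le> x\<^sup>2 - y\<^sup>2" by (simp add: power2_eq_square)
      then have "pi * (\<delta> * real N)\<^sup>2 \<le> pi * (x\<^sup>2 - y\<^sup>2)" by (intro mult_left_mono) auto
      moreover have "norm (gauss \<i> z) = exp (- (pi * (x\<^sup>2 - y\<^sup>2)))"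
        by (simp add: gauss_def z2 mult.assoc) (simp add: power2_eq_square)
      ultimately show "norm (gauss \<i> z) \<le> exp (- (pi * \<delta>\<^sup>2) * (real N)\<^sup>2)"
        by (simp add: power_mult_distrib mult.assoc)
    qed (auto intro: has_field_derivative_at_within A)
    also have "s * (\<sigma> * of_nat N) - s * of_nat N = s * ((\<sigma> - 1) * of_nat N)"
      by (simp add: algebra_simps)
    also have "norm \<dots> = norm (\<sigma> - 1) * real N"
      using s by (auto simp: norm_mult)
    finally show ?thesis .
  qed
  have "(\<lambda>N. exp (- (pi * \<delta>\<^sup>2) * (real N)\<^sup>2) * (norm (\<sigma> - 1) * real N)) \<longlonglongrightarrow> 0"
  proof -
    have "(\<lambda>N. exp (- c * (real N)\<^sup>2) * real N) \<longlonglongrightarrow> 0" if "c > 0" for c :: real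
      using that by real_asymp
    from tendsto_mult_left_zero[OF this[of "pi * \<delta>\<^sup>2"], of "norm (\<sigma> - 1)"] show ?thesis
      using d by (simp add: mult_ac)
  qed
  then have "(\<lambda>N. A (s * (\<sigma> * of_nat N)) - A (s * of_nat N)) \<longlonglongrightarrow> 0" if "s = 1 \<or> s = -1" for s
    by (rule Lim_null_comparison[OF always_eventually, rotated]) (use bound that in blast)
  from this[of 1] this[of "-1"]
  have "(\<lambda>N. (A (\<sigma> * of_nat N) - A (of_nat N)) - (A (- (\<sigma> * of_nat N)) - A (- of_nat N)) + (A (of_nat N) - A (- of_nat N))) \<longlonglongrightarrow> 0 - 0 + 1"
    using lim1 by (intro tendsto_intros) auto
  then have "(\<lambda>N. (A (\<sigma> * of_nat N) - A (- (\<sigma> * of_nat N))) / \<sigma>) \<longlonglongrightarrow> 1 / \<sigma>"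
    using \<open>\<sigma> \<noteq> 0\<close> by (intro tendsto_divide) (auto simp: algebra_simps)
  with lim show ?thesis
    using LIMSEQ_unique \<sigma>_def by blast
qed

theorem jacobi_inversion:
  assumes "Im \<tau> > 0"
  shows "(\<Sum>\<^sub>\<infinity>n::int. gauss \<tau> (of_int n + w))
       = 1 / csqrt (- \<i> * \<tau>) * (\<Sum>\<^sub>\<infinity>m::int. gauss (-1 / \<tau>) (of_int m) * cexp1 (of_int m * w))"
  using jacobi_inversion_const(1)[OF assms, of w] period_integral_gauss_sum[OF assms]
  by (simp add: gauss_sum_def)

section \<open>Inversion coordinate by coordinate\<close>

lemma norm_summable_product:
  fixes f :: "'a \<Rightarrow> complex" and g :: "'b \<Rightarrow> complex"
  assumes "f norm_summable_on A" "g norm_summable_on B"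
  shows "(\<lambda>(x, y). f x * g y) norm_summable_on (A \<times> B)"
proof (subst Infinite_Sum.abs_summable_on_Sigma_iff, intro conjI ballI)
  show "(\<lambda>y. case (x, y) of (x, y) \<Rightarrow> f x * g y) norm_summable_on B" for x
    using assms(2) by (simp add: norm_mult summable_on_cmult_right)
  show "(\<lambda>x. \<Sum>\<^sub>\<infinity>y\<in>B. norm (case (x, y) of (x, y) \<Rightarrow> f x * g y)) norm_summable_on A"
    using assms(1) by (simp add: norm_mult infsum_cmult_right' infsum_nonneg summable_on_cmult_left)
qed

text \<open>A Gaussian with a linear character. By \<open>tgauss_diff\<close> the family is stable
  under multiplication by further characters, which lets the inversions be iterated.\<close>

definition tgauss :: "complex \<Rightarrow> complex \<Rightarrow> complex \<Rightarrow> complex" where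
  "tgauss \<tau> y x = exp (of_real pi * \<i> * \<tau> * x\<^sup>2 + 2 * of_real pi * \<i> * x * y)"

lemma tgauss_eq_gauss:
  assumes "\<tau> \<noteq> 0"
  shows "tgauss \<tau> y x = gauss (-1 / \<tau>) y * gauss \<tau> (x + y / \<tau>)"
  unfolding gauss_def tgauss_def exp_add[symmetric] using assms
  by (intro arg_cong[where f = exp]) (simp add: field_simps power2_eq_square)

lemma tgauss_diff: "tgauss \<tau> (y - t) x = tgauss \<tau> y x * cexp1 (- t * x)"
  unfolding tgauss_def cexp1_def exp_add[symmetric] by (simp add: algebra_simps)

lemma tgauss_sum:
  assumes "Im \<tau> > 0"
  shows "(\<Sum>\<^sub>\<infinity>n::int. tgauss \<tau> y (of_int n + l))
    = 1 / csqrt (- \<i> * \<tau>) * (\<Sum>\<^sub>\<infinity>m::int. gauss (-1 / \<tau>) (of_int m - y) * cexp1 (of_int m * l))"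
proof -
  from assms have t0: "\<tau> \<noteq> 0" by auto
  have "(\<Sum>\<^sub>\<infinity>n::int. tgauss \<tau> y (of_int n + l)) = gauss (-1 / \<tau>) y * (\<Sum>\<^sub>\<infinity>n::int. gauss \<tau> (of_int n + (l + y / \<tau>)))"
    by (simp add: tgauss_eq_gauss[OF t0] infsum_cmult_right' add.assoc)
  also have "\<dots> = 1 / csqrt (- \<i> * \<tau>) * (\<Sum>\<^sub>\<infinity>m::int. gauss (-1 / \<tau>) y * (gauss (-1 / \<tau>) (of_int m) * cexp1 (of_int m * (l + y / \<tau>))))"
    by (simp add: jacobi_inversion[OF assms] infsum_cmult_right')
  also have "(\<lambda>m::int. gauss (-1 / \<tau>) y * (gauss (-1 / \<tau>) (of_int m) * cexp1 (of_int m * (l + y / \<tau>))))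
     = (\<lambda>m. gauss (-1 / \<tau>) (of_int m - y) * cexp1 (of_int m * l))"
    unfolding gauss_def cexp1_def exp_add[symmetric] using t0
    by (intro ext arg_cong[where f = exp]) (simp add: field_simps power2_eq_square)
  finally show ?thesis .
qed

text \<open>The bound is uniform in \<open>l\<close> because a real shift does not leave the strip
  determined by Im (y / \<tau>).\<close>

lemma tgauss_norm_sum_bound:
  assumes "Im \<tau> > 0"
  obtains B where "\<And>l. (\<lambda>n::int. tgauss \<tau> y (of_int n + of_real l)) norm_summable_on UNIV"
    and "\<And>l. (\<Sum>\<^sub>\<infinity>n::int. norm (tgauss \<tau> y (of_int n + of_real l))) \<le> B"
proof -
  from assms have t0: "\<tau> \<noteq> 0" by auto
  obtain B where B: "\<And>w. \<bar>Im w\<bar> \<le> \<bar>Im (y / \<tau>)\<bar> \<Longrightarrow> (\<lambda>n::int. gauss \<tau> (of_int n + w)) norm_summable_on UNIV"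
    "\<And>w. \<bar>Im w\<bar> \<le> \<bar>Im (y / \<tau>)\<bar> \<Longrightarrow> (\<Sum>\<^sub>\<infinity>n::int. norm (gauss \<tau> (of_int n + w))) \<le> B"
    using gauss_sum_bound[OF assms, of "\<bar>Im (y / \<tau>)\<bar>"] by auto
  have im: "\<bar>Im (of_real l + y / \<tau>)\<bar> \<le> \<bar>Im (y / \<tau>)\<bar>" for l by simp
  have eq: "norm (tgauss \<tau> y (of_int n + of_real l)) = norm (gauss (-1 / \<tau>) y) * norm (gauss \<tau> (of_int n + (of_real l + y / \<tau>)))" for n l
    by (simp add: tgauss_eq_gauss[OF t0] norm_mult add.assoc)
  show ?thesis
  proof (rule that)
    show "(\<lambda>n::int. tgauss \<tau> y (of_int n + of_real l)) norm_summable_on UNIV" for l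
      unfolding eq by (intro summable_on_cmult_right B(1) im)
    show "(\<Sum>\<^sub>\<infinity>n::int. norm (tgauss \<tau> y (of_int n + of_real l))) \<le> norm (gauss (-1 / \<tau>) y) * B" for l
      unfolding eq infsum_cmult_right' by (intro mult_left_mono B(2) im) auto
  qed
qed

lemma gauss_inverse_norm_summable:
  assumes "Im \<tau> > 0"
  shows "(\<lambda>m::int. gauss (-1 / \<tau>) (of_int m - y)) norm_summable_on UNIV"
proof -
  have "Im (-1 / \<tau>) > 0"
    using assms by (simp add: Im_divide sum_power2_gt_zero_iff)
  from gauss_abs_summable[OF this, of "-y"] show ?thesis by simp
qed

text \<open>The character \<open>cexp1 (m * l v)\<close> produced by inverting the sum over
  \<open>n\<close> has modulus one, because the shifts \<open>l v\<close> are real.\<close>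

lemma inversion_step:
  fixes f :: "'v \<Rightarrow> complex" and l :: "'v \<Rightarrow> real"
  assumes t: "Im \<tau> > 0" and f: "f norm_summable_on UNIV"
  shows "(\<lambda>(v, n::int). f v * tgauss \<tau> y (of_int n + of_real (l v))) norm_summable_on UNIV"
    and "(\<Sum>\<^sub>\<infinity>(v, n::int). f v * tgauss \<tau> y (of_int n + of_real (l v)))
       = 1 / csqrt (- \<i> * \<tau>) * (\<Sum>\<^sub>\<infinity>m::int. gauss (-1 / \<tau>) (of_int m - y) * (\<Sum>\<^sub>\<infinity>v. f v * cexp1 (of_int m * of_real (l v))))"
proof -
  obtain B where B: "\<And>l. (\<lambda>n::int. tgauss \<tau> y (of_int n + of_real l)) norm_summable_on UNIV"
    "\<And>l. (\<Sum>\<^sub>\<infinity>n::int. norm (tgauss \<tau> y (of_int n + of_real l))) \<le> B"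
    using tgauss_norm_sum_bound[OF t] by blast
  let ?g = "\<lambda>m::int. gauss (-1 / \<tau>) (of_int m - y)"
  show 1: "(\<lambda>(v, n::int). f v * tgauss \<tau> y (of_int n + of_real (l v))) norm_summable_on UNIV"
    unfolding UNIV_Times_UNIV[symmetric]
  proof (subst Infinite_Sum.abs_summable_on_Sigma_iff, intro conjI ballI)
    show "(\<lambda>n. case (v, n) of (v, n) \<Rightarrow> f v * tgauss \<tau> y (of_int n + of_real (l v))) norm_summable_on UNIV" for v
      using summable_on_cmult_right[OF B(1)[of "l v"], of "norm (f v)"] by (simp add: norm_mult)
    have "norm (\<Sum>\<^sub>\<infinity>n. norm (case (v, n) of (v, n) \<Rightarrow> f v * tgauss \<tau> y (of_int n + of_real (l v)))) \<le> norm (f v) * B" for v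
      using mult_left_mono[OF B(2)[of "l v"], of "norm (f v)"]
      by (simp add: norm_mult infsum_cmult_right' infsum_nonneg)
    then show "(\<lambda>v. \<Sum>\<^sub>\<infinity>n. norm (case (v, n) of (v, n) \<Rightarrow> f v * tgauss \<tau> y (of_int n + of_real (l v)))) norm_summable_on UNIV"
      by (intro summable_on_comparison_test[OF summable_on_cmult_left[OF f, of B]]) auto
  qed
  have 2: "(\<lambda>(v, m). f v * (?g m * cexp1 (of_int m * of_real (l v)))) norm_summable_on UNIV \<times> UNIV"
  proof -
    have "norm (case z of (v, m) \<Rightarrow> f v * (?g m * cexp1 (of_int m * of_real (l v)))) = norm (case z of (v, m) \<Rightarrow> f v * ?g m)" for z
      by (auto simp: norm_mult norm_cexp1 split: prod.split)
    then show ?thesis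
      using norm_summable_product[OF f gauss_inverse_norm_summable[OF t]] by simp
  qed
  have "(\<Sum>\<^sub>\<infinity>(v, n::int). f v * tgauss \<tau> y (of_int n + of_real (l v))) = (\<Sum>\<^sub>\<infinity>v. \<Sum>\<^sub>\<infinity>n::int. f v * tgauss \<tau> y (of_int n + of_real (l v)))"
    using abs_summable_summable[OF 1] infsum_Sigma'_banach[of "\<lambda>v (n::int). f v * tgauss \<tau> y (of_int n + of_real (l v))" UNIV "\<lambda>_. UNIV"]
    by simp
  also have "\<dots> = (\<Sum>\<^sub>\<infinity>v. 1 / csqrt (- \<i> * \<tau>) * (\<Sum>\<^sub>\<infinity>m. f v * (?g m * cexp1 (of_int m * of_real (l v)))))"
    by (simp add: infsum_cmult_right' tgauss_sum[OF t] mult_ac)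
  also have "\<dots> = 1 / csqrt (- \<i> * \<tau>) * (\<Sum>\<^sub>\<infinity>v. \<Sum>\<^sub>\<infinity>m. f v * (?g m * cexp1 (of_int m * of_real (l v))))"
    by (rule infsum_cmult_right')
  also have "(\<Sum>\<^sub>\<infinity>v. \<Sum>\<^sub>\<infinity>m. f v * (?g m * cexp1 (of_int m * of_real (l v)))) = (\<Sum>\<^sub>\<infinity>m. \<Sum>\<^sub>\<infinity>v. f v * (?g m * cexp1 (of_int m * of_real (l v))))"
    by (rule infsum_swap_banach[OF abs_summable_summable[OF 2]])
  also have "\<dots> = (\<Sum>\<^sub>\<infinity>m. ?g m * (\<Sum>\<^sub>\<infinity>v. f v * cexp1 (of_int m * of_real (l v))))"
    by (simp add: infsum_cmult_right'[symmetric] mult_ac)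
  finally show "(\<Sum>\<^sub>\<infinity>(v, n::int). f v * tgauss \<tau> y (of_int n + of_real (l v)))
       = 1 / csqrt (- \<i> * \<tau>) * (\<Sum>\<^sub>\<infinity>m. ?g m * (\<Sum>\<^sub>\<infinity>v. f v * cexp1 (of_int m * of_real (l v))))" .
qed

section \<open>Iterated inversion in triangular coordinates\<close>

definition inv_csqrt :: "complex \<Rightarrow> complex" where
  "inv_csqrt \<tau> = 1 / csqrt (- \<i> * \<tau>)"

lemma nested_inversion_1:
  assumes t4: "Im \<tau>4 > 0"
  shows "(\<lambda>d::int. tgauss \<tau>4 y4 (of_int d)) norm_summable_on UNIV"
    and "(\<Sum>\<^sub>\<infinity>d::int. tgauss \<tau>4 y4 (of_int d)) = inv_csqrt \<tau>4 * (\<Sum>\<^sub>\<infinity>m4::int. gauss (-1 / \<tau>4) (of_int m4 - y4))"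
proof -
  show "(\<lambda>d::int. tgauss \<tau>4 y4 (of_int d)) norm_summable_on UNIV"
  proof (rule tgauss_norm_sum_bound[OF t4, of y4])
    assume "\<And>l. (\<lambda>n::int. tgauss \<tau>4 y4 (of_int n + of_real l)) norm_summable_on UNIV"
    from this[of 0] show ?thesis by simp
  qed
  show "(\<Sum>\<^sub>\<infinity>d::int. tgauss \<tau>4 y4 (of_int d)) = inv_csqrt \<tau>4 * (\<Sum>\<^sub>\<infinity>m4::int. gauss (-1 / \<tau>4) (of_int m4 - y4))"
    using tgauss_sum[OF t4, of y4 0] by (simp add: inv_csqrt_def)
qed

text \<open>\<open>X3\<close>, \<open>X2\<close> and \<open>X1\<close> solve N X = k by back
  substitution for the triangular matrix N of \<open>unitri\<close>. Each new integer variable is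
  shifted by a real number depending only on those that precede it, which is the shape required by
  \<open>inversion_step\<close>.\<close>

definition X3 :: "real \<Rightarrow> int \<Rightarrow> int \<Rightarrow> real" where
  "X3 n34 d c = of_int c - n34 * of_int d"

definition X2 :: "real \<Rightarrow> real \<Rightarrow> real \<Rightarrow> int \<Rightarrow> int \<Rightarrow> int \<Rightarrow> real" where
  "X2 n23 n24 n34 d c b = of_int b - n23 * X3 n34 d c - n24 * of_int d"

definition X1 :: "real \<Rightarrow> real \<Rightarrow> real \<Rightarrow> real \<Rightarrow> real \<Rightarrow> real \<Rightarrow> int \<Rightarrow> int \<Rightarrow> int \<Rightarrow> int \<Rightarrow> real" where
  "X1 n12 n13 n14 n23 n24 n34 d c b a = of_int a - n12 * X2 n23 n24 n34 d c b - n13 * X3 n34 d c - n14 * of_int d"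

text \<open>Inverting the sum over \<open>c\<close> leaves the character with argument - m n34 d in
  the sum over \<open>d\<close>; \<open>tgauss_diff\<close> absorbs it into \<open>y4\<close>, and
  the inversion over \<open>d\<close> turns it into the shift m n34. In this way the transposed
  triangular matrix arises on the dual side. The next two lemmas repeat the step.\<close>

lemma nested_inversion_2:
  assumes t3: "Im \<tau>3 > 0" and t4: "Im \<tau>4 > 0"
  shows "(\<lambda>(d, c). tgauss \<tau>4 y4 (of_int d) * tgauss \<tau>3 y3 (of_real (X3 n34 d c))) norm_summable_on UNIV"
    and "(\<Sum>\<^sub>\<infinity>(d, c). tgauss \<tau>4 y4 (of_int d) * tgauss \<tau>3 y3 (of_real (X3 n34 d c)))
      = inv_csqrt \<tau>3 * inv_csqrt \<tau>4 * (\<Sum>\<^sub>\<infinity>m3::int. \<Sum>\<^sub>\<infinity>m4::int. gauss (-1 / \<tau>3) (of_int m3 - y3)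
         * gauss (-1 / \<tau>4) (of_int m4 + of_int m3 * of_real n34 - y4))"
proof -
  let ?f = "\<lambda>d. tgauss \<tau>4 y4 (of_int d)"
  let ?l = "\<lambda>d. - n34 * of_int d"
  note s = inversion_step[OF t3 nested_inversion_1(1)[OF t4, of y4], of y3 ?l]
  have X: "of_int c + complex_of_real (?l d) = of_real (X3 n34 d c)" for c d
    by (simp add: X3_def)
  show "(\<lambda>(d, c). ?f d * tgauss \<tau>3 y3 (of_real (X3 n34 d c))) norm_summable_on UNIV"
    using s(1) unfolding X .
  have tw: "(\<Sum>\<^sub>\<infinity>d. ?f d * cexp1 (of_int m * of_real (?l d)))
      = inv_csqrt \<tau>4 * (\<Sum>\<^sub>\<infinity>m4::int. gauss (-1 / \<tau>4) (of_int m4 + of_int m * of_real n34 - y4))" for m :: int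
  proof -
    have "?f d * cexp1 (of_int m * of_real (?l d)) = tgauss \<tau>4 (y4 - of_int m * of_real n34) (of_int d)" for d
      by (simp add: tgauss_diff mult_ac)
    then show ?thesis
      by (simp add: nested_inversion_1(2)[OF t4] algebra_simps)
  qed
  show "(\<Sum>\<^sub>\<infinity>(d, c). ?f d * tgauss \<tau>3 y3 (of_real (X3 n34 d c)))
      = inv_csqrt \<tau>3 * inv_csqrt \<tau>4 * (\<Sum>\<^sub>\<infinity>m3::int. \<Sum>\<^sub>\<infinity>m4::int. gauss (-1 / \<tau>3) (of_int m3 - y3)
         * gauss (-1 / \<tau>4) (of_int m4 + of_int m3 * of_real n34 - y4))"
    using s(2) unfolding X tw inv_csqrt_def[symmetric]
    by (simp add: infsum_cmult_right' mult.left_commute mult.assoc)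
qed

lemma nested_inversion_3:
  assumes t2: "Im \<tau>2 > 0" and t3: "Im \<tau>3 > 0" and t4: "Im \<tau>4 > 0"
  shows "(\<lambda>((d, c), b). tgauss \<tau>4 y4 (of_int d) * tgauss \<tau>3 y3 (of_real (X3 n34 d c))
      * tgauss \<tau>2 y2 (of_real (X2 n23 n24 n34 d c b))) norm_summable_on UNIV"
    and "(\<Sum>\<^sub>\<infinity>((d, c), b). tgauss \<tau>4 y4 (of_int d) * tgauss \<tau>3 y3 (of_real (X3 n34 d c))
      * tgauss \<tau>2 y2 (of_real (X2 n23 n24 n34 d c b)))
      = inv_csqrt \<tau>2 * inv_csqrt \<tau>3 * inv_csqrt \<tau>4 * (\<Sum>\<^sub>\<infinity>m2::int. \<Sum>\<^sub>\<infinity>m3::int. \<Sum>\<^sub>\<infinity>m4::int.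
          gauss (-1 / \<tau>2) (of_int m2 - y2)
         * (gauss (-1 / \<tau>3) (of_int m3 + of_int m2 * of_real n23 - y3)
         * gauss (-1 / \<tau>4) (of_int m4 + of_int m3 * of_real n34 + of_int m2 * of_real n24 - y4)))"
proof -
  let ?f = "\<lambda>(d, c). tgauss \<tau>4 y4 (of_int d) * tgauss \<tau>3 y3 (of_real (X3 n34 d c))"
  let ?l = "\<lambda>(d, c). - n23 * X3 n34 d c - n24 * of_int d"
  note s = inversion_step[OF t2 nested_inversion_2(1)[OF t3 t4, of y4 y3 n34], of y2 ?l]
  have X: "?f v * tgauss \<tau>2 y2 (of_int b + of_real (?l v)) = (case v of (d, c) \<Rightarrow> \<lambda>b.
      tgauss \<tau>4 y4 (of_int d) * tgauss \<tau>3 y3 (of_real (X3 n34 d c)) * tgauss \<tau>2 y2 (of_real (X2 n23 n24 n34 d c b))) b" for v b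
    by (auto simp: X2_def algebra_simps split: prod.split)
  show "(\<lambda>((d, c), b). tgauss \<tau>4 y4 (of_int d) * tgauss \<tau>3 y3 (of_real (X3 n34 d c))
      * tgauss \<tau>2 y2 (of_real (X2 n23 n24 n34 d c b))) norm_summable_on UNIV"
    using s(1) unfolding X .
  have tw: "(\<Sum>\<^sub>\<infinity>v. ?f v * cexp1 (of_int m * of_real (?l v)))
      = inv_csqrt \<tau>3 * inv_csqrt \<tau>4 * (\<Sum>\<^sub>\<infinity>m3::int. \<Sum>\<^sub>\<infinity>m4::int.
         gauss (-1 / \<tau>3) (of_int m3 + of_int m * of_real n23 - y3)
         * gauss (-1 / \<tau>4) (of_int m4 + of_int m3 * of_real n34 + of_int m * of_real n24 - y4))" for m :: int
  proof -
    have "?f v * cexp1 (of_int m * of_real (?l v)) = (case v of (d, c) \<Rightarrow>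
        tgauss \<tau>4 (y4 - of_int m * of_real n24) (of_int d)
        * tgauss \<tau>3 (y3 - of_int m * of_real n23) (of_real (X3 n34 d c)))" for v
    proof -
      obtain d c where v: "v = (d, c)" by (cases v)
      have "cexp1 (of_int m * of_real (?l v)) = cexp1 (- of_int m * of_real n24 * of_int d)
          * cexp1 (- of_int m * of_real n23 * of_real (X3 n34 d c))"
        unfolding cexp1_add[symmetric] by (intro arg_cong[where f = cexp1]) (simp add: v algebra_simps)
      then show ?thesis
        by (simp add: v tgauss_diff mult_ac)
    qed
    then show ?thesis
      by (simp add: nested_inversion_2(2)[OF t3 t4] diff_diff_eq2 algebra_simps)
  qed
  show "(\<Sum>\<^sub>\<infinity>((d, c), b). tgauss \<tau>4 y4 (of_int d) * tgauss \<tau>3 y3 (of_real (X3 n34 d c))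
      * tgauss \<tau>2 y2 (of_real (X2 n23 n24 n34 d c b)))
      = inv_csqrt \<tau>2 * inv_csqrt \<tau>3 * inv_csqrt \<tau>4 * (\<Sum>\<^sub>\<infinity>m2::int. \<Sum>\<^sub>\<infinity>m3::int. \<Sum>\<^sub>\<infinity>m4::int.
          gauss (-1 / \<tau>2) (of_int m2 - y2)
         * (gauss (-1 / \<tau>3) (of_int m3 + of_int m2 * of_real n23 - y3)
         * gauss (-1 / \<tau>4) (of_int m4 + of_int m3 * of_real n34 + of_int m2 * of_real n24 - y4)))"
    using s(2) unfolding X tw inv_csqrt_def[symmetric]
    by (simp add: infsum_cmult_right' mult.left_commute mult.assoc)
qed

lemma nested_inversion_4:
  assumes t1: "Im \<tau>1 > 0" and t2: "Im \<tau>2 > 0" and t3: "Im \<tau>3 > 0" and t4: "Im \<tau>4 > 0"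
  shows "(\<Sum>\<^sub>\<infinity>(((d, c), b), a). tgauss \<tau>4 y4 (of_int d) * tgauss \<tau>3 y3 (of_real (X3 n34 d c))
      * tgauss \<tau>2 y2 (of_real (X2 n23 n24 n34 d c b)) * tgauss \<tau>1 y1 (of_real (X1 n12 n13 n14 n23 n24 n34 d c b a)))
      = inv_csqrt \<tau>1 * inv_csqrt \<tau>2 * inv_csqrt \<tau>3 * inv_csqrt \<tau>4 * (\<Sum>\<^sub>\<infinity>m1::int. \<Sum>\<^sub>\<infinity>m2::int. \<Sum>\<^sub>\<infinity>m3::int. \<Sum>\<^sub>\<infinity>m4::int.
          gauss (-1 / \<tau>1) (of_int m1 - y1) * (gauss (-1 / \<tau>2) (of_int m2 + of_int m1 * of_real n12 - y2)
         * (gauss (-1 / \<tau>3) (of_int m3 + of_int m2 * of_real n23 + of_int m1 * of_real n13 - y3)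
         * gauss (-1 / \<tau>4) (of_int m4 + of_int m3 * of_real n34 + of_int m2 * of_real n24 + of_int m1 * of_real n14 - y4))))"
proof -
  let ?f = "\<lambda>((d, c), b). tgauss \<tau>4 y4 (of_int d) * tgauss \<tau>3 y3 (of_real (X3 n34 d c))
      * tgauss \<tau>2 y2 (of_real (X2 n23 n24 n34 d c b))"
  let ?l = "\<lambda>((d, c), b). - n12 * X2 n23 n24 n34 d c b - n13 * X3 n34 d c - n14 * of_int d"
  note s = inversion_step[OF t1 nested_inversion_3(1)[OF t2 t3 t4, of y4 y3 n34 y2 n23 n24], of y1 ?l]
  have X: "?f v * tgauss \<tau>1 y1 (of_int a + of_real (?l v)) = (\<lambda>(((d, c), b), a).
      tgauss \<tau>4 y4 (of_int d) * tgauss \<tau>3 y3 (of_real (X3 n34 d c)) * tgauss \<tau>2 y2 (of_real (X2 n23 n24 n34 d c b))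
       * tgauss \<tau>1 y1 (of_real (X1 n12 n13 n14 n23 n24 n34 d c b a))) (v, a)" for v a
    by (auto simp: X1_def algebra_simps split: prod.split)
  have tw: "(\<Sum>\<^sub>\<infinity>v. ?f v * cexp1 (of_int m * of_real (?l v)))
      = inv_csqrt \<tau>2 * inv_csqrt \<tau>3 * inv_csqrt \<tau>4 * (\<Sum>\<^sub>\<infinity>m2::int. \<Sum>\<^sub>\<infinity>m3::int. \<Sum>\<^sub>\<infinity>m4::int.
         gauss (-1 / \<tau>2) (of_int m2 + of_int m * of_real n12 - y2)
         * (gauss (-1 / \<tau>3) (of_int m3 + of_int m2 * of_real n23 + of_int m * of_real n13 - y3)
         * gauss (-1 / \<tau>4) (of_int m4 + of_int m3 * of_real n34 + of_int m2 * of_real n24 + of_int m * of_real n14 - y4)))" for m :: int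
  proof -
    have "?f v * cexp1 (of_int m * of_real (?l v)) = (\<lambda>((d, c), b).
        tgauss \<tau>4 (y4 - of_int m * of_real n14) (of_int d)
        * tgauss \<tau>3 (y3 - of_int m * of_real n13) (of_real (X3 n34 d c))
        * tgauss \<tau>2 (y2 - of_int m * of_real n12) (of_real (X2 n23 n24 n34 d c b))) v" for v
    proof -
      obtain d c b where v: "v = ((d, c), b)" by (metis prod.collapse)
      have "cexp1 (of_int m * of_real (?l v)) = cexp1 (- of_int m * of_real n14 * of_int d)
          * cexp1 (- of_int m * of_real n13 * of_real (X3 n34 d c)) * cexp1 (- of_int m * of_real n12 * of_real (X2 n23 n24 n34 d c b))"
        unfolding cexp1_add[symmetric] by (intro arg_cong[where f = cexp1]) (simp add: v algebra_simps)
      then show ?thesis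
        by (simp add: v tgauss_diff mult_ac)
    qed
    then show ?thesis
      by (simp only: nested_inversion_3(2)[OF t2 t3 t4]) (simp add: algebra_simps)
  qed
  show ?thesis
    using s(2) unfolding X tw inv_csqrt_def[symmetric] case_prod_eta
    by (simp add: infsum_cmult_right' mult.left_commute mult.assoc)
qed

section \<open>Triangular decomposition of positive definite forms\<close>

lemma vector_4 [simp]:
  fixes w x y z :: "'a::zero"
  shows "(vector [w, x, y, z] :: 'a^4) $ 1 = w"
    "(vector [w, x, y, z] :: 'a^4) $ 2 = x"
    "(vector [w, x, y, z] :: 'a^4) $ 3 = y"
    "(vector [w, x, y, z] :: 'a^4) $ 4 = z"
  unfolding vector_def by simp_all

text \<open>Completing the square in the last variable: the choice x2 = - r12 / r22 annihilates the
  square, so the coefficient left for x1 is a value of the form and hence positive.\<close>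

lemma ldl_2:
  fixes r11 r12 r22 :: real
  assumes pd: "\<And>x1 x2. \<not> (x1 = 0 \<and> x2 = 0) \<Longrightarrow> r11 * x1\<^sup>2 + r22 * x2\<^sup>2 + 2 * (r12 * x1 * x2) > 0"
  obtains s1 s2 n12 where "s1 > 0" "s2 > 0" "r22 = s2" "r12 = s2 * n12" "r11 = s1 + s2 * n12\<^sup>2"
proof -
  have s: "r22 > 0" using pd[of 0 1] by simp
  moreover have "r11 - r22 * (r12 / r22)\<^sup>2 > 0"
    using pd[of 1 "- r12 / r22"] s by (simp add: field_simps power2_eq_square)
  ultimately show ?thesis
    using that[of "r11 - r22 * (r12 / r22)\<^sup>2" r22 "r12 / r22"] by simp
qed

lemma ldl_3:
  fixes r11 r12 r13 r22 r23 r33 :: real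
  assumes pd: "\<And>x1 x2 x3. \<not> (x1 = 0 \<and> x2 = 0 \<and> x3 = 0) \<Longrightarrow>
    r11 * x1\<^sup>2 + r22 * x2\<^sup>2 + r33 * x3\<^sup>2 + 2 * (r12 * x1 * x2 + r13 * x1 * x3 + r23 * x2 * x3) > 0"
  obtains s1 s2 s3 n12 n13 n23 where "s1 > 0" "s2 > 0" "s3 > 0" "r33 = s3" "r23 = s3 * n23" "r13 = s3 * n13"
    "r22 = s2 + s3 * n23\<^sup>2" "r12 = s2 * n12 + s3 * n13 * n23" "r11 = s1 + s2 * n12\<^sup>2 + s3 * n13\<^sup>2"
proof -
  have s: "r33 > 0" using pd[of 0 0 1] by simp
  define n13 n23 where "n13 = r13 / r33" and "n23 = r23 / r33"
  have n: "r13 = r33 * n13" "r23 = r33 * n23" using s by (auto simp: n13_def n23_def)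
  have "(r11 - r33 * n13\<^sup>2) * x1\<^sup>2 + (r22 - r33 * n23\<^sup>2) * x2\<^sup>2 + 2 * ((r12 - r33 * n13 * n23) * x1 * x2) > 0"
    if "\<not> (x1 = 0 \<and> x2 = 0)" for x1 x2
  proof -
    \<comment> \<open>This value of \<open>x3\<close> annihilates the square r33 (x3 + n13 x1 + n23
      x2)^2, and the form takes the value of the Schur complement.\<close>
    have "\<not> (x1 = 0 \<and> x2 = 0 \<and> - (n13 * x1 + n23 * x2) = 0)" using that by blast
    from pd[OF this] show ?thesis by (simp add: n algebra_simps power2_eq_square)
  qed
  then obtain s1 s2 n12 where "s1 > 0" "s2 > 0" "r22 - r33 * n23\<^sup>2 = s2" "r12 - r33 * n13 * n23 = s2 * n12"
    "r11 - r33 * n13\<^sup>2 = s1 + s2 * n12\<^sup>2"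
    using ldl_2[of "r11 - r33 * n13\<^sup>2" "r22 - r33 * n23\<^sup>2" "r12 - r33 * n13 * n23"] by blast
  with s n show ?thesis
    by (intro that[of s1 s2 r33 n23 n13 n12]) auto
qed

lemma ldl_4:
  fixes r11 r12 r13 r14 r22 r23 r24 r33 r34 r44 :: real
  assumes pd: "\<And>x1 x2 x3 x4. \<not> (x1 = 0 \<and> x2 = 0 \<and> x3 = 0 \<and> x4 = 0) \<Longrightarrow>
    r11 * x1\<^sup>2 + r22 * x2\<^sup>2 + r33 * x3\<^sup>2 + r44 * x4\<^sup>2 + 2 * (r12 * x1 * x2 + r13 * x1 * x3 + r14 * x1 * x4
     + r23 * x2 * x3 + r24 * x2 * x4 + r34 * x3 * x4) > 0"
  obtains s1 s2 s3 s4 n12 n13 n14 n23 n24 n34 where "s1 > 0" "s2 > 0" "s3 > 0" "s4 > 0"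
    "r44 = s4" "r34 = s4 * n34" "r24 = s4 * n24" "r14 = s4 * n14"
    "r33 = s3 + s4 * n34\<^sup>2" "r23 = s3 * n23 + s4 * n24 * n34" "r13 = s3 * n13 + s4 * n14 * n34"
    "r22 = s2 + s3 * n23\<^sup>2 + s4 * n24\<^sup>2" "r12 = s2 * n12 + s3 * n13 * n23 + s4 * n14 * n24"
    "r11 = s1 + s2 * n12\<^sup>2 + s3 * n13\<^sup>2 + s4 * n14\<^sup>2"
proof -
  have s: "r44 > 0" using pd[of 0 0 0 1] by simp
  define n14 n24 n34 where "n14 = r14 / r44" and "n24 = r24 / r44" and "n34 = r34 / r44"
  have n: "r14 = r44 * n14" "r24 = r44 * n24" "r34 = r44 * n34" using s by (auto simp: n14_def n24_def n34_def)
  have "(r11 - r44 * n14\<^sup>2) * x1\<^sup>2 + (r22 - r44 * n24\<^sup>2) * x2\<^sup>2 + (r33 - r44 * n34\<^sup>2) * x3\<^sup>2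
     + 2 * ((r12 - r44 * n14 * n24) * x1 * x2 + (r13 - r44 * n14 * n34) * x1 * x3 + (r23 - r44 * n24 * n34) * x2 * x3) > 0"
    if "\<not> (x1 = 0 \<and> x2 = 0 \<and> x3 = 0)" for x1 x2 x3
  proof -
    have "\<not> (x1 = 0 \<and> x2 = 0 \<and> x3 = 0 \<and> - (n14 * x1 + n24 * x2 + n34 * x3) = 0)" using that by blast
    from pd[OF this] show ?thesis by (simp add: n algebra_simps power2_eq_square)
  qed
  then obtain s1 s2 s3 n12 n13 n23 where "s1 > 0" "s2 > 0" "s3 > 0" "r33 - r44 * n34\<^sup>2 = s3" "r23 - r44 * n24 * n34 = s3 * n23"
    "r13 - r44 * n14 * n34 = s3 * n13" "r22 - r44 * n24\<^sup>2 = s2 + s3 * n23\<^sup>2"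
    "r12 - r44 * n14 * n24 = s2 * n12 + s3 * n13 * n23" "r11 - r44 * n14\<^sup>2 = s1 + s2 * n12\<^sup>2 + s3 * n13\<^sup>2"
    by (rule ldl_3) blast
  with s n show ?thesis
    by (intro that[of s1 s2 s3 r44 n34 n24 n14 n23 n13 n12]) auto
qed

section \<open>Quadratic forms extended complex-bilinearly, and absolute convergence over
  Z^4\<close>

definition cquad :: "real^'n^'n \<Rightarrow> complex^'n \<Rightarrow> complex" where
  "cquad Q x = (\<Sum>i\<in>UNIV. \<Sum>j\<in>UNIV. of_real (Q $ i $ j) * x $ i * x $ j)"

definition civ :: "int^'n \<Rightarrow> complex^'n" where
  "civ k = (\<chi> i. of_int (k $ i))"

definition riv :: "int^'n \<Rightarrow> real^'n" where
  "riv k = (\<chi> i. of_int (k $ i))"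

text \<open>The minimum over the unit sphere is attained and positive; homogeneity of degree two
  extends the bound to all vectors.\<close>

lemma pos_def_lower_bound:
  assumes "pos_def (M :: real^'n^'n)"
  obtains e where "e > 0" "\<And>x. x \<bullet> (M *v x) \<ge> e * (x \<bullet> x)"
proof -
  let ?S = "sphere (0 :: real^'n) 1"
  have ne: "?S \<noteq> {}" by simp
  have "continuous_on ?S (\<lambda>x. x \<bullet> (M *v x))"
    by (intro continuous_intros matrix_vector_mult_linear_continuous_on)
  then obtain y where y: "y \<in> ?S" "\<And>x. x \<in> ?S \<Longrightarrow> y \<bullet> (M *v y) \<le> x \<bullet> (M *v x)"
    using continuous_attains_inf[OF compact_sphere ne] by blast
  have "y \<noteq> 0" using y(1) by auto
  then have pos: "y \<bullet> (M *v y) > 0" using assms by (simp add: pos_def_def)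
  moreover have "x \<bullet> (M *v x) \<ge> (y \<bullet> (M *v y)) * (x \<bullet> x)" for x
  proof (cases "x = 0")
    case False
    have "y \<bullet> (M *v y) \<le> (x /\<^sub>R norm x) \<bullet> (M *v (x /\<^sub>R norm x))"
      using False by (intro y) auto
    also have "\<dots> = (x \<bullet> (M *v x)) / (norm x)\<^sup>2"
      by (simp add: matrix_vector_mult_scaleR power2_eq_square divide_simps)
    finally show ?thesis
      using False by (simp add: field_simps dot_square_norm)
  qed auto
  ultimately show ?thesis using that by blast
qed

text \<open>The nesting of pairs is the one in which \<open>nested_inversion_4\<close> sums; its
  outermost variable \<open>a\<close> is stored as coordinate 4.\<close>

definition tup4 :: "((int \<times> int) \<times> int) \<times> int \<Rightarrow> int^4" where
  "tup4 = (\<lambda>(((d, c), b), a). vector [b, c, d, a])"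

lemma bij_tup4: "bij tup4"
  by (rule bij_betw_byWitness[where f' = "\<lambda>k. (((k $ 3, k $ 2), k $ 1), k $ 4)"])
     (auto simp: tup4_def vec_eq_iff forall_4)

text \<open>The linear term \<open>c\<close> accounts for a complex shift of the quadratic form.
  Coordinate by coordinate, \<open>linear_le_quadratic\<close> with slope |c_i| + 1 spends the
  quadratic term on the linear one and retains the decay exp (- |k_i|).\<close>

lemma norm_summable_int4:
  fixes f :: "int^4 \<Rightarrow> complex"
  assumes a: "a > 0" and f: "\<And>k. norm (f k) \<le> exp (c0 + (\<Sum>i\<in>UNIV. c $ i * of_int (k $ i)) - a * (\<Sum>i\<in>UNIV. (of_int (k $ i))\<^sup>2))"
  shows "f norm_summable_on UNIV"
proof -
  define h :: "int \<Rightarrow> complex" where "h = (\<lambda>n. of_real (exp (- \<bar>real_of_int n\<bar>)))"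
  have h: "h norm_summable_on UNIV"
    using summable_exp_neg_abs_int by (simp add: h_def)
  define K where "K = exp (c0 + (\<Sum>i\<in>UNIV. (\<bar>c $ i\<bar> + 1)\<^sup>2 / (4 * a)))"
  have bound: "norm (f k) \<le> norm (of_real K * (h (k $ 3) * h (k $ 2) * h (k $ 1) * h (k $ 4)))" for k
  proof -
    have i: "c $ i * of_int (k $ i) - a * (of_int (k $ i))\<^sup>2 \<le> (\<bar>c $ i\<bar> + 1)\<^sup>2 / (4 * a) - \<bar>real_of_int (k $ i)\<bar>" for i
    proof -
      have "(\<bar>c $ i\<bar> + 1) * \<bar>real_of_int (k $ i)\<bar> \<le> a * \<bar>real_of_int (k $ i)\<bar>\<^sup>2 + (\<bar>c $ i\<bar> + 1)\<^sup>2 / (4 * a)"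
        by (rule linear_le_quadratic[OF a])
      moreover have "c $ i * of_int (k $ i) \<le> \<bar>c $ i\<bar> * \<bar>real_of_int (k $ i)\<bar>"
        by (metis abs_ge_self abs_mult)
      ultimately show ?thesis by (simp add: algebra_simps)
    qed
    have "c0 + (\<Sum>i\<in>UNIV. c $ i * of_int (k $ i)) - a * (\<Sum>i\<in>UNIV. (of_int (k $ i))\<^sup>2)
      = c0 + (\<Sum>i\<in>UNIV. c $ i * of_int (k $ i) - a * (of_int (k $ i))\<^sup>2)"
      by (simp add: sum_subtractf sum_distrib_left)
    also have "\<dots> \<le> c0 + (\<Sum>i\<in>UNIV. (\<bar>c $ i\<bar> + 1)\<^sup>2 / (4 * a) - \<bar>real_of_int (k $ i)\<bar>)"
      by (intro add_left_mono sum_mono i)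
    also have "\<dots> = (c0 + (\<Sum>i\<in>UNIV. (\<bar>c $ i\<bar> + 1)\<^sup>2 / (4 * a))) + (- \<bar>real_of_int (k $ 3)\<bar> + - \<bar>real_of_int (k $ 2)\<bar> + - \<bar>real_of_int (k $ 1)\<bar> + - \<bar>real_of_int (k $ 4)\<bar>)"
      by (simp add: sum_subtractf sum_4)
    finally have "norm (f k) \<le> exp ((c0 + (\<Sum>i\<in>UNIV. (\<bar>c $ i\<bar> + 1)\<^sup>2 / (4 * a))) + (- \<bar>real_of_int (k $ 3)\<bar> + - \<bar>real_of_int (k $ 2)\<bar> + - \<bar>real_of_int (k $ 1)\<bar> + - \<bar>real_of_int (k $ 4)\<bar>))"
      using f[of k] by (meson exp_le_cancel_iff order_trans)
    then show ?thesis
      by (simp only: exp_add) (simp add: K_def h_def norm_mult exp_add)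
  qed
  have "(\<lambda>(((d, c), b), a). h d * h c * h b * h a) norm_summable_on UNIV"
    using norm_summable_product[OF norm_summable_product[OF norm_summable_product[OF h h] h] h]
    by (simp add: case_prod_unfold)
  then have "(\<lambda>z. norm (case tup4 z of k \<Rightarrow> of_real K * (h (k $ 3) * h (k $ 2) * h (k $ 1) * h (k $ 4)))) summable_on UNIV"
    by (auto simp: tup4_def case_prod_unfold norm_mult intro!: summable_on_cmult_right)
  then have "(\<lambda>k::int^4. norm (of_real K * (h (k $ 3) * h (k $ 2) * h (k $ 1) * h (k $ 4)))) summable_on UNIV"
    by (subst (asm) summable_on_reindex_bij_betw[OF bij_tup4])
  then show ?thesis
    by (rule summable_on_comparison_test) (use bound in auto)
qed

lemma infsum_nested4:
  fixes h :: "int \<Rightarrow> int \<Rightarrow> int \<Rightarrow> int \<Rightarrow> complex"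
  assumes s: "(\<lambda>(a, b, c, d). h a b c d) summable_on UNIV"
  shows "(\<Sum>\<^sub>\<infinity>(a, b, c, d). h a b c d) = (\<Sum>\<^sub>\<infinity>a. \<Sum>\<^sub>\<infinity>b. \<Sum>\<^sub>\<infinity>c. \<Sum>\<^sub>\<infinity>d. h a b c d)"
proof -
  have s1: "(\<lambda>(b, c, d). h a b c d) summable_on UNIV" for a
    using summable_on_SigmaD1[of "\<lambda>a (b, c, d). h a b c d" UNIV "\<lambda>_. UNIV" a] s by (simp add: case_prod_unfold)
  have s2: "(\<lambda>(c, d). h a b c d) summable_on UNIV" for a b
    using summable_on_SigmaD1[of "\<lambda>b (c, d). h a b c d" UNIV "\<lambda>_. UNIV" b] s1[of a] by (simp add: case_prod_unfold)
  have e1: "(\<Sum>\<^sub>\<infinity>(a, b, c, d). h a b c d) = (\<Sum>\<^sub>\<infinity>a. \<Sum>\<^sub>\<infinity>(b, c, d). h a b c d)"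
    using infsum_Sigma'_banach[of "\<lambda>a (b, c, d). h a b c d" UNIV "\<lambda>_. UNIV"] s by (simp add: case_prod_unfold)
  have e2: "(\<Sum>\<^sub>\<infinity>(b, c, d). h a b c d) = (\<Sum>\<^sub>\<infinity>b. \<Sum>\<^sub>\<infinity>(c, d). h a b c d)" for a
    using infsum_Sigma'_banach[of "\<lambda>b (c, d). h a b c d" UNIV "\<lambda>_. UNIV"] s1[of a] by (simp add: case_prod_unfold)
  have e3: "(\<Sum>\<^sub>\<infinity>(c, d). h a b c d) = (\<Sum>\<^sub>\<infinity>c. \<Sum>\<^sub>\<infinity>d. h a b c d)" for a b
    using infsum_Sigma'_banach[of "\<lambda>c d. h a b c d" UNIV "\<lambda>_. UNIV"] s2[of a b] by (simp add: case_prod_unfold)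
  show ?thesis by (simp only: e1 e2 e3)
qed

text \<open>The root of - \<i> \<tau> has positive real part, so a positive factor keeps it on the
  principal branch.\<close>

lemma inv_csqrt_scale:
  assumes "q > 0" "Im \<tau> > 0"
  shows "inv_csqrt (\<tau> * of_real q) = inv_csqrt \<tau> / of_real (sqrt q)"
proof -
  have "csqrt (- \<i> * (\<tau> * of_real q)) = of_real (sqrt q) * csqrt (- \<i> * \<tau>)"
  proof (rule csqrt_unique)
    show "(of_real (sqrt q) * csqrt (- \<i> * \<tau>))\<^sup>2 = - \<i> * (\<tau> * of_real q)"
      using assms by (simp add: power_mult_distrib flip: of_real_power)
    have "Re (csqrt (- \<i> * \<tau>)) > 0"
    proof -
      define r where "r = csqrt (- \<i> * \<tau>)"
      have "r\<^sup>2 = - \<i> * \<tau>" by (simp add: r_def)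
      from arg_cong[OF this, of Re] have "Re r * Re r - Im r * Im r = Im \<tau>"
        by (simp add: power2_eq_square)
      then have "Re r \<noteq> 0"
        using assms(2) zero_le_square[of "Im r"] by (metis diff_0 diff_gt_0_iff_gt mult_zero_left not_less)
      then have "Re (csqrt (- \<i> * \<tau>)) \<noteq> 0" unfolding r_def .
      then show ?thesis
        using csqrt_principal[of "- \<i> * \<tau>"] by auto
    qed
    then show "0 < Re (of_real (sqrt q) * csqrt (- \<i> * \<tau>)) \<or> Re (of_real (sqrt q) * csqrt (- \<i> * \<tau>)) = 0 \<and> 0 \<le> Im (of_real (sqrt q) * csqrt (- \<i> * \<tau>))"
      using assms by (simp del: csqrt.sel)
  qed
  then show ?thesis by (simp add: inv_csqrt_def)
qed

text \<open>The fourth power removes the branch and leaves (- \<i> \<tau>)^2 = - \<tau>^2. This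
  minus sign rules out even unimodular forms of rank four and makes the summands of the trace
  cancel.\<close>

lemma inv_csqrt_pow4: "inv_csqrt \<tau> ^ 4 = - 1 / \<tau>\<^sup>2"
proof -
  have "x ^ 4 = (x\<^sup>2)\<^sup>2" for x :: complex
    by (simp add: power2_eq_square power4_eq_xxxx)
  then have "csqrt (- \<i> * \<tau>) ^ 4 = ((csqrt (- \<i> * \<tau>))\<^sup>2)\<^sup>2" .
  also have "\<dots> = - (\<tau>\<^sup>2)" by (simp only: power2_csqrt) (simp add: power_mult_distrib)
  finally show ?thesis by (simp add: inv_csqrt_def power_divide)
qed

section \<open>Theta inversion in rank four\<close>

lemma cquad_civ: "cquad M (civ k) = of_real (riv k \<bullet> (M *v riv k))"
  by (simp add: cquad_def civ_def riv_def inner_vec_def matrix_vector_mult_def sum_distrib_left mult_ac)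

lemma pos_def_sym:
  assumes "pos_def Q"
  shows "Q $ i $ j = Q $ j $ i"
proof -
  have "transpose Q $ j $ i = Q $ j $ i"
    using assms by (simp add: pos_def_def)
  then show ?thesis
    by (simp add: transpose_def)
qed

lemma cquad_norm_summable:
  fixes Q :: "real^4^4"
  assumes Q: "pos_def Q" and s: "Im \<sigma> > 0"
  shows "(\<lambda>m. exp (of_real pi * \<i> * \<sigma> * cquad Q (civ m - w))) norm_summable_on UNIV"
proof -
  obtain e where e: "e > 0" "\<And>x. x \<bullet> (Q *v x) \<ge> e * (x \<bullet> x)"
    by (rule pos_def_lower_bound[OF Q]) (rule that)
  have sym: "Q $ i $ j = Q $ j $ i" for i j
    by (rule pos_def_sym[OF Q])
  \<comment> \<open>The coefficients of the part linear in \<open>k\<close> after expanding the form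
    at \<open>civ k - w\<close>.\<close>
  define c where "c = (\<chi> i. 2 * pi * Im (\<sigma> * (\<Sum>j\<in>UNIV. of_real (Q $ i $ j) * w $ j)))"
  show ?thesis
  proof (rule norm_summable_int4)
    show "pi * Im \<sigma> * e > 0" using e s by simp
    fix k :: "int^4"
    have "cquad Q (civ k - w) = cquad Q (civ k) - 2 * (\<Sum>i\<in>UNIV. civ k $ i * (\<Sum>j\<in>UNIV. of_real (Q $ i $ j) * w $ j)) + cquad Q w"
    proof -
      have "(\<Sum>i\<in>UNIV. \<Sum>j\<in>UNIV. of_real (Q $ i $ j) * w $ i * civ k $ j) = (\<Sum>i\<in>UNIV. civ k $ i * (\<Sum>j\<in>UNIV. of_real (Q $ i $ j) * w $ j))"
        unfolding sum_distrib_left by (subst sum.swap) (simp add: sym mult_ac)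
      moreover have "(\<Sum>i\<in>UNIV. \<Sum>j\<in>UNIV. of_real (Q $ i $ j) * civ k $ i * w $ j) = (\<Sum>i\<in>UNIV. civ k $ i * (\<Sum>j\<in>UNIV. of_real (Q $ i $ j) * w $ j))"
        unfolding sum_distrib_left by (simp add: mult_ac)
      ultimately show ?thesis
        by (simp add: cquad_def ring_distribs sum.distrib sum_subtractf)
    qed
    also have "- pi * Im (\<sigma> * \<dots>) = - pi * Im \<sigma> * (riv k \<bullet> (Q *v riv k)) + (\<Sum>i\<in>UNIV. c $ i * of_int (k $ i)) - pi * Im (\<sigma> * cquad Q w)"
    proof -
      have "(\<Sum>i\<in>UNIV. c $ i * of_int (k $ i)) = 2 * pi * Im (\<sigma> * (\<Sum>i\<in>UNIV. civ k $ i * (\<Sum>j\<in>UNIV. of_real (Q $ i $ j) * w $ j)))"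
        unfolding sum_distrib_left[of \<sigma>] Im_sum sum_distrib_left[of "2 * pi"]
        by (intro sum.cong refl) (simp add: c_def civ_def algebra_simps)
      then show ?thesis
        by (simp add: cquad_civ algebra_simps)
    qed
    finally have eq: "- pi * Im (\<sigma> * cquad Q (civ k - w)) = \<dots>" .
    have "norm (exp (of_real pi * \<i> * \<sigma> * cquad Q (civ k - w))) = exp (- pi * Im (\<sigma> * cquad Q (civ k - w)))"
      by (simp add: algebra_simps)
    also have "\<dots> \<le> exp (- pi * Im (\<sigma> * cquad Q w) + (\<Sum>i\<in>UNIV. c $ i * of_int (k $ i)) - pi * Im \<sigma> * e * (\<Sum>i\<in>UNIV. (of_int (k $ i))\<^sup>2))"
    proof -
      have "e * (\<Sum>i\<in>UNIV. (of_int (k $ i))\<^sup>2) \<le> riv k \<bullet> (Q *v riv k)"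
        using e(2)[of "riv k"] by (simp add: inner_vec_def riv_def power2_eq_square)
      from mult_left_mono[OF this, of "pi * Im \<sigma>"] s show ?thesis
        unfolding eq by (simp add: mult.assoc)
    qed
    finally show "norm (exp (of_real pi * \<i> * \<sigma> * cquad Q (civ k - w))) \<le>
      exp (- pi * Im (\<sigma> * cquad Q w) + (\<Sum>i\<in>UNIV. c $ i * of_int (k $ i)) - pi * Im \<sigma> * e * (\<Sum>i\<in>UNIV. (of_int (k $ i))\<^sup>2))" .
  qed
qed

text \<open>The rows are indexed by \<open>1, 2, 3, 4 :: 4\<close>, and \<open>4 = 0\<close> is the least element of this
  type: the triangular shape refers to the order \<open>4 < 1 < 2 < 3\<close>.\<close>

definition unitri :: "real \<Rightarrow> real \<Rightarrow> real \<Rightarrow> real \<Rightarrow> real \<Rightarrow> real \<Rightarrow> real^4^4" where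
  "unitri n12 n13 n14 n23 n24 n34 =
     vector [vector [1, n23, n24, 0], vector [0, 1, n34, 0], vector [0, 0, 1, 0], vector [n12, n13, n14, 1]]"

definition diag4 :: "real \<Rightarrow> real \<Rightarrow> real \<Rightarrow> real \<Rightarrow> real^4^4" where
  "diag4 s1 s2 s3 s4 =
     vector [vector [s2, 0, 0, 0], vector [0, s3, 0, 0], vector [0, 0, s4, 0], vector [0, 0, 0, s1]]"

lemma det_unitri: "det (unitri n12 n13 n14 n23 n24 n34) = 1"
proof -
  have *: "\<forall>i j. i > j \<longrightarrow> unitri n12 n13 n14 n23 n24 n34 $ i $ j = 0"
    unfolding forall_4 by (simp add: less_bit0_def bit0.Rep_numeral bit0.Rep_1 unitri_def)
  have "det (unitri n12 n13 n14 n23 n24 n34) = prod (\<lambda>i. unitri n12 n13 n14 n23 n24 n34 $ i $ i) UNIV"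
    by (rule det_upperdiagonal) (rule *[rule_format])
  also have "\<dots> = 1"
    unfolding UNIV_4 by (simp add: unitri_def)
  finally show ?thesis .
qed

lemma det_diag4: "det (diag4 s1 s2 s3 s4) = s1 * s2 * s3 * s4"
proof -
  have *: "\<forall>i j. i \<noteq> j \<longrightarrow> diag4 s1 s2 s3 s4 $ i $ j = 0"
    unfolding forall_4 by (simp add: diag4_def)
  have "det (diag4 s1 s2 s3 s4) = prod (\<lambda>i. diag4 s1 s2 s3 s4 $ i $ i) UNIV"
    by (rule det_diagonal) (rule *[rule_format])
  also have "\<dots> = s1 * s2 * s3 * s4"
    unfolding UNIV_4 by (simp add: diag4_def)
  finally show ?thesis .
qed

lemma pos_def_ldl:
  fixes Q :: "real^4^4"
  assumes "pos_def Q"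
  obtains s1 s2 s3 s4 n12 n13 n14 n23 n24 n34 where "s1 > 0" "s2 > 0" "s3 > 0" "s4 > 0"
    "Q = unitri n12 n13 n14 n23 n24 n34 ** diag4 s1 s2 s3 s4 ** transpose (unitri n12 n13 n14 n23 n24 n34)"
proof -
  have sym: "Q $ i $ j = Q $ j $ i" for i j
    by (rule pos_def_sym[OF assms])
  \<comment> \<open>The variable \<open>x1\<close> of \<open>ldl_4\<close> is coordinate 4, and
    \<open>x2\<close>, \<open>x3\<close>, \<open>x4\<close> are coordinates 1, 2, 3, in accordance
    with the order of the index type.\<close>
  have pd: "Q $ 4 $ 4 * x1\<^sup>2 + Q $ 1 $ 1 * x2\<^sup>2 + Q $ 2 $ 2 * x3\<^sup>2 + Q $ 3 $ 3 * x4\<^sup>2 + 2 * (Q $ 4 $ 1 * x1 * x2 + Q $ 4 $ 2 * x1 * x3 + Q $ 4 $ 3 * x1 * x4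
     + Q $ 1 $ 2 * x2 * x3 + Q $ 1 $ 3 * x2 * x4 + Q $ 2 $ 3 * x3 * x4) > 0"
    if nz: "\<not> (x1 = 0 \<and> x2 = 0 \<and> x3 = 0 \<and> x4 = 0)" for x1 x2 x3 x4
  proof -
    let ?x = "vector [x2, x3, x4, x1] :: real^4"
    have "?x \<noteq> 0" using nz by (auto simp: vec_eq_iff forall_4)
    then have "?x \<bullet> (Q *v ?x) > 0" using assms by (auto simp: pos_def_def)
    then show ?thesis
      by (simp add: inner_vec_def matrix_vector_mult_def sum_4 sym[of 1 4] sym[of 2 4] sym[of 3 4] sym[of 2 1] sym[of 3 1] sym[of 3 2]
          algebra_simps power2_eq_square)
  qed
  obtain s1 s2 s3 s4 n12 n13 n14 n23 n24 n34 where s: "s1 > 0" "s2 > 0" "s3 > 0" "s4 > 0"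
    and e: "Q $ 3 $ 3 = s4" "Q $ 2 $ 3 = s4 * n34" "Q $ 1 $ 3 = s4 * n24" "Q $ 4 $ 3 = s4 * n14"
    "Q $ 2 $ 2 = s3 + s4 * n34\<^sup>2" "Q $ 1 $ 2 = s3 * n23 + s4 * n24 * n34" "Q $ 4 $ 2 = s3 * n13 + s4 * n14 * n34"
    "Q $ 1 $ 1 = s2 + s3 * n23\<^sup>2 + s4 * n24\<^sup>2" "Q $ 4 $ 1 = s2 * n12 + s3 * n13 * n23 + s4 * n14 * n24"
    "Q $ 4 $ 4 = s1 + s2 * n12\<^sup>2 + s3 * n13\<^sup>2 + s4 * n14\<^sup>2"
    by (rule ldl_4[OF pd]) (assumption, rule that)
  show ?thesis
  proof (rule that[OF s])
    show "Q = unitri n12 n13 n14 n23 n24 n34 ** diag4 s1 s2 s3 s4 ** transpose (unitri n12 n13 n14 n23 n24 n34)"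
      by (simp add: unitri_def diag4_def vec_eq_iff forall_4 matrix_matrix_mult_def transpose_def sum_4 e sym[of 1 4] sym[of 2 4] sym[of 3 4] sym[of 2 1] sym[of 3 1] sym[of 3 2]
          algebra_simps power2_eq_square)
  qed
qed

lemma pos_def_invertible:
  assumes "pos_def (M :: real^'n^'n)"
  shows "invertible M"
proof -
  have "x = 0" if "M *v x = 0" for x
    using assms that unfolding pos_def_def by (metis inner_zero_right less_irrefl)
  then show ?thesis
    by (simp add: invertible_left_inverse matrix_left_invertible_ker)
qed

lemma matrix_inv_mult:
  assumes "invertible M"
  shows "M ** matrix_inv M = mat 1 \<and> matrix_inv M ** M = mat 1"
  using assms unfolding invertible_def matrix_inv_def by (rule someI_ex)

lemma matrix_inv_mult_vec:
  fixes M :: "real^'n^'n"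
  assumes "invertible M"
  shows "matrix_inv M *v (M *v x) = x" "M *v (matrix_inv M *v x) = x"
  using matrix_inv_mult[OF assms] by (simp_all add: matrix_vector_mul_assoc)

text \<open>For Q = N S N^T the inverse form is diagonal in N^(-1) k with entries 1 / s_i, while Q
  is diagonal in N^T (m - w) with entries s_i. So this is \<open>nested_inversion_4\<close> with
  parameters \<tau> / s_i, and the square roots of the s_i multiply to that of det Q.\<close>

theorem theta_inversion_4:
  fixes Q :: "real^4^4" and w :: "complex^4"
  assumes Q: "pos_def Q" and t: "Im \<tau> > 0"
  shows "(\<Sum>\<^sub>\<infinity>k. exp (of_real pi * \<i> * \<tau> * cquad (matrix_inv Q) (civ k) + 2 * of_real pi * \<i> * (\<Sum>i\<in>UNIV. of_int (k $ i) * w $ i)))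
    = - of_real (sqrt (det Q)) / \<tau>\<^sup>2 * (\<Sum>\<^sub>\<infinity>m. exp (of_real pi * \<i> * (-1 / \<tau>) * cquad Q (civ m - w)))"
proof -
  from t have t0: "\<tau> \<noteq> 0" by auto
  obtain s1 s2 s3 s4 n12 n13 n14 n23 n24 n34 where s: "s1 > 0" "s2 > 0" "s3 > 0" "s4 > 0"
    and Q_ldl: "Q = unitri n12 n13 n14 n23 n24 n34 ** diag4 s1 s2 s3 s4 ** transpose (unitri n12 n13 n14 n23 n24 n34)"
    by (rule pos_def_ldl[OF Q]) (rule that)
  define N where "N = unitri n12 n13 n14 n23 n24 n34"
  define S where "S = diag4 s1 s2 s3 s4"
  have Q_eq: "Q = N ** S ** transpose N" unfolding N_def S_def by (rule Q_ldl)
  have det: "det Q = s1 * s2 * s3 * s4"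
    by (simp add: Q_eq det_mul det_transpose N_def S_def det_unitri det_diag4)
  have quad: "cquad Q x = of_real s1 * (x $ 4)\<^sup>2 + of_real s2 * (x $ 1 + of_real n12 * x $ 4)\<^sup>2
      + of_real s3 * (x $ 2 + of_real n23 * x $ 1 + of_real n13 * x $ 4)\<^sup>2
      + of_real s4 * (x $ 3 + of_real n34 * x $ 2 + of_real n24 * x $ 1 + of_real n14 * x $ 4)\<^sup>2" for x
    by (simp add: cquad_def Q_eq N_def S_def unitri_def diag4_def sum_4 matrix_matrix_mult_def transpose_def algebra_simps power2_eq_square)
  define x1 where "x1 = (\<lambda>k::int^4. X1 n12 n13 n14 n23 n24 n34 (k $ 3) (k $ 2) (k $ 1) (k $ 4))"
  define x2 where "x2 = (\<lambda>k::int^4. X2 n23 n24 n34 (k $ 3) (k $ 2) (k $ 1))"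
  define x3 where "x3 = (\<lambda>k::int^4. X3 n34 (k $ 3) (k $ 2))"
  define x4 where "x4 = (\<lambda>k::int^4. real_of_int (k $ 3))"
  note x_defs = x1_def x2_def x3_def x4_def X1_def X2_def X3_def
  have inv_quad: "cquad (matrix_inv Q) (civ k) = of_real ((x1 k)\<^sup>2 / s1 + (x2 k)\<^sup>2 / s2 + (x3 k)\<^sup>2 / s3 + (x4 k)\<^sup>2 / s4)" for k
  proof -
    \<comment> \<open>\<open>z\<close> is S^(-1) X, and the vector \<open>x\<close> below solves Q x
      = k; the inverse form at k is then the inner product of X and z.\<close>
    define z :: "real^4" where "z = vector [x2 k / s2, x3 k / s3, x4 k / s4, x1 k / s1]"
    define X :: "real^4" where "X = vector [x2 k, x3 k, x4 k, x1 k]"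
    have "invertible (transpose N)"
      by (simp add: invertible_det_nz det_transpose N_def det_unitri)
    define x where "x = matrix_inv (transpose N) *v z"
    have Nx: "transpose N *v x = z"
      using matrix_inv_mult_vec[OF \<open>invertible (transpose N)\<close>] by (simp add: x_def)
    have SX: "S *v z = X"
      using s by (simp add: vec_eq_iff forall_4 S_def diag4_def z_def X_def matrix_vector_mult_def sum_4)
    have NX: "N *v X = riv k"
      by (simp add: vec_eq_iff forall_4 N_def unitri_def X_def riv_def matrix_vector_mult_def sum_4 x_defs)
    have "Q *v x = riv k"
      by (simp only: Q_eq matrix_vector_mul_assoc[symmetric] Nx SX NX)
    then have "matrix_inv Q *v riv k = x"
      using matrix_inv_mult_vec[OF pos_def_invertible[OF Q]] by metis
    then have "riv k \<bullet> (matrix_inv Q *v riv k) = (N *v X) \<bullet> x" by (simp add: NX)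
    also have "\<dots> = X \<bullet> z"
      using dot_lmul_matrix[of X "transpose N" x] Nx by (simp add: inner_commute transpose_transpose flip: transpose_matrix_vector)
    also have "\<dots> = (x1 k)\<^sup>2 / s1 + (x2 k)\<^sup>2 / s2 + (x3 k)\<^sup>2 / s3 + (x4 k)\<^sup>2 / s4"
      by (simp add: inner_vec_def sum_4 X_def z_def power2_eq_square)
    finally show ?thesis by (simp only: cquad_civ)
  qed
  define y1 where "y1 = w $ 4"
  define y2 where "y2 = w $ 1 + of_real n12 * w $ 4"
  define y3 where "y3 = w $ 2 + of_real n23 * w $ 1 + of_real n13 * w $ 4"
  define y4 where "y4 = w $ 3 + of_real n34 * w $ 2 + of_real n24 * w $ 1 + of_real n14 * w $ 4"
  have lin: "(\<Sum>i\<in>UNIV. of_int (k $ i) * w $ i) = of_real (x1 k) * y1 + of_real (x2 k) * y2 + of_real (x3 k) * y3 + of_real (x4 k) * y4" for k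
    by (simp add: sum_4 x_defs y1_def y2_def y3_def y4_def algebra_simps)
  define \<tau>1 \<tau>2 \<tau>3 \<tau>4 where "\<tau>1 = \<tau> * of_real (1 / s1)" and "\<tau>2 = \<tau> * of_real (1 / s2)"
    and "\<tau>3 = \<tau> * of_real (1 / s3)" and "\<tau>4 = \<tau> * of_real (1 / s4)"
  note \<tau>_defs = \<tau>1_def \<tau>2_def \<tau>3_def \<tau>4_def
  have im: "Im \<tau>1 > 0" "Im \<tau>2 > 0" "Im \<tau>3 > 0" "Im \<tau>4 > 0"
    using t s by (simp_all add: \<tau>_defs)
  have lhs: "exp (of_real pi * \<i> * \<tau> * cquad (matrix_inv Q) (civ k) + 2 * of_real pi * \<i> * (\<Sum>i\<in>UNIV. of_int (k $ i) * w $ i))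
    = tgauss \<tau>4 y4 (of_real (x4 k)) * tgauss \<tau>3 y3 (of_real (x3 k)) * tgauss \<tau>2 y2 (of_real (x2 k)) * tgauss \<tau>1 y1 (of_real (x1 k))" for k
    unfolding tgauss_def exp_add[symmetric] inv_quad lin
    by (intro arg_cong[where f = exp]) (simp add: \<tau>_defs algebra_simps)
  define h where "h = (\<lambda>m1 m2 m3 m4. gauss (-1 / \<tau>1) (of_int m1 - y1) * (gauss (-1 / \<tau>2) (of_int m2 + of_int m1 * of_real n12 - y2)
         * (gauss (-1 / \<tau>3) (of_int m3 + of_int m2 * of_real n23 + of_int m1 * of_real n13 - y3)
         * gauss (-1 / \<tau>4) (of_int m4 + of_int m3 * of_real n34 + of_int m2 * of_real n24 + of_int m1 * of_real n14 - y4))))"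
  let ?g = "\<lambda>m. exp (of_real pi * \<i> * (-1 / \<tau>) * cquad Q (civ m - w))"
  let ?v = "\<lambda>(a, b, c, d). vector [b, c, d, a] :: int^4"
  have bij: "bij ?v"
    by (rule bij_betw_byWitness[where f' = "\<lambda>k. (k $ 4, k $ 1, k $ 2, k $ 3)"]) (auto simp: vec_eq_iff forall_4)
  have rhs: "?g (?v z) = (case z of (a, b, c, d) \<Rightarrow> h a b c d)" for z
  proof -
    obtain a b c d where z: "z = (a, b, c, d)" by (cases z)
    have frac: "-1 / \<tau>1 = (-1 / \<tau>) * of_real s1" "-1 / \<tau>2 = (-1 / \<tau>) * of_real s2"
      "-1 / \<tau>3 = (-1 / \<tau>) * of_real s3" "-1 / \<tau>4 = (-1 / \<tau>) * of_real s4"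
      using s t0 by (simp_all add: \<tau>_defs)
    show ?thesis
      unfolding z prod.case h_def gauss_def exp_add[symmetric] quad frac
      by (intro arg_cong[where f = exp]) (simp add: civ_def y1_def y2_def y3_def y4_def algebra_simps)
  qed
  have imt: "Im (-1 / \<tau>) > 0"
    using t by (simp add: Im_divide sum_power2_gt_zero_iff)
  have "?g summable_on UNIV"
    by (rule abs_summable_summable[OF cquad_norm_summable[OF Q imt]])
  then have sum_h: "(\<lambda>(a, b, c, d). h a b c d) summable_on UNIV"
    using summable_on_reindex_bij_betw[OF bij, of ?g] by (simp only: rhs)
  have "(\<Sum>\<^sub>\<infinity>k. exp (of_real pi * \<i> * \<tau> * cquad (matrix_inv Q) (civ k) + 2 * of_real pi * \<i> * (\<Sum>i\<in>UNIV. of_int (k $ i) * w $ i)))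
    = (\<Sum>\<^sub>\<infinity>z. (\<lambda>k. tgauss \<tau>4 y4 (of_real (x4 k)) * tgauss \<tau>3 y3 (of_real (x3 k)) * tgauss \<tau>2 y2 (of_real (x2 k)) * tgauss \<tau>1 y1 (of_real (x1 k))) (tup4 z))"
    unfolding lhs by (rule infsum_reindex_bij_betw[OF bij_tup4, symmetric])
  also have "\<dots> = (\<Sum>\<^sub>\<infinity>(((d, c), b), a). tgauss \<tau>4 y4 (of_int d) * tgauss \<tau>3 y3 (of_real (X3 n34 d c))
      * tgauss \<tau>2 y2 (of_real (X2 n23 n24 n34 d c b)) * tgauss \<tau>1 y1 (of_real (X1 n12 n13 n14 n23 n24 n34 d c b a)))"
    by (intro infsum_cong) (auto simp: tup4_def x1_def x2_def x3_def x4_def)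
  also have "\<dots> = inv_csqrt \<tau>1 * inv_csqrt \<tau>2 * inv_csqrt \<tau>3 * inv_csqrt \<tau>4 * (\<Sum>\<^sub>\<infinity>a. \<Sum>\<^sub>\<infinity>b. \<Sum>\<^sub>\<infinity>c. \<Sum>\<^sub>\<infinity>d. h a b c d)"
    unfolding h_def by (rule nested_inversion_4[OF im])
  also have "(\<Sum>\<^sub>\<infinity>a. \<Sum>\<^sub>\<infinity>b. \<Sum>\<^sub>\<infinity>c. \<Sum>\<^sub>\<infinity>d. h a b c d) = (\<Sum>\<^sub>\<infinity>(a, b, c, d). h a b c d)"
    by (rule infsum_nested4[OF sum_h, symmetric])
  also have "\<dots> = infsum ?g UNIV"
    using infsum_reindex_bij_betw[OF bij, of ?g] by (simp only: rhs)
  also have "inv_csqrt \<tau>1 * inv_csqrt \<tau>2 * inv_csqrt \<tau>3 * inv_csqrt \<tau>4 = - of_real (sqrt (det Q)) / \<tau>\<^sup>2"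
  proof -
    have "inv_csqrt \<tau>1 * inv_csqrt \<tau>2 * inv_csqrt \<tau>3 * inv_csqrt \<tau>4 = inv_csqrt \<tau> ^ 4 * of_real (sqrt s1 * sqrt s2 * sqrt s3 * sqrt s4)"
    proof -
      have "inv_csqrt (\<tau> * of_real (1 / u)) = inv_csqrt \<tau> * of_real (sqrt u)" if "u > 0" for u
        using that inv_csqrt_scale[OF _ t, of "1 / u"] by (simp add: real_sqrt_divide)
      from this[OF s(1)] this[OF s(2)] this[OF s(3)] this[OF s(4)] show ?thesis
        by (simp add: \<tau>_defs power4_eq_xxxx del: of_real_divide)
    qed
    then show ?thesis
      by (simp add: inv_csqrt_pow4 det real_sqrt_mult)
  qed
  finally show ?thesis .
qed

section \<open>Even unimodular forms and anisotropy\<close>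

definition idot :: "int^'n \<Rightarrow> int^'n \<Rightarrow> int" where
  "idot x y = (\<Sum>i\<in>UNIV. x $ i * y $ i)"

lemma riv_inner: "riv x \<bullet> riv y = of_int (idot x y)"
  by (simp add: riv_def inner_vec_def idot_def)

lemma riv_mult: "real_mat A *v riv x = riv (A *v x)"
  by (simp add: riv_def vec_eq_iff matrix_vector_mult_def map_matrix_def)

lemma riv_eq_iff: "riv x = riv y \<longleftrightarrow> x = y"
  by (simp add: riv_def vec_eq_iff)

lemma real_mat_mult: "real_mat (A ** B) = real_mat A ** real_mat B"
  by (simp add: vec_eq_iff matrix_matrix_mult_def map_matrix_def)

lemma real_mat_eq_iff: "real_mat A = real_mat B \<longleftrightarrow> A = B"
  by (simp add: vec_eq_iff map_matrix_def)

lemma det_real_mat: "det (real_mat A) = of_int (det A)"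
  by (simp add: det_def map_matrix_def)

lemma cquad_real_mat: "cquad (real_mat A) (civ k) = of_int (idot k (A *v k))"
  by (simp add: cquad_civ riv_mult riv_inner)

lemma idot_commute: "idot x y = idot y x"
  by (simp add: idot_def mult.commute)

lemma idot_mult_transpose: "idot x (A *v y) = idot (transpose A *v x) y"
  unfolding idot_def matrix_vector_mult_def transpose_def
  by (simp add: sum_distrib_left sum_distrib_right mult_ac) (rule sum.swap)

lemma even_idot:
  fixes A :: "int^4^4"
  assumes "even_integral A"
  shows "even (idot k (A *v k))"
proof -
  have sym: "A $ i $ j = A $ j $ i" for i j
  proof -
    have "transpose A $ j $ i = A $ j $ i"
      using assms by (simp add: even_integral_def)
    then show ?thesis by (simp add: transpose_def)
  qed
  have "idot k (A *v k) = A $ 1 $ 1 * (k $ 1)\<^sup>2 + A $ 2 $ 2 * (k $ 2)\<^sup>2 + A $ 3 $ 3 * (k $ 3)\<^sup>2 + A $ 4 $ 4 * (k $ 4)\<^sup>2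
     + 2 * (A $ 1 $ 2 * k $ 1 * k $ 2 + A $ 1 $ 3 * k $ 1 * k $ 3 + A $ 1 $ 4 * k $ 1 * k $ 4
          + A $ 2 $ 3 * k $ 2 * k $ 3 + A $ 2 $ 4 * k $ 2 * k $ 4 + A $ 3 $ 4 * k $ 3 * k $ 4)"
    by (simp add: idot_def matrix_vector_mult_def sum_4 sym[of 4 1] sym[of 4 2] sym[of 4 3] sym[of 2 1] sym[of 3 1] sym[of 3 2]
        algebra_simps power2_eq_square)
  moreover have "even (A $ i $ i)" for i
    using assms by (simp add: even_integral_def)
  ultimately show ?thesis by simp
qed

text \<open>Surjectivity is Cramer's rule: the entries of a solution are integer determinants
  divided by det M = 1.\<close>

lemma bij_unimodular:
  fixes M :: "int^'n^'n"
  assumes "det M = 1"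
  shows "bij (\<lambda>l. M *v l)"
proof (rule bijI)
  have d: "det (real_mat M) \<noteq> 0" using assms by (simp add: det_real_mat)
  then have inv: "invertible (real_mat M)" by (simp add: invertible_det_nz)
  show "inj (\<lambda>l. M *v l)"
  proof (rule injI)
    fix x y assume "M *v x = M *v y"
    then have "real_mat M *v riv x = real_mat M *v riv y" by (simp add: riv_mult)
    then have "riv x = riv y" using matrix_inv_mult_vec(1)[OF inv] by metis
    then show "x = y" by (simp add: riv_eq_iff)
  qed
  show "surj (\<lambda>l. M *v l)"
  proof (rule surjI)
    fix k :: "int^'n"
    let ?B = "\<lambda>j. \<chi> a b. if b = j then k $ a else M $ a $ b"
    let ?l = "\<chi> j. det (?B j)"
    have B: "(\<chi> a b. if b = j then riv k $ a else real_mat M $ a $ b) = real_mat (?B j)" for j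
      by (simp add: vec_eq_iff map_matrix_def riv_def)
    have "real_mat M *v riv ?l = riv k"
      unfolding cramer[OF d] B det_real_mat by (simp add: riv_def assms)
    then show "M *v ?l = k" by (simp add: riv_mult riv_eq_iff)
  qed
qed

text \<open>For an even unimodular \<open>M\<close> of rank four the theta series satisfies \<open>\<theta>(\<tau> + 1) = \<theta>(\<tau>)\<close> and
  \<open>\<theta>(-1/\<tau>) = - \<tau>\<^sup>2 \<theta>(\<tau>)\<close>. These are incompatible: going from \<open>\<i>\<close> through \<open>\<i> + 1\<close>,
  \<open>(\<i> - 1) / 2\<close>, \<open>(\<i> + 1) / 2\<close> and \<open>\<i> - 1\<close> back to \<open>\<i>\<close> gives \<open>\<theta>(\<i>) = - \<theta>(\<i>)\<close>.\<close>

theorem no_even_unimodular_4: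
  fixes M :: "int^4^4"
  assumes even: "even_integral M" and pd: "pos_def (real_mat M)" and det: "det M = 1"
  shows False
proof -
  define th where "th = (\<lambda>\<tau>. \<Sum>\<^sub>\<infinity>k::int^4. exp (of_real pi * \<i> * \<tau> * of_int (idot k (M *v k))))"
  have inv: "invertible (real_mat M)" by (rule pos_def_invertible[OF pd])
  have S: "th \<tau> = - 1 / \<tau>\<^sup>2 * th (-1 / \<tau>)" if "Im \<tau> > 0" for \<tau>
  proof -
    have "th \<tau> = (\<Sum>\<^sub>\<infinity>l. exp (of_real pi * \<i> * \<tau> * cquad (matrix_inv (real_mat M)) (civ (M *v l))))"
    proof -
      \<comment> \<open>Unimodularity permits the substitution k = M l, under which the inverse form
        at k becomes M at l.\<close>
      have "cquad (matrix_inv (real_mat M)) (civ (M *v l)) = of_int (idot l (M *v l))" for l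
        using matrix_inv_mult_vec(1)[OF inv, of "riv l"]
        by (simp add: cquad_civ riv_mult riv_inner idot_commute)
      then show ?thesis by (simp add: th_def)
    qed
    also have "\<dots> = (\<Sum>\<^sub>\<infinity>k. exp (of_real pi * \<i> * \<tau> * cquad (matrix_inv (real_mat M)) (civ k)))"
      by (rule infsum_reindex_bij_betw[OF bij_unimodular[OF det]])
    also have "\<dots> = - 1 / \<tau>\<^sup>2 * th (-1 / \<tau>)"
      using theta_inversion_4[OF pd that, of 0] by (simp add: det_real_mat det th_def cquad_real_mat)
    finally show ?thesis .
  qed
  have T: "th (\<tau> + 1) = th \<tau>" for \<tau>
  proof -
    have "exp (of_real pi * \<i> * (\<tau> + 1) * of_int (idot k (M *v k))) = exp (of_real pi * \<i> * \<tau> * of_int (idot k (M *v k)))" for k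
    proof -
      obtain c where c: "idot k (M *v k) = 2 * c"
        using even_idot[OF even, of k] by (rule evenE)
      have "exp (of_real pi * \<i> * (\<tau> + 1) * of_int (idot k (M *v k))) = exp (of_real pi * \<i> * \<tau> * of_int (idot k (M *v k))) * cexp1 (of_int c)"
        unfolding cexp1_def exp_add[symmetric] by (simp add: c algebra_simps)
      then show ?thesis by simp
    qed
    then show ?thesis by (simp add: th_def)
  qed
  have "th \<i> = th (\<i> + 1)" by (simp add: T)
  also have "\<dots> = - 1 / (\<i> + 1)\<^sup>2 * th (- 1 / (\<i> + 1))" by (rule S) simp
  also have "- 1 / (\<i> + 1) = (\<i> - 1) / 2" by (simp add: complex_eq_iff Re_divide Im_divide)
  also have "th ((\<i> - 1) / 2) = th ((\<i> - 1) / 2 + 1)" by (simp add: T)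
  also have "(\<i> - 1) / 2 + 1 = (\<i> + 1) / 2" by (simp add: complex_eq_iff)
  also have "th ((\<i> + 1) / 2) = - 1 / ((\<i> + 1) / 2)\<^sup>2 * th (- 1 / ((\<i> + 1) / 2))" by (rule S) simp
  also have "- 1 / ((\<i> + 1) / 2) = \<i> - 1" by (simp add: complex_eq_iff Re_divide Im_divide)
  also have "th (\<i> - 1) = th \<i>" using T[of "\<i> - 1"] by simp
  \<comment> \<open>The squares of \<i> + 1 and (\<i> + 1) / 2 are 2 \<i> and \<i> / 2, with product
    -1; the two signs from the inversions cancel.\<close>
  also have "- 1 / (\<i> + 1)\<^sup>2 * (- 1 / ((\<i> + 1) / 2)\<^sup>2 * th \<i>) = - th \<i>"
  proof -
    have "(\<i> + 1)\<^sup>2 = 2 * \<i>" by (simp add: power2_eq_square algebra_simps)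
    then show ?thesis by (simp add: power_divide field_simps)
  qed
  finally have "th \<i> = 0" by simp
  \<comment> \<open>At \<tau> = \<i> all terms are positive and k = 0 contributes 1, so the sum
    cannot vanish.\<close>
  have eq: "exp (of_real pi * \<i> * \<i> * of_int n) = complex_of_real (exp (- pi * of_int n))" for n
    by (simp add: exp_of_real[symmetric] mult.assoc)
  have s: "(\<lambda>k. exp (- pi * of_int (idot k (M *v k)))) summable_on UNIV"
    using cquad_norm_summable[OF pd, of \<i> 0] by (simp add: cquad_real_mat)
  have "(\<Sum>k\<in>{0}. exp (- pi * of_int (idot k (M *v k)))) \<le> (\<Sum>\<^sub>\<infinity>k. exp (- pi * of_int (idot k (M *v k))))"
    by (rule finite_sum_le_infsum[OF s]) auto
  moreover have "th \<i> = of_real (\<Sum>\<^sub>\<infinity>k. exp (- pi * of_int (idot k (M *v k))))"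
    unfolding th_def eq by (rule infsumI[OF has_sum_of_real[OF has_sum_infsum[OF s]]])
  ultimately show False
    using \<open>th \<i> = 0\<close> by (simp add: idot_def)
qed

section \<open>Overlattices of index p and anisotropy of the discriminant form\<close>

lemma matrix_vector_mult_smult:
  fixes A :: "'a::comm_semiring_1^'n^'m"
  shows "A *v (c *s x) = c *s (A *v x)"
  by (simp add: vec_eq_iff matrix_vector_mult_def sum_distrib_left mult_ac)

lemma pos_def_congruence:
  fixes A T :: "real^'n^'n"
  assumes A: "pos_def A" and T: "invertible T"
  shows "pos_def (transpose T ** A ** T)"
  unfolding pos_def_def
proof (intro conjI allI impI)
  show "transpose (transpose T ** A ** T) = transpose T ** A ** T"
    using A by (simp add: pos_def_def matrix_transpose_mul matrix_mul_assoc)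
  fix x :: "real^'n" assume "x \<noteq> 0"
  then have "T *v x \<noteq> 0"
    using matrix_inv_mult_vec(1)[OF T, of x] by (metis matrix_vector_mult_0_right)
  then have "(T *v x) \<bullet> (A *v (T *v x)) > 0"
    using A by (simp add: pos_def_def)
  also have "(T *v x) \<bullet> (A *v (T *v x)) = x \<bullet> (transpose T *v (A *v (T *v x)))"
    by (metis dot_lmul_matrix inner_commute transpose_matrix_vector)
  finally show "x \<bullet> ((transpose T ** A ** T) *v x) > 0"
    by (simp only: matrix_vector_mul_assoc[symmetric])
qed

text \<open>If the conclusion fails, \<open>P k / p\<close> generates an even unimodular overlattice of index \<open>p\<close>. After
  normalising its \<open>i\<close>-th coordinate to \<open>1 / p\<close>, replacing the \<open>i\<close>-th standard basis vector by it
  gives a basis of the overlattice.\<close>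

theorem anisotropic_mod_p:
  fixes Q P :: "int^4^4" and p :: nat
  assumes p: "prime p" and Q: "even_integral Q" and P: "even_integral P" and pd: "pos_def (real_mat Q)"
    and QP: "Q ** P = mat (int p)" and PQ: "P ** Q = mat (int p)" and det: "det Q = (int p)\<^sup>2"
    and k: "2 * int p dvd idot k (P *v k)"
  shows "int p dvd (P *v k) $ i"
proof (rule ccontr)
  assume "\<not> int p dvd (P *v k) $ i"
  then have "gcd ((P *v k) $ i) (int p) = 1"
    using p by (metis coprime_commute coprime_imp_gcd_eq_1 prime_imp_coprime prime_nat_int_transfer)
  then obtain s t where "s * (P *v k) $ i + t * int p = 1"
    using bezout_int[of "(P *v k) $ i" "int p"] by auto
  then obtain j where sj: "s * (P *v k) $ i = 1 + int p * j"
    by (intro that[of "- t"]) (simp add: algebra_simps)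
  define e :: "int^4" where "e = axis i 1"
  \<comment> \<open>The lattice vector \<open>e\<close> is \<open>Q *v e\<close> in dual
    coordinates. Subtracting j times it makes the i-th entry of \<open>P *v k'\<close> equal to s (P
    k)_i - p j = 1.\<close>
  define k' where "k' = s *s k - j *s (Q *v e)"
  define w where "w = P *v k'"
  have QPv: "Q *v (P *v x) = int p *s x" "P *v (Q *v x) = int p *s x" for x
    by (simp_all add: matrix_vector_mul_assoc QP PQ) (simp_all add: mat_def matrix_vector_mult_def vec_eq_iff mult_delta_left)
  have symQ: "transpose Q = Q" and symP: "transpose P = P"
    using P Q by (auto simp: even_integral_def)
  have w: "w = s *s (P *v k) - (j * int p) *s e"
    by (simp add: w_def k'_def matrix_vector_mult_diff_distrib matrix_vector_mult_smult QPv vector_smult_assoc)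
  have wi: "w $ i = 1"
    using sj by (simp add: w e_def axis_def mult_ac)
  have ide: "idot x e = x $ i" for x
    by (simp add: idot_def e_def axis_def if_distrib sum.delta cong: if_cong)
  have kw: "2 * int p dvd idot k' w"
  proof -
    have lin: "idot (a *s x - b *s y) z = a * idot x z - b * idot y z" "idot z (a *s x - b *s y) = a * idot z x - b * idot z y" for a b x y z
      by (simp_all add: idot_def sum_subtractf sum_distrib_left algebra_simps)
    have q1: "idot (Q *v e) (P *v k) = int p * k $ i"
    proof -
      have "idot (Q *v e) (P *v k) = idot e (Q *v (P *v k))"
        by (simp add: idot_mult_transpose[of e Q] symQ)
      also have "\<dots> = int p * idot k e"
        by (simp add: QPv idot_def sum_distrib_left mult_ac)
      finally show ?thesis by (simp add: ide)
    qed
    have q2: "(Q *v e) $ i = Q $ i $ i"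
      by (simp add: e_def matrix_vector_mult_def axis_def if_distrib sum.delta cong: if_cong)
    have "idot k' w = s * (s * idot k (P *v k)) - s * (j * int p * k $ i) - (j * (s * (int p * k $ i)) - j * (j * int p * Q $ i $ i))"
      unfolding k'_def w lin q1 ide by (simp add: q2 algebra_simps)
    also have "\<dots> = s * s * idot k (P *v k) - 2 * int p * (s * j * k $ i) + int p * Q $ i $ i * (j * j)"
      by (simp add: algebra_simps)
    also have "2 * int p dvd \<dots>"
    proof -
      have "even (Q $ i $ i)" using Q by (simp add: even_integral_def)
      then have "2 * int p dvd int p * Q $ i $ i" by (metis dvd_refl mult.commute mult_dvd_mono)
      then show ?thesis
        by (rule dvd_add[OF dvd_diff[OF dvd_mult[OF k] dvd_triv_left] dvd_mult2])
    qed
    finally show ?thesis .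
  qed
  define n :: "real^4" where "n = (1 / real p) *s riv w"
  have p0: "p > 0" using p by (simp add: prime_gt_0_nat)
  have Qn: "real_mat Q *v n = riv k'"
  proof -
    have "real_mat Q *v riv w = riv (Q *v w)" by (rule riv_mult)
    also have "Q *v w = int p *s k'" by (simp add: w_def QPv)
    finally show ?thesis
      using p0 by (simp add: n_def matrix_vector_mult_smult) (simp add: riv_def vec_eq_iff)
  qed
  \<comment> \<open>Column \<open>i\<close> of the identity is replaced by \<open>n\<close>, in the
    shape of \<open>cramer_lemma\<close>, which gives the determinant as the i-th entry 1 / p of
    \<open>n\<close>.\<close>
  define T :: "real^4^4" where "T = (\<chi> a b. if b = i then (mat 1 *v n) $ a else mat 1 $ a $ b)"
  have detT: "det T = 1 / real p"
    unfolding T_def cramer_lemma using wi by (simp add: n_def riv_def)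
  have colT: "column b T = (if b = i then n else axis b 1)" for b
    unfolding T_def matrix_vector_mul_lid by (auto simp: column_def vec_eq_iff axis_def mat_def)
  \<comment> \<open>The Gram matrix of the new basis, written with integer entries: Q n = k'
    supplies the mixed ones, and the norm of n is \<open>idot k' w\<close> divided by p, an even
    integer by \<open>kw\<close>.\<close>
  define M :: "int^4^4" where "M = (\<chi> a b. if a = i then (if b = i then idot k' w div int p else k' $ b)
      else (if b = i then k' $ a else Q $ a $ b))"
  have MT: "real_mat M = transpose T ** real_mat Q ** T"
  proof -
    have ent: "(transpose T ** real_mat Q ** T) $ a $ b = column a T \<bullet> (real_mat Q *v column b T)" for a b
      by (simp add: matrix_matrix_mult_def matrix_vector_mult_def inner_vec_def column_def transpose_def sum_distrib_left sum_distrib_right mult.assoc)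
         (rule sum.swap)
    have sy: "x \<bullet> (real_mat Q *v y) = (real_mat Q *v x) \<bullet> y" for x y :: "real^4"
      using pd by (metis dot_lmul_matrix pos_def_def transpose_matrix_vector)
    have nk: "n \<bullet> riv k' = real_of_int (idot k' w div int p)"
    proof -
      have "n \<bullet> riv k' = of_int (idot k' w) / real p"
        using riv_inner[of k' w] by (simp add: n_def scalar_mult_eq_scaleR inner_commute[of _ "riv k'"])
      also have "\<dots> = real_of_int (idot k' w div int p)"
        using kw p0 by (metis dvd_mult_right of_int_of_nat_eq real_of_int_div)
      finally show ?thesis .
    qed
    have "real_mat M $ a $ b = column a T \<bullet> (real_mat Q *v column b T)" for a b
    proof (cases "a = i"; cases "b = i")
      assume "a = i" "b = i"
      then show ?thesis by (simp add: colT Qn nk) (simp add: M_def map_matrix_def)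
    next
      assume "a = i" "b \<noteq> i"
      then show ?thesis by (simp add: colT Qn sy inner_axis) (simp add: M_def map_matrix_def riv_def)
    next
      assume "a \<noteq> i" "b = i"
      then show ?thesis by (simp add: colT Qn inner_axis') (simp add: M_def map_matrix_def riv_def)
    next
      assume "a \<noteq> i" "b \<noteq> i"
      then show ?thesis
        by (simp add: colT inner_axis' matrix_vector_mult_basis) (simp add: column_def M_def map_matrix_def)
    qed
    then show ?thesis by (simp only: vec_eq_iff ent) simp
  qed
  have "even_integral M"
    unfolding even_integral_def
  proof (intro conjI allI)
    have "Q $ a $ b = Q $ b $ a" for a b
      using arg_cong[OF symQ, of "\<lambda>X. X $ b $ a"] by (simp add: transpose_def)
    then show "transpose M = M"
      by (auto simp: M_def transpose_def vec_eq_iff)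
    fix a
    obtain c where "idot k' w = 2 * int p * c"
      using kw by (rule dvdE)
    then have "idot k' w = int p * (2 * c)" by simp
    then have "even (idot k' w div int p)"
      using p0 by simp
    then show "even (M $ a $ a)"
      using Q by (auto simp: M_def even_integral_def)
  qed
  moreover have "pos_def (real_mat M)"
    unfolding MT using detT p0 by (intro pos_def_congruence pd) (simp add: invertible_det_nz)
  moreover have "det M = 1"
  proof -
    \<comment> \<open>The two factors det T = 1 / p cancel det Q = p^2.\<close>
    have "real_of_int (det M) = 1"
      using p0 by (simp add: det_real_mat[symmetric] MT det_mul det_transpose detT)
         (simp add: det_real_mat det power2_eq_square)
    then show ?thesis by simp
  qed
  ultimately show False by (rule no_even_unimodular_4)
qed

section \<open>The slash operators\<close>

definition Om :: "complex \<Rightarrow> complex \<Rightarrow> complex \<Rightarrow> complex^2^2" where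
  "Om a b c = vector [vector [a, b], vector [b, c]]"

lemma siegel_Om:
  assumes "\<Omega> \<in> siegel_upper_half"
  obtains a b c where "\<Omega> = Om a b c" "Im c > 0" "(Im b)\<^sup>2 < Im a * Im c"
proof -
  define a b c where "a = \<Omega> $ 1 $ 1" and "b = \<Omega> $ 1 $ 2" and "c = \<Omega> $ 2 $ 2"
  have "transpose \<Omega> $ 1 $ 2 = \<Omega> $ 1 $ 2"
    using assms by (simp add: siegel_upper_half_def)
  then have "\<Omega> = Om a b c"
    by (simp add: Om_def a_def b_def c_def vec_eq_iff forall_2 transpose_def)
  have pd: "x \<noteq> 0 \<Longrightarrow> x \<bullet> (map_matrix Im \<Omega> *v x) > 0" for x
    using assms by (auto simp: siegel_upper_half_def pos_def_def)
  have q: "vector [x, y] \<bullet> (map_matrix Im \<Omega> *v vector [x, y]) = Im a * x\<^sup>2 + 2 * Im b * x * y + Im c * y\<^sup>2" for x y :: real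
    by (simp add: \<open>\<Omega> = Om a b c\<close> Om_def map_matrix_def inner_vec_def matrix_vector_mult_def sum_2 algebra_simps power2_eq_square)
  have nz: "vector [x, y] \<noteq> (0 :: real^2)" if "\<not> (x = 0 \<and> y = 0)" for x y :: real
    using that by (auto simp: vec_eq_iff forall_2)
  have c: "Im c > 0"
    using pd[OF nz[of 0 1]] by (simp add: q)
  \<comment> \<open>The test vector (Im c, - Im b) gives Im c times the determinant of the imaginary
    part.\<close>
  have "Im a * (Im c)\<^sup>2 + 2 * Im b * Im c * (- Im b) + Im c * (- Im b)\<^sup>2 > 0"
    using pd[OF nz[of "Im c" "- Im b"]] c unfolding q by simp
  then have "Im c * (Im a * Im c - (Im b)\<^sup>2) > 0"
    by (simp add: algebra_simps power2_eq_square)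
  then have "(Im b)\<^sup>2 < Im a * Im c"
    using c by (simp add: zero_less_mult_iff)
  with \<open>\<Omega> = Om a b c\<close> c show ?thesis
    using that by blast
qed

lemma multiplier_eq_1:
  assumes "transpose g ** symp_J ** g = symp_J"
  shows "multiplier g = 1"
  unfolding multiplier_def
proof (rule the_equality)
  show "transpose g ** symp_J ** g = 1 *\<^sub>R symp_J" using assms by simp
  fix m assume "transpose g ** symp_J ** g = m *\<^sub>R symp_J"
  then have "symp_J $ 1 $ 3 = (m *\<^sub>R symp_J) $ 1 $ 3" using assms by simp
  then show "m = 1" by (simp add: symp_J_def)
qed

lemma matrix_inv_eqI:
  fixes A B :: "complex^'n^'n"
  assumes "A ** B = mat 1"
  shows "matrix_inv A = B"
proof -
  have BA: "B ** A = mat 1" using assms matrix_left_right_inverse by blast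
  then have "invertible A" using assms by (auto simp: invertible_def)
  from matrix_inv_mult[OF this] have "matrix_inv A ** A = mat 1" by blast
  then have "matrix_inv A = matrix_inv A ** (A ** B)" "matrix_inv A ** A ** B = B"
    by (simp_all add: assms)
  then show ?thesis by (simp add: matrix_mul_assoc)
qed

text \<open>Exhibiting the inverse \<open>Y\<close> of C \<Omega> + D reduces every slash to matrix
  identities checked entry by entry; multiplier 1 removes the scalar factor.\<close>

lemma slash_2_eq:
  assumes g: "transpose g ** symp_J ** g = symp_J"
    and inv: "(cplx_mat (block_C g) ** \<Omega> + cplx_mat (block_D g)) ** Y = mat 1"
    and W: "(cplx_mat (block_A g) ** \<Omega> + cplx_mat (block_B g)) ** Y = W"
    and det: "det (cplx_mat (block_C g) ** \<Omega> + cplx_mat (block_D g)) = D"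
  shows "slash 2 f g \<Omega> = f W / D\<^sup>2"
  unfolding slash_def Let_def multiplier_eq_1[OF g] det matrix_inv_eqI[OF inv] W
  by (simp add: power_int_minus divide_inverse mult.commute)

lemmas mat_simps = vec_eq_iff forall_4 forall_2 matrix_matrix_mult_def transpose_def sum_4 sum_2
  map_matrix_def mat_def det_2 symp_J_def block_A_def block_B_def block_C_def block_D_def Om_def

lemma slash_t_mat: "slash 2 f (t_mat (diag2 x y)) (Om a b c) = f (Om (a + of_real x) b (c + of_real y))"
proof -
  have "slash 2 f (t_mat (diag2 x y)) (Om a b c) = f (Om (a + of_real x) b (c + of_real y)) / 1\<^sup>2"
    by (rule slash_2_eq[where Y = "mat 1"]) (simp_all add: mat_simps t_mat_def diag2_def)
  then show ?thesis by simp
qed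

lemma slash_E1_mat:
  assumes "c \<noteq> 0"
  shows "slash 2 f E1_mat (Om a b c) = f (Om (a - b\<^sup>2 / c) (- b / c) (- 1 / c)) / c\<^sup>2"
proof -
  have "slash 2 f E1_mat (Om a b c) = f (Om (a - b\<^sup>2 / c) (- b / c) (- 1 / c)) / (- c)\<^sup>2"
    by (rule slash_2_eq[where Y = "vector [vector [1, 0], vector [- b / c, - 1 / c]]"])
       (use assms in \<open>simp_all add: mat_simps E1_mat_def power2_eq_square\<close>)
  then show ?thesis by simp
qed

lemma slash_mu_tilde_mat:
  assumes "p > 0"
  shows "slash 2 f (mu_tilde_mat p) (Om a b c) = (of_nat p)\<^sup>2 * f (Om c (- (of_nat p * b)) ((of_nat p)\<^sup>2 * a))"
proof -
  have "slash 2 f (mu_tilde_mat p) (Om a b c) = f (Om c (- (of_nat p * b)) ((of_nat p)\<^sup>2 * a)) / (1 / of_nat p)\<^sup>2"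
    by (rule slash_2_eq[where Y = "vector [vector [0, - of_nat p], vector [1, 0]]"])
       (use assms in \<open>simp_all add: mat_simps mu_tilde_mat_def power2_eq_square\<close>)
  then show ?thesis using assms by (simp add: power_divide)
qed

lemma slash_F_mat:
  assumes p: "p > 0" and D: "D = a * c - b\<^sup>2" "D \<noteq> 0"
  shows "slash 2 f (F_mat p) (Om a b c)
    = f (Om (- c / (of_nat p * D)) (b / (of_nat p * D)) (- a / (of_nat p * D))) / (of_nat p * D)\<^sup>2"
proof (rule slash_2_eq)
  define s where "s = sqrt (real p)"
  have s: "s * s = real p" "s \<noteq> 0" using p by (simp_all add: s_def)
  have s': "of_real s * (of_real s * z) = of_nat p * z" "of_real s * of_real s = (of_nat p :: complex)" for z :: complex
    using s by (metis of_real_mult of_real_of_nat_eq mult.assoc)+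
  have F: "F_mat p = vector [vector [0, 0, 1 / s, 0], vector [0, 0, 0, 1 / s], vector [- s, 0, 0, 0], vector [0, - s, 0, 0]]"
    using s by (simp add: mat_simps F_mat_def s_def[symmetric] divide_simps)
  show "transpose (F_mat p) ** symp_J ** F_mat p = symp_J"
    using s by (simp add: mat_simps F)
  let ?Y = "vector [vector [- c / (of_real s * D), b / (of_real s * D)], vector [b / (of_real s * D), - a / (of_real s * D)]] :: complex^2^2"
  show "(cplx_mat (block_C (F_mat p)) ** Om a b c + cplx_mat (block_D (F_mat p))) ** ?Y = mat 1"
  proof -
    have "a * c / D - b * b / D = 1"
      using D by (simp add: diff_divide_distrib[symmetric] power2_eq_square)
    then show ?thesis
      using s by (simp add: mat_simps F mult_ac)
  qed
  show "(cplx_mat (block_A (F_mat p)) ** Om a b c + cplx_mat (block_B (F_mat p))) ** ?Y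
     = Om (- c / (of_nat p * D)) (b / (of_nat p * D)) (- a / (of_nat p * D))"
    using s D(2) by (simp add: mat_simps F s' field_simps)
  show "det (cplx_mat (block_C (F_mat p)) ** Om a b c + cplx_mat (block_D (F_mat p))) = of_nat p * D"
    using s by (simp add: mat_simps F D(1) s' algebra_simps power2_eq_square)
qed

lemma slash_mu_t_mat:
  assumes p: "p > 0"
  shows "slash 2 f (mu_mat p ** t_mat (diag2 0 x)) (Om a b c) = f (Om ((c + of_real x) / of_nat p) (- b) (of_nat p * a))"
proof -
  define s where "s = sqrt (real p)"
  have s: "s * s = real p" "s \<noteq> 0" using p by (simp_all add: s_def)
  have s': "of_real s * (of_real s * z) = of_nat p * z" "of_real s * of_real s = (of_nat p :: complex)" for z :: complex
    using s by (metis of_real_mult of_real_of_nat_eq mult.assoc)+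
  have mu: "mu_mat p ** t_mat (diag2 0 x)
      = vector [vector [0, 1 / s, 0, x / s], vector [- s, 0, 0, 0], vector [0, 0, 0, s], vector [0, 0, - 1 / s, 0]]"
    using s by (simp add: mat_simps mu_mat_def t_mat_def diag2_def s_def[symmetric] divide_simps)
  have "slash 2 f (mu_mat p ** t_mat (diag2 0 x)) (Om a b c) = f (Om ((c + of_real x) / of_nat p) (- b) (of_nat p * a)) / 1\<^sup>2"
    unfolding mu by (rule slash_2_eq[where Y = "vector [vector [0, - of_real s], vector [1 / of_real s, 0]]"])
       (use s in \<open>simp_all add: mat_simps s' add_divide_distrib[symmetric]\<close>)
  then show ?thesis by simp
qed

section \<open>Theta series over the dual lattice\<close>

text \<open>Orthogonality of characters modulo p: the geometric sum of a p-th root of unity other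
  than 1 vanishes.\<close>

lemma sum_cexp1_residues:
  assumes "p > 0"
  shows "(\<Sum>\<beta><p. cexp1 (of_nat \<beta> * of_int N / of_nat p)) = (if int p dvd N then of_nat p else 0)"
proof -
  define z where "z = cexp1 (of_int N / of_nat p)"
  have z: "cexp1 (of_nat \<beta> * of_int N / of_nat p) = z ^ \<beta>" for \<beta>
    unfolding z_def cexp1_def exp_of_nat_mult[symmetric] by (simp add: mult_ac)
  show ?thesis
  proof (cases "int p dvd N")
    case True
    then obtain c where "N = int p * c" by (rule dvdE)
    then have "z = 1" using assms by (simp add: z_def)
    then show ?thesis using True by (simp add: z)
  next
    case False
    have "z \<noteq> 1"
    proof
      assume "z = 1"
      then obtain c where "of_int N / of_nat p = (of_int c :: complex)"
        by (auto simp: z_def cexp1_eq_1_iff elim: Ints_cases)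
      then have "of_int N = (of_int (c * int p) :: complex)"
        using assms by (simp add: field_simps)
      then have "N = c * int p" by (simp only: of_int_eq_iff)
      then show False using False by simp
    qed
    moreover have "z ^ p = 1"
      using z[of p] assms by simp
    ultimately show ?thesis
      using False by (simp add: z geometric_sum)
  qed
qed

text \<open>\<open>P\<close> is \<open>p Q\<^sup>-\<^sup>1\<close>. The dual lattice \<open>Q\<^sup>-\<^sup>1 \<int>\<^sup>4\<close> is parametrised by \<open>k \<mapsto> Q\<^sup>-\<^sup>1 k\<close>, so that
  \<open>\<int>\<^sup>4\<close> itself becomes the range of \<open>Q\<close> and the form \<open>Q\<close> becomes \<open>P / p\<close>.\<close>

locale level_pair =
  fixes p :: nat and Q P :: "int^4^4"
  assumes prime_p: "prime p"
    and Q_even: "even_integral Q" and P_even: "even_integral P"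
    and Q_pos: "pos_def (real_mat Q)" and P_pos: "pos_def (real_mat P)"
    and QP: "Q ** P = mat (int p)" and PQ: "P ** Q = mat (int p)"
    and det_Q: "det Q = (int p)\<^sup>2" and det_P: "det P = (int p)\<^sup>2"
begin

lemma p_pos: "p > 0"
  using prime_p by (simp add: prime_gt_0_nat)

text \<open>\<open>bil k l\<close> is p times the form Q at the dual vectors Q^(-1) k and Q^(-1) l;
  the factor p keeps it integral.\<close>

definition bil :: "int^4 \<Rightarrow> int^4 \<Rightarrow> int" where
  "bil k l = idot k (P *v l)"

lemma QPv: "Q *v (P *v x) = int p *s x" and PQv: "P *v (Q *v x) = int p *s x"
  by (simp_all add: matrix_vector_mul_assoc QP PQ) (simp_all add: mat_def matrix_vector_mult_def vec_eq_iff mult_delta_left)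

lemma sym: "transpose Q = Q" "transpose P = P"
  using Q_even P_even by (auto simp: even_integral_def)

lemma bil_commute: "bil k l = bil l k"
  using idot_mult_transpose[of k P l] by (simp add: bil_def sym idot_commute)

lemma idot_smult: "idot x (c *s y) = c * idot x y" "idot (c *s x) y = c * idot x y"
  by (simp_all add: idot_def sum_distrib_left mult_ac)

lemma bil_smult: "bil x (c *s y) = c * bil x y" "bil (c *s x) y = c * bil x y"
  by (simp_all add: bil_def matrix_vector_mult_smult idot_smult)

lemma bil_Q: "bil k (Q *v m) = int p * idot k m"
  by (simp add: bil_def PQv idot_smult)

lemma inj_Q: "inj (\<lambda>m. Q *v m)"
proof (rule injI)
  fix x y assume "Q *v x = Q *v y"
  then have "int p *s x = int p *s y" by (metis PQv)
  then show "x = y" using p_pos by (simp add: vec_eq_iff)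
qed

definition lat :: "(int^4) set" where
  "lat = range (\<lambda>m. Q *v m)"

text \<open>The copy of p L' in these coordinates, since Q maps p Q^(-1) m to p m.\<close>

definition pdual :: "(int^4) set" where
  "pdual = range (\<lambda>m. int p *s m)"

lemma pdual_subset_lat: "pdual \<subseteq> lat"
proof
  fix k assume "k \<in> pdual"
  then obtain m where "k = int p *s m" by (auto simp: pdual_def)
  then have "k = Q *v (P *v m)" by (simp add: QPv)
  then show "k \<in> lat" by (simp add: lat_def)
qed

text \<open>A dual vector of even integral norm outside L would be isotropic in L' / L, which
  \<open>anisotropic_mod_p\<close> excludes. The other direction is the evenness of Q.\<close>

lemma mem_lat_iff: "l \<in> lat \<longleftrightarrow> 2 * int p dvd bil l l"
proof
  assume "l \<in> lat"
  then obtain m where l: "l = Q *v m" by (auto simp: lat_def)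
  have "bil l l = int p * idot m (Q *v m)"
    by (simp add: l bil_Q idot_commute)
  moreover have "even (idot m (Q *v m))" by (rule even_idot[OF Q_even])
  ultimately show "2 * int p dvd bil l l"
    by (simp add: mult.commute mult_dvd_mono)
next
  assume "2 * int p dvd bil l l"
  then have "int p dvd (P *v l) $ i" for i
    unfolding bil_def by (rule anisotropic_mod_p[OF prime_p Q_even P_even Q_pos QP PQ det_Q])
  then have "P *v l = int p *s (\<chi> i. (P *v l) $ i div int p)"
    by (simp add: vec_eq_iff)
  then have "int p *s l = int p *s (Q *v (\<chi> i. (P *v l) $ i div int p))"
    by (metis QPv matrix_vector_mult_smult)
  then have "l = Q *v (\<chi> i. (P *v l) $ i div int p)"
    using p_pos by (simp add: vec_eq_iff)
  then show "l \<in> lat" unfolding lat_def by (rule range_eqI)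
qed

text \<open>\<open>anisotropic_mod_p\<close> with Q and P exchanged: P is even of determinant p^2 as
  well, so Q has no isotropic vectors on L / p L'.\<close>

lemma mem_pdual_iff:
  assumes "k \<in> lat"
  shows "k \<in> pdual \<longleftrightarrow> 2 * (int p)\<^sup>2 dvd bil k k"
proof -
  obtain m where k: "k = Q *v m" using assms by (auto simp: lat_def)
  have b: "bil k k = int p * idot m (Q *v m)"
    by (simp add: k bil_Q idot_commute)
  have b2: "2 * (int p)\<^sup>2 dvd bil k k \<longleftrightarrow> 2 * int p dvd idot m (Q *v m)"
    using p_pos by (simp add: b power2_eq_square mult.assoc mult.left_commute)
  show ?thesis
  proof
    assume "k \<in> pdual"
    then obtain n where n: "k = int p *s n" by (auto simp: pdual_def)
    have "bil k k = (int p)\<^sup>2 * idot n (P *v n)"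
      by (simp add: n bil_smult power2_eq_square) (simp add: bil_def)
    moreover have "even (idot n (P *v n))" by (rule even_idot[OF P_even])
    ultimately show "2 * (int p)\<^sup>2 dvd bil k k"
      by (simp add: mult.commute mult_dvd_mono)
  next
    assume "2 * (int p)\<^sup>2 dvd bil k k"
    then have "2 * int p dvd idot m (Q *v m)" by (simp add: b2)
    then have "int p dvd k $ i" for i
      unfolding k by (rule anisotropic_mod_p[OF prime_p P_even Q_even P_pos PQ QP det_P])
    then have "k = int p *s (\<chi> i. k $ i div int p)"
      by (simp add: vec_eq_iff)
    then show "k \<in> pdual" unfolding pdual_def by (rule range_eqI)
  qed
qed

section \<open>Theta series over a product of two lattices and their inversion in one column\<close>

definition tterm :: "complex \<Rightarrow> complex \<Rightarrow> complex \<Rightarrow> (int^4) \<times> (int^4) \<Rightarrow> complex" where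
  "tterm a b c = (\<lambda>(k, l). exp (of_real pi * \<i> / of_nat p * (a * of_int (bil k k) + 2 * b * of_int (bil k l) + c * of_int (bil l l))))"

text \<open>The factors \<open>A\<close> and \<open>B\<close> are independent, so that inversions
  and character sums can act on one column at a time.\<close>

definition Theta :: "(int^4) set \<Rightarrow> (int^4) set \<Rightarrow> complex \<Rightarrow> complex \<Rightarrow> complex \<Rightarrow> complex" where
  "Theta A B a b c = infsum (tterm a b c) (A \<times> B)"

definition h2 :: "complex \<Rightarrow> complex \<Rightarrow> complex \<Rightarrow> bool" where
  "h2 a b c \<longleftrightarrow> Im c > 0 \<and> (Im b)\<^sup>2 < Im a * Im c"

lemma h2_a_pos:
  assumes "h2 a b c"
  shows "Im a > 0"
proof -
  have "0 < Im a * Im c"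
    using assms zero_le_power2[of "Im b"] unfolding h2_def by linarith
  then show ?thesis
    using assms by (simp add: h2_def zero_less_mult_iff)
qed

lemma h2_swap: "h2 a b c \<Longrightarrow> h2 c b a"
  using h2_a_pos[of a b c] by (simp add: h2_def mult.commute)

lemma h2_uminus: "h2 a b c \<Longrightarrow> h2 a (- b) c"
  by (simp add: h2_def)

text \<open>Congruence of \<Omega> with diag (s, t).\<close>

lemma h2_scale:
  assumes "h2 a b c" "s \<noteq> 0" "t \<noteq> 0"
  shows "h2 (of_real (s * s) * a) (of_real (s * t) * b) (of_real (t * t) * c)"
proof -
  have "(s * t)\<^sup>2 * (Im b)\<^sup>2 < (s * t)\<^sup>2 * (Im a * Im c)"
    using assms by (simp add: h2_def)
  moreover have "t * t * Im c > 0"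
  proof (rule mult_pos_pos)
    show "t * t > 0"
      using assms(3) by (metis not_real_square_gt_zero)
    show "Im c > 0"
      using assms(1) by (simp add: h2_def)
  qed
  ultimately show ?thesis
    by (simp add: h2_def power_mult_distrib power2_eq_square mult_ac)
qed

lemma bil_real: "real_of_int (bil k l) = riv k \<bullet> (real_mat P *v riv l)"
  by (simp add: bil_def riv_mult riv_inner)

text \<open>Bounding the imaginary part below by \<epsilon> times the identity removes the coupling
  of \<open>k\<close> and \<open>l\<close>; the series is then dominated by a product of two
  Gaussian series.\<close>

lemma tterm_summable:
  assumes h: "h2 a b c"
  shows "tterm a b c norm_summable_on A \<times> B"
proof -
  define \<alpha> \<beta> \<gamma> where "\<alpha> = Im a" and "\<beta> = Im b" and "\<gamma> = Im c"
  have pos: "\<alpha> > 0" "\<gamma> > 0" "\<beta>\<^sup>2 < \<alpha> * \<gamma>"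
    using h h2_a_pos[OF h] by (auto simp: h2_def \<alpha>_def \<beta>_def \<gamma>_def)
  \<comment> \<open>Determinant over trace: then (\<alpha> - \<epsilon>) (\<gamma> - \<epsilon>) =
    \<beta>^2 + \<epsilon>^2, so subtracting \<epsilon> on the diagonal leaves a positive definite
    form.\<close>
  define \<epsilon> where "\<epsilon> = (\<alpha> * \<gamma> - \<beta>\<^sup>2) / (\<alpha> + \<gamma>)"
  have e: "\<epsilon> > 0" "\<epsilon> < \<alpha>" "\<epsilon> * (\<alpha> + \<gamma>) = \<alpha> * \<gamma> - \<beta>\<^sup>2"
  proof -
    show "\<epsilon> > 0" "\<epsilon> * (\<alpha> + \<gamma>) = \<alpha> * \<gamma> - \<beta>\<^sup>2" using pos by (simp_all add: \<epsilon>_def)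
    have "\<alpha> * \<gamma> - \<beta>\<^sup>2 < \<alpha> * (\<alpha> + \<gamma>)"
      using zero_le_power2[of \<beta>] mult_pos_pos[OF pos(1) pos(1)] unfolding distrib_left by linarith
    then show "\<epsilon> < \<alpha>" using pos by (simp add: \<epsilon>_def pos_divide_less_eq)
  qed
  define N where "N = (\<lambda>x :: real^4. x \<bullet> (real_mat P *v x))"
  have N0: "N x \<ge> 0" for x
    using P_pos by (cases "x = 0") (auto simp: N_def pos_def_def intro: less_imp_le)
  have symP: "x \<bullet> (real_mat P *v y) = y \<bullet> (real_mat P *v x)" for x y
    using P_pos by (metis dot_lmul_matrix inner_commute pos_def_def transpose_matrix_vector)
  have lower: "\<alpha> * N x + 2 * \<beta> * (x \<bullet> (real_mat P *v y)) + \<gamma> * N y \<ge> \<epsilon> * (N x + N y)" for x y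
  proof -
    define \<alpha>' \<gamma>' where "\<alpha>' = \<alpha> - \<epsilon>" and "\<gamma>' = \<gamma> - \<epsilon>"
    have a': "\<alpha>' > 0" using e by (simp add: \<alpha>'_def)
    have "\<alpha>' * \<gamma>' = \<beta>\<^sup>2 + \<epsilon>\<^sup>2"
      using e(3) by (simp add: \<alpha>'_def \<gamma>'_def algebra_simps power2_eq_square)
    then have ge: "\<alpha>' * \<gamma>' - \<beta>\<^sup>2 \<ge> 0" by simp
    have "N (\<alpha>' *\<^sub>R x + \<beta> *\<^sub>R y) = \<alpha>'\<^sup>2 * N x + 2 * \<alpha>' * \<beta> * (x \<bullet> (real_mat P *v y)) + \<beta>\<^sup>2 * N y"
      by (simp add: N_def matrix_vector_right_distrib matrix_vector_mult_scaleR inner_add_left inner_add_right symP[of y x] power2_eq_square algebra_simps)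
    then have "\<alpha>' * (\<alpha>' * N x + 2 * \<beta> * (x \<bullet> (real_mat P *v y)) + \<gamma>' * N y)
        = N (\<alpha>' *\<^sub>R x + \<beta> *\<^sub>R y) + (\<alpha>' * \<gamma>' - \<beta>\<^sup>2) * N y"
      by (simp add: algebra_simps power2_eq_square)
    also have "\<dots> \<ge> 0" using N0 ge by simp
    finally have "\<alpha>' * N x + 2 * \<beta> * (x \<bullet> (real_mat P *v y)) + \<gamma>' * N y \<ge> 0"
      using a' by (simp add: zero_le_mult_iff)
    then show ?thesis by (simp add: \<alpha>'_def \<gamma>'_def algebra_simps)
  qed
  obtain e1 where e1: "e1 > 0" "\<And>x. x \<bullet> (real_mat P *v x) \<ge> e1 * (x \<bullet> x)"
    by (rule pos_def_lower_bound[OF P_pos]) (rule that)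
  define g :: "int^4 \<Rightarrow> complex" where "g = (\<lambda>k. of_real (exp (- (pi / real p * \<epsilon>) * N (riv k))))"
  have g: "g norm_summable_on UNIV"
  proof (rule norm_summable_int4)
    show "pi / real p * \<epsilon> * e1 > 0" using e e1 p_pos by simp
    fix k :: "int^4"
    have "e1 * (\<Sum>i\<in>UNIV. (of_int (k $ i))\<^sup>2) \<le> N (riv k)"
      using e1(2)[of "riv k"] by (simp add: N_def inner_vec_def riv_def power2_eq_square)
    from mult_left_mono[OF this, of "pi / real p * \<epsilon>"] e
    show "norm (g k) \<le> exp (0 + (\<Sum>i\<in>UNIV. (0 :: real^4) $ i * of_int (k $ i)) - pi / real p * \<epsilon> * e1 * (\<Sum>i\<in>UNIV. (of_int (k $ i))\<^sup>2))"
      by (simp add: g_def mult.assoc)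
  qed
  have "norm (tterm a b c z) \<le> norm (case z of (k, l) \<Rightarrow> g k * g l)" for z
  proof -
    obtain k l where z: "z = (k, l)" by (cases z)
    have "norm (tterm a b c z) = exp (- (pi / real p) * (\<alpha> * N (riv k) + 2 * \<beta> * (riv k \<bullet> (real_mat P *v riv l)) + \<gamma> * N (riv l)))"
      by (simp add: tterm_def z \<alpha>_def \<beta>_def \<gamma>_def N_def bil_real[symmetric] field_simps)
         (simp add: diff_divide_distrib add_divide_distrib)
    also have "\<dots> \<le> exp (- (pi / real p) * (\<epsilon> * (N (riv k) + N (riv l))))"
      using lower[of "riv k" "riv l"] p_pos by (simp add: divide_right_mono)
    also have "\<dots> = norm (case z of (k, l) \<Rightarrow> g k * g l)"
      by (simp add: z g_def norm_mult exp_add[symmetric] algebra_simps)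
    finally show ?thesis .
  qed
  then have "tterm a b c norm_summable_on UNIV \<times> UNIV"
    by (intro summable_on_comparison_test[OF norm_summable_product[OF g g]]) auto
  then show ?thesis
    by (rule summable_on_subset_banach) auto
qed

lemma tterm_summable': "h2 a b c \<Longrightarrow> tterm a b c summable_on A \<times> B"
  by (rule abs_summable_summable[OF tterm_summable])

lemma Theta_swap: "Theta A B a b c = Theta B A c b a"
proof -
  have "bij_betw (\<lambda>(k, l). (l, k)) (B \<times> A) (A \<times> B)"
    by (rule bij_betw_byWitness[where f' = "\<lambda>(k, l). (l, k)"]) auto
  from infsum_reindex_bij_betw[OF this, of "tterm a b c"] show ?thesis
    by (simp add: Theta_def tterm_def case_prod_unfold bil_commute add_ac)
qed

lemma Theta_image:
  assumes "s \<noteq> 0"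
  shows "Theta ((\<lambda>k. s *s k) ` A) B a b c = Theta A B (of_int (s * s) * a) (of_int s * b) c"
proof -
  have "bij_betw (\<lambda>(k, l). (s *s k, l)) (A \<times> B) (((\<lambda>k. s *s k) ` A) \<times> B)"
    using assms by (auto simp: bij_betw_def inj_on_def vec_eq_iff)
  from infsum_reindex_bij_betw[OF this, of "tterm a b c"] show ?thesis
    by (simp add: Theta_def tterm_def case_prod_unfold bil_smult mult_ac)
qed

lemma uminus_lat: "(\<lambda>k. (-1) *s k) ` lat = lat"
proof -
  have "(\<lambda>k. (-1) *s k) ` lat = (\<lambda>m. Q *v m) ` range (\<lambda>m. (-1) *s m)"
    unfolding lat_def image_image matrix_vector_mult_smult ..
  also have "range (\<lambda>m :: int^4. (-1) *s m) = UNIV"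
    by (rule surjI[where f = "\<lambda>m. (-1) *s m"]) (simp add: vec_eq_iff)
  finally show ?thesis
    by (simp add: lat_def)
qed

text \<open>Replacing k by - k reconciles the entry - b / c of \<open>slash_E1_mat\<close> with the
  b / c of \<open>Theta_inversion\<close>.\<close>

lemma Theta_lat_uminus: "Theta lat B a (- b) c = Theta lat B a b c"
  using Theta_image[of "-1" lat B a b c] by (simp only: uminus_lat) simp

text \<open>The two columns of N, mapped by Q, run through \<open>lat\<close>; on such vectors
  \<open>bil\<close> has a factor p that cancels the 1 / p in \<open>tterm\<close>.\<close>

lemma theta2_eq_Theta: "theta2 Q (Om a b c) = Theta lat lat a b c"
proof -
  define col where "col = (\<lambda>(m :: int^4, n :: int^4). (\<chi> i. vector [m $ i, n $ i]) :: int^2^4)"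
  have bij1: "bij col"
    by (rule bij_betw_byWitness[where f' = "\<lambda>N. (\<chi> i. N $ i $ 1, \<chi> i. N $ i $ 2)"])
       (auto simp: col_def vec_eq_iff forall_2)
  have bij2: "bij_betw (\<lambda>(m, n). (Q *v m, Q *v n)) UNIV (lat \<times> lat)"
    using inj_Q by (auto simp: bij_betw_def lat_def inj_def inj_on_def)
  have "theta2 Q (Om a b c) = (\<Sum>\<^sub>\<infinity>z. exp (2 * of_real pi * \<i> * (1 / 2 * trace (map_matrix of_int (transpose (col z) ** Q ** col z) ** Om a b c))))"
    unfolding theta2_def by (rule infsum_reindex_bij_betw[OF bij1, symmetric])
  also have "\<dots> = (\<Sum>\<^sub>\<infinity>z. tterm a b c (case z of (m, n) \<Rightarrow> (Q *v m, Q *v n)))"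
  proof (intro infsum_cong)
    fix z :: "(int^4) \<times> (int^4)"
    obtain m n where z: "z = (m, n)" by (cases z)
    have ent: "(transpose (col z) ** Q ** col z) $ r $ s = idot (\<chi> i. col z $ i $ r) (Q *v (\<chi> i. col z $ i $ s))" for r s
      by (simp add: idot_def matrix_matrix_mult_def matrix_vector_mult_def transpose_def sum_distrib_left sum_distrib_right mult.assoc)
         (rule sum.swap)
    have c: "(\<chi> i. col z $ i $ 1) = m" "(\<chi> i. col z $ i $ 2) = n"
      by (simp_all add: z col_def vec_eq_iff)
    have nm: "idot n (Q *v m) = idot m (Q *v n)"
      using idot_mult_transpose[of n Q m] by (simp add: sym idot_commute)
    have b: "bil (Q *v x) (Q *v y) = int p * idot x (Q *v y)" for x y
      using idot_mult_transpose[of x Q y] by (simp add: bil_Q sym idot_commute)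
    have tr: "trace (map_matrix of_int (transpose (col z) ** Q ** col z) ** Om a b c)
        = a * of_int (idot m (Q *v m)) + 2 * b * of_int (idot m (Q *v n)) + c * of_int (idot n (Q *v n))"
    proof -
      have "trace (map_matrix of_int G ** Om a b c)
         = of_int (G $ 1 $ 1) * a + of_int (G $ 1 $ 2) * b + (of_int (G $ 2 $ 1) * b + of_int (G $ 2 $ 2) * c)" for G :: "int^2^2"
        by (simp add: trace_def sum_2 matrix_matrix_mult_def map_matrix_def Om_def)
      then show ?thesis
        by (simp add: ent c nm algebra_simps)
    qed
    show "exp (2 * of_real pi * \<i> * (1 / 2 * trace (map_matrix of_int (transpose (col z) ** Q ** col z) ** Om a b c)))
       = tterm a b c (case z of (m, n) \<Rightarrow> (Q *v m, Q *v n))"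
      unfolding tr unfolding z tterm_def prod.case b
      by (intro arg_cong[where f = exp]) (use p_pos in \<open>simp add: field_simps\<close>)
  qed
  also have "\<dots> = Theta lat lat a b c"
    unfolding Theta_def using infsum_reindex_bij_betw[OF bij2, of "tterm a b c"] by (simp add: case_prod_unfold)
  finally show ?thesis .
qed

text \<open>Inverting the second variable divides the determinant of the imaginary part by
  |c|^2.\<close>

lemma h2_invert:
  assumes "h2 a b c"
  shows "h2 (a - b\<^sup>2 / c) (b / c) (- 1 / c)"
proof -
  define r where "r = (norm c)\<^sup>2"
  have c0: "c \<noteq> 0" and ic: "Im c > 0" using assms by (auto simp: h2_def)
  have r: "r > 0" "r = (Re c)\<^sup>2 + (Im c)\<^sup>2" using c0 by (simp add: r_def) (simp add: r_def cmod_power2)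
  have i1: "Im (- 1 / c) = Im c / r"
    by (simp add: Im_divide r)
  have i2: "Im (b / c) = (Im b * Re c - Re b * Im c) / r"
    by (simp add: Im_divide r)
  have i3: "Im (a - b\<^sup>2 / c) = Im a - (2 * Re b * Im b * Re c - ((Re b)\<^sup>2 - (Im b)\<^sup>2) * Im c) / r"
    by (simp add: Im_divide r power2_eq_square algebra_simps)
  have "Im (a - b\<^sup>2 / c) * Im (- 1 / c) - (Im (b / c))\<^sup>2 = (Im a * Im c - (Im b)\<^sup>2) / r"
  proof -
    have "(Im a - (2 * Re b * Im b * Re c - ((Re b)\<^sup>2 - (Im b)\<^sup>2) * Im c) / r) * (Im c / r) - ((Im b * Re c - Re b * Im c) / r)\<^sup>2
       = (r * (Im a * Im c) - (2 * Re b * Im b * Re c - ((Re b)\<^sup>2 - (Im b)\<^sup>2) * Im c) * Im c - (Im b * Re c - Re b * Im c)\<^sup>2) / r\<^sup>2"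
      using r(1) by (simp add: field_simps power2_eq_square)
    also have "r * (Im a * Im c) - (2 * Re b * Im b * Re c - ((Re b)\<^sup>2 - (Im b)\<^sup>2) * Im c) * Im c - (Im b * Re c - Re b * Im c)\<^sup>2
       = r * (Im a * Im c - (Im b)\<^sup>2)"
      by (simp add: r(2) algebra_simps power2_eq_square)
    finally show ?thesis
      unfolding i1 i2 i3 using r(1) by (simp add: power2_eq_square)
  qed
  moreover have "(Im a * Im c - (Im b)\<^sup>2) / r > 0"
    using assms r(1) by (simp add: h2_def)
  ultimately have "(Im (b / c))\<^sup>2 < Im (a - b\<^sup>2 / c) * Im (- 1 / c)"
    by linarith
  moreover have "Im (- 1 / c) > 0"
    unfolding i1 using ic r(1) by simp
  ultimately show ?thesis
    unfolding h2_def by blast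
qed

text \<open>For fixed k the sum over l is \<open>theta_inversion_4\<close> with a shift linear in k.
  The square of the shift changes a into a - b^2 / c, the factor p is the square root of det Q, and
  the vectors Q m of the dual sum make up \<open>lat\<close>.\<close>

lemma Theta_inversion:
  assumes h: "h2 a b c"
  shows "Theta A UNIV a b c = - of_nat p / c\<^sup>2 * Theta A lat (a - b\<^sup>2 / c) (b / c) (- 1 / c)"
proof -
  have ic: "Im c > 0" using h by (simp add: h2_def)
  then have c0: "c \<noteq> 0" by auto
  have p0: "(of_nat p :: complex) \<noteq> 0" using p_pos by simp
  have inv: "matrix_inv (real_mat Q) = (1 / real p) *\<^sub>R real_mat P"
  proof -
    have "matrix_inv (real_mat Q) *v x = (1 / real p) *\<^sub>R (real_mat P *v x)" for x
    proof -
      have "real_mat Q *v (real_mat P *v x) = real p *\<^sub>R x"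
      proof -
        have "real_mat Q ** real_mat P = mat (real p)"
          unfolding real_mat_mult[symmetric] QP by (simp add: vec_eq_iff map_matrix_def mat_def)
        moreover have "mat (real p) *v x = real p *\<^sub>R x"
          by (simp add: mat_def matrix_vector_mult_def vec_eq_iff mult_delta_left)
        ultimately show ?thesis by (simp add: matrix_vector_mul_assoc)
      qed
      then have "real_mat Q *v ((1 / real p) *\<^sub>R (real_mat P *v x)) = x"
        using p_pos by (simp add: matrix_vector_mult_scaleR)
      then show ?thesis
        using matrix_inv_mult_vec(1)[OF pos_def_invertible[OF Q_pos]] by metis
    qed
    then show ?thesis
      by (simp add: matrix_eq scaleR_matrix_vector_assoc)
  qed
  have quadP: "cquad (matrix_inv (real_mat Q)) (civ l) = of_int (bil l l) / of_nat p" for l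
    unfolding cquad_civ inv by (simp add: scaleR_matrix_vector_assoc[symmetric] bil_real[symmetric])
  have quadQ: "cquad (real_mat Q) (civ m - (\<chi> i. b / of_nat p * of_int ((P *v k) $ i)))
     = of_int (idot m (Q *v m)) - 2 * b * of_int (idot k m) + b\<^sup>2 / of_nat p * of_int (bil k k)" for k m
  proof -
    define y where "y = P *v k"
    define t where "t = b / of_nat p"
    have Qs: "Q $ i $ j = Q $ j $ i" for i j
      using arg_cong[OF sym(1), of "\<lambda>X. X $ j $ i"] by (simp add: transpose_def)
    have ex: "of_int (idot u (Q *v v)) = (\<Sum>i\<in>UNIV. \<Sum>j\<in>UNIV. of_int (Q $ i $ j) * of_int (u $ i) * (of_int (v $ j) :: complex))" for u v
      by (simp add: idot_def matrix_vector_mult_def sum_distrib_left mult_ac)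
    have "cquad (real_mat Q) (civ m - (\<chi> i. t * of_int (y $ i)))
       = of_int (idot m (Q *v m)) - t * of_int (idot m (Q *v y)) - t * of_int (idot y (Q *v m)) + t\<^sup>2 * of_int (idot y (Q *v y))"
      unfolding ex
      by (simp add: cquad_def civ_def map_matrix_def sum_4 algebra_simps power2_eq_square)
    moreover have "idot m (Q *v y) = int p * idot k m"
      by (simp add: y_def QPv idot_smult idot_commute)
    moreover have "idot y (Q *v m) = int p * idot k m"
      using idot_mult_transpose[of y Q m] by (simp add: y_def sym QPv idot_smult)
    moreover have "idot y (Q *v y) = int p * bil k k"
      by (simp add: y_def QPv idot_smult bil_def idot_commute)
    ultimately show ?thesis
      using p0 by (simp add: t_def y_def power2_eq_square field_simps)
  qed
  have inner: "(\<Sum>\<^sub>\<infinity>l. tterm a b c (k, l)) = - of_nat p / c\<^sup>2 * (\<Sum>\<^sub>\<infinity>l\<in>lat. tterm (a - b\<^sup>2 / c) (b / c) (- 1 / c) (k, l))" for k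
  proof -
    \<comment> \<open>Chosen so that pairing l with w reproduces the coupling b
      \<open>bil k l\<close> / p.\<close>
    define w :: "complex^4" where "w = (\<chi> i. b / of_nat p * of_int ((P *v k) $ i))"
    define f where "f = exp (of_real pi * \<i> / of_nat p * (a * of_int (bil k k)))"
    have lw: "(\<Sum>i\<in>UNIV. of_int (l $ i) * w $ i) = b / of_nat p * of_int (bil k l)" for l
      unfolding bil_commute[of k l] by (simp add: w_def bil_def idot_def sum_distrib_left mult_ac)
    have "tterm a b c (k, l) = f * exp (of_real pi * \<i> * c * cquad (matrix_inv (real_mat Q)) (civ l) + 2 * of_real pi * \<i> * (\<Sum>i\<in>UNIV. of_int (l $ i) * w $ i))" for l
      unfolding lw quadP f_def tterm_def prod.case exp_add[symmetric]
      by (intro arg_cong[where f = exp]) (use p0 in \<open>simp add: field_simps\<close>)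
    then have "(\<Sum>\<^sub>\<infinity>l. tterm a b c (k, l)) = f * (\<Sum>\<^sub>\<infinity>l. exp (of_real pi * \<i> * c * cquad (matrix_inv (real_mat Q)) (civ l) + 2 * of_real pi * \<i> * (\<Sum>i\<in>UNIV. of_int (l $ i) * w $ i)))"
      by (simp add: infsum_cmult_right')
    also have "\<dots> = f * (- of_nat p / c\<^sup>2 * (\<Sum>\<^sub>\<infinity>m. exp (of_real pi * \<i> * (-1 / c) * cquad (real_mat Q) (civ m - w))))"
      unfolding theta_inversion_4[OF Q_pos ic] by (simp add: det_real_mat det_Q)
    also have "\<dots> = - of_nat p / c\<^sup>2 * (\<Sum>\<^sub>\<infinity>m. f * exp (of_real pi * \<i> * (-1 / c) * cquad (real_mat Q) (civ m - w)))"
      by (simp add: infsum_cmult_right')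
    also have "(\<lambda>m. f * exp (of_real pi * \<i> * (-1 / c) * cquad (real_mat Q) (civ m - w)))
        = (\<lambda>m. tterm (a - b\<^sup>2 / c) (b / c) (- 1 / c) (k, Q *v m))"
    proof
      fix m
      have b1: "bil (Q *v m) (Q *v m) = int p * idot m (Q *v m)"
        by (simp add: bil_Q idot_commute)
      show "f * exp (of_real pi * \<i> * (-1 / c) * cquad (real_mat Q) (civ m - w)) = tterm (a - b\<^sup>2 / c) (b / c) (- 1 / c) (k, Q *v m)"
        unfolding w_def quadQ f_def tterm_def prod.case exp_add[symmetric] b1 bil_Q[of k]
        by (intro arg_cong[where f = exp]) (use p0 c0 in \<open>simp add: field_simps\<close>)
    qed
    also have "(\<Sum>\<^sub>\<infinity>m. tterm (a - b\<^sup>2 / c) (b / c) (- 1 / c) (k, Q *v m)) = (\<Sum>\<^sub>\<infinity>l\<in>lat. tterm (a - b\<^sup>2 / c) (b / c) (- 1 / c) (k, l))"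
      by (rule infsum_reindex_bij_betw) (use inj_Q in \<open>auto simp: bij_betw_def lat_def\<close>)
    finally show ?thesis .
  qed
  have "Theta A UNIV a b c = (\<Sum>\<^sub>\<infinity>k\<in>A. \<Sum>\<^sub>\<infinity>l. tterm a b c (k, l))"
    unfolding Theta_def using infsum_Sigma_banach[OF tterm_summable'[OF h, of A UNIV]] by simp
  also have "\<dots> = - of_nat p / c\<^sup>2 * (\<Sum>\<^sub>\<infinity>k\<in>A. \<Sum>\<^sub>\<infinity>l\<in>lat. tterm (a - b\<^sup>2 / c) (b / c) (- 1 / c) (k, l))"
    unfolding inner by (rule infsum_cmult_right')
  also have "(\<Sum>\<^sub>\<infinity>k\<in>A. \<Sum>\<^sub>\<infinity>l\<in>lat. tterm (a - b\<^sup>2 / c) (b / c) (- 1 / c) (k, l)) = Theta A lat (a - b\<^sup>2 / c) (b / c) (- 1 / c)"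
    unfolding Theta_def using infsum_Sigma_banach[OF tterm_summable'[OF h2_invert[OF h], of A lat]] by simp
  finally show ?thesis .
qed

end

section \<open>The trace\<close>

lemma sum_infsum:
  fixes f :: "'i \<Rightarrow> 'a \<Rightarrow> complex"
  assumes "finite I" "\<And>i. i \<in> I \<Longrightarrow> f i summable_on A"
  shows "(\<Sum>i\<in>I. infsum (f i) A) = (\<Sum>\<^sub>\<infinity>x\<in>A. \<Sum>i\<in>I. f i x)"
proof -
  have "((\<lambda>x. \<Sum>i\<in>I. f i x) has_sum (\<Sum>i\<in>I. infsum (f i) A)) A"
    using assms
  proof (induction I rule: finite_induct)
    case (insert j I)
    have "((\<lambda>x. f j x + (\<Sum>i\<in>I. f i x)) has_sum (infsum (f j) A + (\<Sum>i\<in>I. infsum (f i) A))) A"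
      using insert by (intro has_sum_add has_sum_infsum) auto
    then show ?case
      using insert by simp
  qed auto
  from infsumI[OF this] show ?thesis by simp
qed

context level_pair
begin

lemma h2_add_real: "h2 a b c \<Longrightarrow> h2 (a + of_real s) b (c + of_real t)"
  by (simp add: h2_def)

lemma tterm_add_real:
  "tterm (a + s) b (c + t) (k, l) = tterm a b c (k, l)
     * exp (of_real pi * \<i> / of_nat p * (s * of_int (bil k k) + t * of_int (bil l l)))"
  unfolding tterm_def prod.case exp_add[symmetric] by (simp add: algebra_simps)

lemma infsum_tterm_select:
  assumes "S \<subseteq> A \<times> B"
  shows "(\<Sum>\<^sub>\<infinity>z\<in>A \<times> B. tterm a b c z * (if z \<in> S then of_nat p else 0)) = of_nat p * infsum (tterm a b c) S"
proof -
  have "(\<Sum>\<^sub>\<infinity>z\<in>A \<times> B. tterm a b c z * (if z \<in> S then of_nat p else 0)) = (\<Sum>\<^sub>\<infinity>z\<in>S. of_nat p * tterm a b c z)"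
    using assms by (intro infsum_cong_neutral) auto
  then show ?thesis by (simp add: infsum_cmult_right')
qed

text \<open>For k in \<open>lat\<close> one has \<open>bil k k\<close> = 2 p N, and the translation
  by \<beta> / p multiplies the term by the character of \<beta> N / p. Its sum selects p | N, which
  means k in \<open>pdual\<close>.\<close>

lemma Theta_sum_first:
  assumes h: "h2 a b c"
  shows "(\<Sum>\<beta><p. Theta lat B (a + of_nat \<beta> / of_nat p) b c) = of_nat p * Theta pdual B a b c"
proof -
  have p0: "(of_nat p :: complex) \<noteq> 0" using p_pos by simp
  have "(\<Sum>\<beta><p. Theta lat B (a + of_nat \<beta> / of_nat p) b c) = (\<Sum>\<^sub>\<infinity>z\<in>lat \<times> B. \<Sum>\<beta><p. tterm (a + of_nat \<beta> / of_nat p) b c z)"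
    unfolding Theta_def
  proof (rule sum_infsum)
    fix \<beta>
    have "h2 (a + of_nat \<beta> / of_nat p) b c"
      using h2_add_real[OF h, of "real \<beta> / real p" 0] by simp
    then show "tterm (a + of_nat \<beta> / of_nat p) b c summable_on lat \<times> B"
      by (rule tterm_summable')
  qed auto
  also have "\<dots> = (\<Sum>\<^sub>\<infinity>z\<in>lat \<times> B. tterm a b c z * (if z \<in> pdual \<times> B then of_nat p else 0))"
  proof (rule infsum_cong)
    fix z assume "z \<in> lat \<times> B"
    then obtain k l where z: "z = (k, l)" "k \<in> lat" "l \<in> B" by auto
    obtain N where N: "bil k k = 2 * int p * N"
      using z(2) unfolding mem_lat_iff by (rule dvdE)
    have dv: "int p dvd N \<longleftrightarrow> k \<in> pdual"
      unfolding mem_pdual_iff[OF z(2)] N using p_pos by (simp add: power2_eq_square mult.assoc)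
    have "tterm (a + of_nat \<beta> / of_nat p) b c z = tterm a b c z * cexp1 (of_nat \<beta> * of_int N / of_nat p)" for \<beta>
      using tterm_add_real[of a "of_nat \<beta> / of_nat p" b c 0 k l] p0
      by (simp add: z N cexp1_def mult_ac)
    then show "(\<Sum>\<beta><p. tterm (a + of_nat \<beta> / of_nat p) b c z) = tterm a b c z * (if z \<in> pdual \<times> B then of_nat p else 0)"
      using z by (simp only: sum_distrib_left[symmetric] sum_cexp1_residues[OF p_pos] dv mem_Times_iff fst_conv snd_conv simp_thms)
  qed
  also have "\<dots> = of_nat p * Theta pdual B a b c"
    unfolding Theta_def using pdual_subset_lat by (intro infsum_tterm_select) auto
  finally show ?thesis .
qed

text \<open>Here \<open>bil l l\<close> = 2 N by evenness of P alone, and the translation by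
  \<alpha> multiplies the term by the character of \<alpha> N / p; p | N means l in
  \<open>lat\<close>.\<close>

lemma Theta_sum_second:
  assumes h: "h2 a b c"
  shows "(\<Sum>\<alpha><p. Theta A UNIV a b (c + of_nat \<alpha>)) = of_nat p * Theta A lat a b c"
proof -
  have p0: "(of_nat p :: complex) \<noteq> 0" using p_pos by simp
  have "(\<Sum>\<alpha><p. Theta A UNIV a b (c + of_nat \<alpha>)) = (\<Sum>\<^sub>\<infinity>z\<in>A \<times> UNIV. \<Sum>\<alpha><p. tterm a b (c + of_nat \<alpha>) z)"
    unfolding Theta_def
  proof (rule sum_infsum)
    fix \<alpha>
    have "h2 a b (c + of_nat \<alpha>)"
      using h2_add_real[OF h, of 0 "real \<alpha>"] by simp
    then show "tterm a b (c + of_nat \<alpha>) summable_on A \<times> UNIV"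
      by (rule tterm_summable')
  qed auto
  also have "\<dots> = (\<Sum>\<^sub>\<infinity>z\<in>A \<times> UNIV. tterm a b c z * (if z \<in> A \<times> lat then of_nat p else 0))"
  proof (rule infsum_cong)
    fix z :: "(int^4) \<times> (int^4)" assume "z \<in> A \<times> UNIV"
    then obtain k l where z: "z = (k, l)" "k \<in> A" by auto
    have "even (bil l l)" unfolding bil_def by (rule even_idot[OF P_even])
    then obtain N where N: "bil l l = 2 * N" by (rule evenE)
    have dv: "int p dvd N \<longleftrightarrow> l \<in> lat"
      unfolding mem_lat_iff N by simp
    have "tterm a b (c + of_nat \<alpha>) z = tterm a b c z * cexp1 (of_nat \<alpha> * of_int N / of_nat p)" for \<alpha>
      using tterm_add_real[of a 0 b c "of_nat \<alpha>" k l] p0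
      by (simp add: z N cexp1_def mult_ac)
    then show "(\<Sum>\<alpha><p. tterm a b (c + of_nat \<alpha>) z) = tterm a b c z * (if z \<in> A \<times> lat then of_nat p else 0)"
      using z by (simp only: sum_distrib_left[symmetric] sum_cexp1_residues[OF p_pos] dv mem_Times_iff fst_conv snd_conv simp_thms)
  qed
  also have "\<dots> = of_nat p * Theta A lat a b c"
    unfolding Theta_def by (intro infsum_tterm_select) auto
  finally show ?thesis .
qed

text \<open>The substitution uses - p in place of p, so that the middle entry gets the sign produced
  by \<open>mu_tilde_mat\<close> and \<open>mu_mat\<close>.\<close>

lemma Theta_pdual: "Theta pdual B a b c = Theta UNIV B ((of_nat p)\<^sup>2 * a) (- (of_nat p * b)) c"
proof -
  have "range (\<lambda>m :: int^4. (- int p) *s m) = pdual"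
  proof -
    have "(- int p) *s m = int p *s (- m)" "int p *s m = (- int p) *s (- m)" for m :: "int^4"
      by (simp_all add: vec_eq_iff)
    then show ?thesis
      unfolding pdual_def by (auto simp only: image_iff) blast+
  qed
  then show ?thesis
    using Theta_image[of "- int p" UNIV B a b c] p_pos by (simp add: power2_eq_square)
qed

text \<open>\<open>Theta_inversion\<close> read from right to left: moving its factor - p / c^2
  across leaves -1 / p.\<close>

lemma slash_E1_theta:
  assumes h: "h2 a b c"
  shows "slash 2 (theta2 Q) E1_mat (Om a b c) = - Theta lat UNIV a b c / of_nat p"
proof -
  have "c \<noteq> 0" using h by (auto simp: h2_def)
  moreover have "Theta lat lat (a - b\<^sup>2 / c) (- b / c) (- 1 / c) = Theta lat lat (a - b\<^sup>2 / c) (b / c) (- 1 / c)"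
    using Theta_lat_uminus[of lat "a - b\<^sup>2 / c" "b / c" "- 1 / c"] by simp
  ultimately show ?thesis
    using p_pos by (simp add: slash_E1_mat theta2_eq_Theta Theta_inversion[OF h])
qed

text \<open>The full inversion is carried out as two column inversions at p \<Omega> with the
  columns swapped in between. The two minus signs cancel and the two automorphy factors combine to
  (p D)^(-2).\<close>

lemma slash_F_theta:
  assumes h: "h2 a b c"
  shows "slash 2 (theta2 Q) (F_mat p) (Om a b c) = Theta UNIV UNIV (of_nat p * a) (of_nat p * b) (of_nat p * c)"
proof -
  define D where "D = a * c - b\<^sup>2"
  let ?q = "of_nat p :: complex"
  have q0: "?q \<noteq> 0" using p_pos by simp
  have a0: "a \<noteq> 0" using h2_a_pos[OF h] by auto
  have c0: "c \<noteq> 0" using h by (auto simp: h2_def)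
  have "a - b\<^sup>2 / c \<noteq> 0" using h2_a_pos[OF h2_invert[OF h]] by auto
  then have D0: "D \<noteq> 0" using c0 by (simp add: D_def field_simps)
  have hp: "h2 (?q * c) (?q * b) (?q * a)"
  proof -
    have "sqrt (real p) \<noteq> 0" using p_pos by simp
    from h2_swap[OF h2_scale[OF h this this]] show ?thesis by simp
  qed
  have e1: "?q * c - (?q * b)\<^sup>2 / (?q * a) = ?q * D / a" "?q * b / (?q * a) = b / a"
    using q0 a0 by (simp_all add: D_def field_simps power2_eq_square)
  have hs: "h2 (- 1 / (?q * a)) (b / a) (?q * D / a)"
    using h2_swap[OF h2_invert[OF hp]] unfolding e1 .
  have e2: "- 1 / (?q * a) - (b / a)\<^sup>2 / (?q * D / a) = - c / (?q * D)"
  proof -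
    have "- 1 / (?q * a) - (b / a)\<^sup>2 / (?q * D / a) = - (D + b\<^sup>2) / (?q * a * D)"
      using q0 a0 D0 by (simp add: field_simps power2_eq_square)
    also have "D + b\<^sup>2 = a * c" by (simp add: D_def)
    finally show ?thesis using a0 by simp
  qed
  have e3: "b / a / (?q * D / a) = b / (?q * D)" "- 1 / (?q * D / a) = - a / (?q * D)"
    using a0 by simp_all
  have "Theta UNIV UNIV (?q * a) (?q * b) (?q * c) = Theta UNIV UNIV (?q * c) (?q * b) (?q * a)"
    by (rule Theta_swap)
  also have "\<dots> = - ?q / (?q * a)\<^sup>2 * Theta UNIV lat (?q * D / a) (b / a) (- 1 / (?q * a))"
    using Theta_inversion[OF hp, of UNIV] unfolding e1 .
  also have "Theta UNIV lat (?q * D / a) (b / a) (- 1 / (?q * a)) = Theta lat UNIV (- 1 / (?q * a)) (b / a) (?q * D / a)"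
    by (rule Theta_swap)
  also have "\<dots> = - ?q / (?q * D / a)\<^sup>2 * Theta lat lat (- c / (?q * D)) (b / (?q * D)) (- a / (?q * D))"
    using Theta_inversion[OF hs, of lat] unfolding e2 e3 .
  also have "- ?q / (?q * a)\<^sup>2 * (- ?q / (?q * D / a)\<^sup>2 * Theta lat lat (- c / (?q * D)) (b / (?q * D)) (- a / (?q * D)))
      = Theta lat lat (- c / (?q * D)) (b / (?q * D)) (- a / (?q * D)) / (?q * D)\<^sup>2"
    using q0 a0 D0 by (simp add: power2_eq_square)
  finally show ?thesis
    by (simp only: slash_F_mat[OF p_pos D_def D0] theta2_eq_Theta)
qed

theorem Tr_op_theta2:
  assumes h: "h2 a b c"
  shows "Tr_op 2 p (theta2 Q) (Om a b c) = 0"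
proof -
  let ?q = "of_nat p :: complex" and ?T = "Theta pdual lat a b c"
  have q0: "?q \<noteq> 0" using p_pos by simp
  have hab: "h2 (a + of_nat \<beta> / ?q) b (c + of_nat \<alpha>)" for \<alpha> \<beta>
    using h2_add_real[OF h, of "real \<beta> / real p" "real \<alpha>"] by simp
  have T1: "(\<Sum>\<beta><p. slash 2 (theta2 Q) (t_mat (diag2 (real \<beta> / real p) 0)) (Om a b c)) = ?q * ?T"
    using Theta_sum_first[OF h, of lat] by (simp add: slash_t_mat theta2_eq_Theta)
  \<comment> \<open>The p^2 of \<open>slash_mu_tilde_mat\<close> meets the -1 / p of
    \<open>slash_E1_theta\<close>; swapping the columns and rescaling one of them turns the factors
    \<open>lat\<close> and \<open>UNIV\<close> into \<open>pdual\<close> and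
    \<open>lat\<close>.\<close>
  have T2: "slash 2 (slash 2 (theta2 Q) E1_mat) (mu_tilde_mat p) (Om a b c) = - (?q * ?T)"
  proof -
    have "h2 c (- (?q * b)) (?q\<^sup>2 * a)"
      using h2_uminus[OF h2_scale[OF h2_swap[OF h], of 1 "real p"]] p_pos by (simp add: power2_eq_square)
    then have "slash 2 (slash 2 (theta2 Q) E1_mat) (mu_tilde_mat p) (Om a b c) = ?q\<^sup>2 * (- Theta lat UNIV c (- (?q * b)) (?q\<^sup>2 * a) / ?q)"
      by (simp only: slash_mu_tilde_mat[OF p_pos] slash_E1_theta)
    also have "Theta lat UNIV c (- (?q * b)) (?q\<^sup>2 * a) = ?T"
      unfolding Theta_pdual by (rule Theta_swap)
    finally show ?thesis using q0 by (simp add: power2_eq_square)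
  qed
  \<comment> \<open>The inner sum over \<beta> yields a factor p that cancels the 1 / p of
    \<open>slash_E1_theta\<close>; the sum over \<alpha> yields the p that remains.\<close>
  have T3: "(\<Sum>\<alpha><p. \<Sum>\<beta><p. slash 2 (slash 2 (theta2 Q) E1_mat) (t_mat (diag2 (real \<beta> / real p) (real \<alpha>))) (Om a b c)) = - (?q * ?T)"
  proof -
    have hc: "h2 a b (c + of_nat \<alpha>)" for \<alpha>
      using hab[of 0 \<alpha>] by simp
    have "(\<Sum>\<beta><p. slash 2 (slash 2 (theta2 Q) E1_mat) (t_mat (diag2 (real \<beta> / real p) (real \<alpha>))) (Om a b c))
        = - Theta pdual UNIV a b (c + of_nat \<alpha>)" for \<alpha>
    proof -
      have "(\<Sum>\<beta><p. slash 2 (slash 2 (theta2 Q) E1_mat) (t_mat (diag2 (real \<beta> / real p) (real \<alpha>))) (Om a b c))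
          = - (\<Sum>\<beta><p. Theta lat UNIV (a + of_nat \<beta> / ?q) b (c + of_nat \<alpha>)) / ?q"
        by (simp add: slash_t_mat slash_E1_theta[OF hab] sum_divide_distrib sum_negf)
      then show ?thesis
        using q0 by (simp add: Theta_sum_first[OF hc])
    qed
    then show ?thesis
      by (simp add: sum_negf Theta_sum_second[OF h])
  qed
  have T4: "(\<Sum>\<alpha><p. slash 2 (slash 2 (theta2 Q) (F_mat p)) (mu_mat p ** t_mat (diag2 0 (real \<alpha>))) (Om a b c)) = ?q * ?T"
  proof -
    have "slash 2 (slash 2 (theta2 Q) (F_mat p)) (mu_mat p ** t_mat (diag2 0 (real \<alpha>))) (Om a b c)
        = Theta pdual UNIV a b (c + of_nat \<alpha>)" for \<alpha>
    proof -
      have hc: "h2 (c + of_nat \<alpha>) b a"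
        using h2_swap[OF hab[of 0 \<alpha>]] by simp
      have hf: "h2 ((c + of_nat \<alpha>) / ?q) (- b) (?q * a)"
      proof -
        \<comment> \<open>The point arises from (c + \<alpha>, b, a) by congruence with diag (1 /
          sqrt p, sqrt p) and a change of sign in the middle entry.\<close>
        have "sqrt (real p) \<noteq> 0" "1 / sqrt (real p) \<noteq> 0" using p_pos by simp_all
        moreover have "1 / sqrt (real p) * (1 / sqrt (real p)) = 1 / real p"
          "1 / sqrt (real p) * sqrt (real p) = 1" "sqrt (real p) * sqrt (real p) = real p"
          using p_pos by simp_all
        ultimately show ?thesis
          using h2_uminus[OF h2_scale[OF hc, of "1 / sqrt (real p)" "sqrt (real p)"]] by (simp only:) simp
      qed
      have "slash 2 (slash 2 (theta2 Q) (F_mat p)) (mu_mat p ** t_mat (diag2 0 (real \<alpha>))) (Om a b c)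
          = Theta UNIV UNIV (c + of_nat \<alpha>) (- (?q * b)) (?q\<^sup>2 * a)"
        using q0 by (simp add: slash_mu_t_mat[OF p_pos] slash_F_theta[OF hf] power2_eq_square mult.assoc)
      also have "\<dots> = Theta pdual UNIV a b (c + of_nat \<alpha>)"
        unfolding Theta_pdual by (rule Theta_swap)
      finally show ?thesis .
    qed
    then show ?thesis
      by (simp add: Theta_sum_second[OF h])
  qed
  show ?thesis
    unfolding Tr_op_def T1 T2 T3 T4 by simp
qed

end

section \<open>Reduction of the theorem to determinant p^2\<close>

lemma det_mat_4: "det (mat x :: int^4^4) = x ^ 4"
  by (subst det_diagonal) (simp_all add: mat_def)

lemma matrix_mult_scaleR:
  fixes A B :: "real^'n^'n"
  shows "A ** (c *\<^sub>R B) = c *\<^sub>R (A ** B)" "(c *\<^sub>R A) ** B = c *\<^sub>R (A ** B)"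
  by (simp_all add: matrix_matrix_mult_def vec_eq_iff sum_distrib_left mult_ac)

theorem theorem3p5:
  fixes p :: nat and Q :: "int^4^4"
  assumes "prime p" and "odd p"
    and "even_integral Q"
    and "pos_def (real_mat Q)"
    and "has_level Q p"
    and "\<exists>d. det Q = d\<^sup>2"
  shows "\<forall>\<Omega>\<in>siegel_upper_half. Tr_op 2 p (theta2 Q) \<Omega> = 0"
proof
  fix \<Omega> assume "\<Omega> \<in> siegel_upper_half"
  then obtain a b c where \<Omega>: "\<Omega> = Om a b c" "Im c > 0" "(Im b)\<^sup>2 < Im a * Im c"
    by (rule siegel_Om)
  obtain P where P: "even_integral P" "real p *\<^sub>R matrix_inv (real_mat Q) = real_mat P"
    using assms(5) by (auto simp: has_level_def inverse_scaled_even_def)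
  have p0: "p > 0" using assms(1) by (simp add: prime_gt_0_nat)
  have inv: "invertible (real_mat Q)" by (rule pos_def_invertible[OF assms(4)])
  have matp: "real p *\<^sub>R mat 1 = real_mat (mat (int p) :: int^4^4)"
    by (simp add: vec_eq_iff map_matrix_def mat_def)
  have QP: "Q ** P = mat (int p)" and PQ: "P ** Q = mat (int p)"
    using matrix_inv_mult[OF inv] matp
    by (simp_all add: real_mat_eq_iff[symmetric] real_mat_mult P(2)[symmetric] matrix_mult_scaleR)
  have P_pos: "pos_def (real_mat P)"
    unfolding pos_def_def
  proof (intro conjI allI impI)
    have "P $ i $ j = P $ j $ i" for i j
    proof -
      have "transpose P $ j $ i = P $ j $ i" using P(1) by (simp add: even_integral_def)
      then show ?thesis by (simp add: transpose_def)
    qed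
    then show "transpose (real_mat P) = real_mat P"
      by (simp add: vec_eq_iff transpose_def map_matrix_def)
    fix x :: "real^4" assume "x \<noteq> 0"
    \<comment> \<open>With x = Q y, the value of P at x is p times the value of Q at y.\<close>
    define y where "y = matrix_inv (real_mat Q) *v x"
    have x: "real_mat Q *v y = x" by (simp add: y_def matrix_inv_mult_vec(2)[OF inv])
    have "y \<noteq> 0" using x \<open>x \<noteq> 0\<close> by auto
    then have "y \<bullet> (real_mat Q *v y) > 0" using assms(4) by (simp add: pos_def_def)
    then show "x \<bullet> (real_mat P *v x) > 0"
      using p0 by (simp add: P(2)[symmetric] scaleR_matrix_vector_assoc[symmetric] x y_def[symmetric] inner_commute)
  qed
  have detQP: "det Q * det P = int p ^ 4"
    using arg_cong[OF QP, of det] by (simp add: det_mul det_mat_4)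
  obtain d where d: "det Q = d\<^sup>2" using assms(6) by blast
  \<comment> \<open>Divisibility passes from squares to their roots, so d divides p^2 and det Q is
    1, p^2 or p^4.\<close>
  have "d\<^sup>2 dvd (int p ^ 2)\<^sup>2"
    using detQP by (simp add: d flip: power_mult) (metis dvd_triv_left)
  then have "d dvd int (p ^ 2)"
    by (simp only: pow_divides_pow_iff[OF zero_less_numeral] of_nat_power)
  then have "nat \<bar>d\<bar> dvd p ^ 2"
    by (simp only: nat_abs_dvd_iff)
  then obtain i where i: "i \<le> 2" "nat \<bar>d\<bar> = p ^ i"
    using divides_primepow_nat[OF assms(1)] by blast
  have dQ: "det Q = int p ^ (2 * i)"
  proof -
    have "\<bar>d\<bar> = int p ^ i" using i(2) by (metis abs_ge_zero int_nat_eq of_nat_power)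
    then have "\<bar>d\<bar>\<^sup>2 = int p ^ (2 * i)" by (simp add: power_mult[symmetric] mult.commute)
    then show ?thesis by (simp add: d)
  qed
  \<comment> \<open>For i = 0 the form Q itself would be even unimodular; for i = 2 the form P would
    be.\<close>
  have "i \<noteq> 0"
    using no_even_unimodular_4[OF assms(3,4)] dQ by (metis mult_0_right power_0)
  moreover have "i \<noteq> 2"
  proof
    assume "i = 2"
    then have "det P = 1" using detQP dQ p0 by simp
    then show False using no_even_unimodular_4[OF P(1) P_pos] by simp
  qed
  ultimately have i: "i = 1" using i by simp
  have dQ: "det Q = (int p)\<^sup>2" using dQ i by simp
  have "(int p)\<^sup>2 * det P = (int p)\<^sup>2 * (int p)\<^sup>2" using detQP dQ by (simp flip: power_add)
  then have dP: "det P = (int p)\<^sup>2" using p0 by (subst (asm) mult_left_cancel) auto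
  interpret level_pair p Q P
    by unfold_locales (use assms P P_pos QP PQ dQ dP in auto)
  show "Tr_op 2 p (theta2 Q) \<Omega> = 0"
    unfolding \<Omega>(1) by (rule Tr_op_theta2) (use \<Omega> in \<open>simp add: h2_def\<close>)
qed

end
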